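(* Let $u$ be the solution of the semilinear problem $-\varepsilon\Delta u+g(\cdot,u)=0$ in $\Omega=(0,1)\times(0,1)$, $u=0$ on $\partial\Omega$, where $g$ is sufficiently smooth and $\partial_2 g\ge\mu>0$. Suppose there is a constant $C_0$ independent of $\varepsilon$ and $N$ such that the Lagrange interpolant $u^I\in V^N$ of $u$ satisfies $$\|u-u^I\|_0\le C_0N^{-2},\qquad \varepsilon^{1/4}|u-u^I|_1\le C_0N^{-1}\ln N,$$ $$\|u-u^I\|_{\infty,\Omega_0}\le C_0N^{-2},\qquad \|u-u^I\|_{\infty,\Omega\setminus\Omega_0}\le C_0(N^{-1}\ln N)^2 .$$ Let $u^N\in V^N$ be the Galerkin finite element solution with linear or bilinear elements on the Shishkin mesh. Then there is a constant $C$ independent of $\varepsilon$ and $N$ such that $$\varepsilon^{1/4}|u-u^N|_1+\|u-u^N\|_0\le C\left(N^{-1}(\ln N)^{3/2}+N^{-2}\right).$$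
   Context: Here $0<\varepsilon\ll1$ is a small parameter, and $\partial_2 g$ is the derivative of $g$ with respect to its second argument (the value of $u$). The weak solution $u\in V=H_0^1(\Omega)$ satisfies $\varepsilon(\nabla u,\nabla v)+(g(\cdot,u),v)=0$ for all $v\in V$; the Galerkin solution $u^N\in V^N$ satisfies $\varepsilon(\nabla u^N,\nabla v)+(g(\cdot,u^N),v)=0$ for all $v\in V^N$. Norms: $(\cdot,\cdot)$ and $\|\cdot\|_0$ are the $L_2(\Omega)$ inner product and norm, $|\cdot|_1$ the $H^1(\Omega)$ seminorm, $\|\cdot\|_{\infty,D}$ the $L_\infty(D)$ norm. Mesh: $N$ is a positive integer divisible by 4, and $\lambda=\min\{1/4,\lambda_0\sqrt{\varepsilon/c^*}\,\ln N\}$ with $\lambda_0=2$ and a fixed $0<c^*<\mu$. The Shishkin mesh $\Omega^N$ is the tensor product of two identical one-dimensional meshes on $[0,1]$, each dividing $[0,\lambda]$ and $[1-\lambda,1]$ uniformly into $N/4$ intervals each and $[\lambda,1-\lambda]$ uniformly into $N/2$ intervals. Put $\Omega_0=(\lambda,1-\lambda)\times(\lambda,1-\lambda)$. Finite element space: $V^N\subset H_0^1(\Omega)$ is either the space of continuous piecewise bilinear functions on the rectangles of $\Omega^N$, or the space of continuous piecewise linear functions on the triangulation obtained from $\Omega^N$ by drawing diagonals, vanishing on $\partial\Omega$. *)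

theory Defs
  imports "HOL-Analysis.Analysis" "HOL-Probability.Essential_Supremum"
begin

definition L2 :: "'a::euclidean_space set \<Rightarrow> ('a \<Rightarrow> real) set" where
  "L2 D = {f. f \<in> borel_measurable (lebesgue_on D) \<and> integrable (lebesgue_on D) (\<lambda>x. (f x)\<^sup>2)}"

definition inner_L2 :: "'a::euclidean_space set \<Rightarrow> ('a \<Rightarrow> real) \<Rightarrow> ('a \<Rightarrow> real) \<Rightarrow> real" where
  "inner_L2 D f h = (LINT x | lebesgue_on D. f x * h x)"

definition norm_L2 :: "'a::euclidean_space set \<Rightarrow> ('a \<Rightarrow> real) \<Rightarrow> real" where
  "norm_L2 D f = sqrt (inner_L2 D f f)"

definition norm_Linf :: "'a::euclidean_space set \<Rightarrow> ('a \<Rightarrow> real) \<Rightarrow> ereal" where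
  "norm_Linf D f = esssup (lebesgue_on D) (\<lambda>x. ereal \<bar>f x\<bar>)"

primrec C_k :: "nat \<Rightarrow> ('a::euclidean_space \<Rightarrow> real) \<Rightarrow> bool" where
  "C_k 0 f \<longleftrightarrow> continuous_on UNIV f"
| "C_k (Suc k) f \<longleftrightarrow>
     (\<forall>x. f differentiable (at x)) \<and> (\<forall>b\<in>Basis. C_k k (\<lambda>x. frechet_derivative f (at x) b))"

definition test_function :: "'a::euclidean_space set \<Rightarrow> ('a \<Rightarrow> real) \<Rightarrow> bool" where
  "test_function D \<phi> \<longleftrightarrow>
     (\<forall>k. C_k k \<phi>) \<and> compact (closure {x. \<phi> x \<noteq> 0}) \<and> closure {x. \<phi> x \<noteq> 0} \<subseteq> D"

definition is_weak_partial ::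
    "'a::euclidean_space set \<Rightarrow> 'a \<Rightarrow> ('a \<Rightarrow> real) \<Rightarrow> ('a \<Rightarrow> real) \<Rightarrow> bool" where
  "is_weak_partial D b f h \<longleftrightarrow>
     (\<forall>\<phi>. test_function D \<phi> \<longrightarrow>
        inner_L2 D f (\<lambda>x. frechet_derivative \<phi> (at x) b) = - inner_L2 D h \<phi>)"

definition H1 :: "'a::euclidean_space set \<Rightarrow> ('a \<Rightarrow> real) set" where
  "H1 D = {f \<in> L2 D. \<forall>b\<in>Basis. \<exists>h\<in>L2 D. is_weak_partial D b f h}"

text \<open>Weak derivatives are unique only almost everywhere; we pick one representative, and
  use it only under integrals. It is meaningful for functions in \<open>H1 D\<close>.\<close>

definition weak_partial :: "'a::euclidean_space set \<Rightarrow> 'a \<Rightarrow> ('a \<Rightarrow> real) \<Rightarrow> 'a \<Rightarrow> real" where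
  "weak_partial D b f = (SOME h. h \<in> L2 D \<and> is_weak_partial D b f h)"

definition inner_grad :: "'a::euclidean_space set \<Rightarrow> ('a \<Rightarrow> real) \<Rightarrow> ('a \<Rightarrow> real) \<Rightarrow> real" where
  "inner_grad D f h = (\<Sum>b\<in>Basis. inner_L2 D (weak_partial D b f) (weak_partial D b h))"

definition seminorm_H1 :: "'a::euclidean_space set \<Rightarrow> ('a \<Rightarrow> real) \<Rightarrow> real" where
  "seminorm_H1 D f = sqrt (inner_grad D f f)"

definition H1_0 :: "'a::euclidean_space set \<Rightarrow> ('a \<Rightarrow> real) set" where
  "H1_0 D = {f \<in> H1 D. \<exists>\<phi>. (\<forall>n::nat. test_function D (\<phi> n)) \<and>
      (\<lambda>n. norm_L2 D (\<lambda>x. f x - \<phi> n x)) \<longlonglongrightarrow> 0 \<and>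
      (\<lambda>n. seminorm_H1 D (\<lambda>x. f x - \<phi> n x)) \<longlonglongrightarrow> 0}"

definition unit_square :: "(real \<times> real) set" where
  "unit_square = {0<..<1} \<times> {0<..<1}"

text \<open>With \<open>W = H1_0 unit_square\<close> this is the weak solution, with a finite element space \<open>W\<close>
  the Galerkin solution.\<close>

definition variational_solution ::
    "real \<Rightarrow> (real \<times> real \<Rightarrow> real \<Rightarrow> real) \<Rightarrow> (real \<times> real \<Rightarrow> real) set \<Rightarrow> (real \<times> real \<Rightarrow> real) \<Rightarrow> bool"
  where
  "variational_solution \<epsilon> g W w \<longleftrightarrow> w \<in> W \<and>
     (\<forall>v\<in>W. \<epsilon> * inner_grad unit_square w v + inner_L2 unit_square (\<lambda>x. g x (w x)) v = 0)"

definition transition_point :: "real \<Rightarrow> real \<Rightarrow> nat \<Rightarrow> real" where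
  "transition_point cstar \<epsilon> N = min (1/4) (2 * sqrt (\<epsilon> / cstar) * ln (real N))"

text \<open>\<open>i\<close>-th node (\<open>0 \<le> i \<le> N\<close>) of the one-dimensional mesh with transition points \<open>l\<close> and
  \<open>1 - l\<close>; \<open>N\<close> is meant to be divisible by 4.\<close>

definition mesh_pt :: "real \<Rightarrow> nat \<Rightarrow> nat \<Rightarrow> real" where
  "mesh_pt l N i =
     (if i \<le> N div 4 then real i * (l / (real N / 4))
      else if i \<le> 3 * (N div 4) then l + (real i - real N / 4) * ((1 - 2 * l) / (real N / 2))
      else (1 - l) + (real i - 3 * real N / 4) * (l / (real N / 4)))"

definition coarse_region :: "real \<Rightarrow> (real \<times> real) set" where
  "coarse_region l = {l<..<1 - l} \<times> {l<..<1 - l}"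

definition mesh_rectangle :: "real \<Rightarrow> nat \<Rightarrow> nat \<Rightarrow> nat \<Rightarrow> (real \<times> real) set" where
  "mesh_rectangle l N i j =
     {mesh_pt l N i..mesh_pt l N (Suc i)} \<times> {mesh_pt l N j..mesh_pt l N (Suc j)}"

text \<open>The two triangles of rectangle \<open>(i, j)\<close>; \<open>d\<close> tells which of its diagonals is drawn.\<close>

definition mesh_triangles :: "bool \<Rightarrow> real \<Rightarrow> nat \<Rightarrow> nat \<Rightarrow> nat \<Rightarrow> (real \<times> real) set set" where
  "mesh_triangles d l N i j =
     (let sw = (mesh_pt l N i, mesh_pt l N j);
          se = (mesh_pt l N (Suc i), mesh_pt l N j);
          nw = (mesh_pt l N i, mesh_pt l N (Suc j));
          ne = (mesh_pt l N (Suc i), mesh_pt l N (Suc j))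
      in if d then {convex hull {sw, ne, se}, convex hull {sw, ne, nw}}
         else {convex hull {se, nw, sw}, convex hull {se, nw, ne}})"

definition bilinear_on :: "(real \<times> real) set \<Rightarrow> (real \<times> real \<Rightarrow> real) \<Rightarrow> bool" where
  "bilinear_on T v \<longleftrightarrow> (\<exists>a b c e. \<forall>(x, y)\<in>T. v (x, y) = a + b * x + c * y + e * x * y)"

definition linear_fun_on :: "(real \<times> real) set \<Rightarrow> (real \<times> real \<Rightarrow> real) \<Rightarrow> bool" where
  "linear_fun_on T v \<longleftrightarrow> (\<exists>a b c. \<forall>(x, y)\<in>T. v (x, y) = a + b * x + c * y)"

text \<open>Only the values on the closed unit square matter.\<close>

definition bilinear_space :: "real \<Rightarrow> nat \<Rightarrow> (real \<times> real \<Rightarrow> real) set" where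
  "bilinear_space l N = {v. continuous_on (closure unit_square) v \<and>
     (\<forall>z\<in>frontier unit_square. v z = 0) \<and>
     (\<forall>i<N. \<forall>j<N. bilinear_on (mesh_rectangle l N i j) v)}"

definition linear_space ::
    "(nat \<Rightarrow> nat \<Rightarrow> bool) \<Rightarrow> real \<Rightarrow> nat \<Rightarrow> (real \<times> real \<Rightarrow> real) set" where
  "linear_space d l N = {v. continuous_on (closure unit_square) v \<and>
     (\<forall>z\<in>frontier unit_square. v z = 0) \<and>
     (\<forall>i<N. \<forall>j<N. \<forall>T\<in>mesh_triangles (d i j) l N i j. linear_fun_on T v)}"

definition lagrange_interpolant ::
    "real \<Rightarrow> nat \<Rightarrow> (real \<times> real \<Rightarrow> real) set \<Rightarrow> (real \<times> real \<Rightarrow> real) \<Rightarrow> (real \<times> real \<Rightarrow> real) \<Rightarrow> bool"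
  where
  "lagrange_interpolant l N W f w \<longleftrightarrow> w \<in> W \<and>
     (\<forall>i\<le>N. \<forall>j\<le>N. w (mesh_pt l N i, mesh_pt l N j) = f (mesh_pt l N i, mesh_pt l N j))"

end

theory Submission
  imports Defs
begin

text \<open>Write \<open>u - uN = \<theta> + \<xi>\<close> with \<open>\<theta> = u - uI\<close> and \<open>\<xi> = uI - uN\<close> in the finite element space.
  Testing the difference of the two variational equations with \<open>\<xi>\<close>, monotonicity of \<open>g\<close> gives
  \<open>\<epsilon> |\<xi>|_1^2 + \<mu> \<parallel>\<xi>\<parallel>^2 \<le> \<epsilon> |\<theta>|_1^2 + C \<parallel>\<theta>\<parallel>^2\<close>. This settles the case \<open>sqrt \<epsilon> * N^2 \<ge> 1\<close>; otherwise it
  still yields \<open>\<parallel>\<xi>\<parallel> \<le> C ln N / N^2\<close>. In that case let \<open>z\<close> be the finite element function with the nodal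
  values of \<open>- \<xi>\<close> on the closed coarse region and \<open>0\<close> at the other nodes. Outside the coarse region
  \<open>z\<close> lives on a single layer of elements of width \<open>h\<close>, much smaller than the coarse width \<open>H\<close>, so
  there \<open>\<parallel>z\<parallel>^2 \<le> C (h / H) \<parallel>\<xi>\<parallel>^2\<close>, while \<open>|z|_1^2 \<le> C \<parallel>\<xi>\<parallel>^2 / (h H)\<close> everywhere. Testing with \<open>\<xi> + z\<close>,
  which vanishes on the coarse region, leaves only integrals over the fine region, whose measure is
  of order \<open>sqrt \<epsilon> * ln N\<close>; the gained powers of \<open>\<epsilon>\<close> are what the balanced norm needs.
  The finite element space is contained in \<open>H1_0\<close> because a dilated and mollified element function
  is a test function whose gradient converges pointwise off the mesh lines.\<close>

section \<open>Smooth functions\<close>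

text \<open>The energy norm weights the gradient by eps^(1/2), the balanced norm only by eps^(1/4).
  Dividing the first estimate by sqrt eps leaves a reaction term of size N^-4 / sqrt eps, which is
  not bounded uniformly in eps, so a factor sqrt eps has to be found inside that term. The measure
  of the fine region supplies it for the interpolation error, because the transition point is at
  most a multiple of sqrt eps * ln N; for \<open>z\<close> it comes from the ratio h / H. One ln N
  from the transition point together with (ln N / N)^2 yields, after taking the root, the power 3/2.

  \<open>g\<close> is Lipschitz in its second argument only on bounded sets, and no maximum norm
  bound for \<open>uN\<close> is at hand. Therefore g(u) - g(uN) is split at an element function w:
  monotonicity alone handles g(w) - g(uN), and only g(u) - g(w), with both arguments bounded, uses a
  Lipschitz constant. This calls for maximum norm bounds, uniform in eps and N, for
  \<open>u\<close>, \<open>uI\<close> and \<open>uI + z\<close>.\<close>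

abbreviation partial :: "'a::euclidean_space \<Rightarrow> ('a \<Rightarrow> real) \<Rightarrow> 'a \<Rightarrow> real" where
  "partial b f x \<equiv> frechet_derivative f (at x) b"

text \<open>Lets smoothness be shown from any explicit derivative, uniqueness identifying it with
  \<open>frechet_derivative\<close>.\<close>

lemma C_k_SucI:
  assumes "\<And>x. (f has_derivative D x) (at x)" and "\<And>b. b \<in> Basis \<Longrightarrow> C_k k (\<lambda>x. D x b)"
  shows "C_k (Suc k) f"
proof -
  have "frechet_derivative f (at x) = D x" for x
    using frechet_derivative_at[OF assms(1)[of x]] by simp
  then show ?thesis
    using assms by (auto simp: differentiable_def)
qed

lemma C_k_SucD: "C_k (Suc k) f \<Longrightarrow> C_k k f"
proof (induction k arbitrary: f)
  case 0
  then show ?case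
    by (auto simp: continuous_on_eq_continuous_at intro: differentiable_imp_continuous_within)
next
  case (Suc k)
  have "C_k (Suc k) (\<lambda>x. partial b f x)" if "b \<in> Basis" for b
    using Suc.prems that by simp
  then show ?case
    using Suc.prems Suc.IH by (metis C_k.simps(2))
qed

lemma C_k_continuous: "C_k k f \<Longrightarrow> continuous_on UNIV f"
  by (induction k) (auto dest: C_k_SucD simp del: C_k.simps(2))

lemma C_k_has_derivative:
  assumes "C_k (Suc k) f" shows "(f has_derivative frechet_derivative f (at x)) (at x)"
  using assms by (simp add: frechet_derivative_works)

lemma C_k_const: "C_k k (\<lambda>x::'a::euclidean_space. c)"
proof (induction k arbitrary: c)
  case (Suc k)
  show ?case
    by (rule C_k_SucI[where D = "\<lambda>x h. 0"]) (use Suc in auto)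
qed simp

lemma C_k_add: "C_k k f \<Longrightarrow> C_k k h \<Longrightarrow> C_k k (\<lambda>x. f x + h x)"
proof (induction k arbitrary: f h)
  case (Suc k)
  show ?case
    by (rule C_k_SucI, rule has_derivative_add[OF C_k_has_derivative C_k_has_derivative])
      (use Suc in auto)
qed (auto intro: continuous_intros)

lemma C_k_mult: "C_k k f \<Longrightarrow> C_k k h \<Longrightarrow> C_k k (\<lambda>x. f x * h x)"
proof (induction k arbitrary: f h)
  case (Suc k)
  show ?case
  proof (rule C_k_SucI, rule has_derivative_mult[OF C_k_has_derivative C_k_has_derivative])
    fix b :: 'a assume b: "b \<in> Basis"
    show "C_k k (\<lambda>x. f x * partial b h x + partial b f x * h x)"
      using Suc.prems b Suc.prems[THEN C_k_SucD] by (intro C_k_add Suc.IH) auto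
  qed (use Suc in auto)
qed (auto intro: continuous_intros)

subsection \<open>A smooth bump\<close>

text \<open>The extra power of \<open>x\<close> makes the family closed under differentiation up to
  linear combinations, so that smoothness is an induction with \<open>n\<close> arbitrary.\<close>

definition flat :: "nat \<Rightarrow> real \<Rightarrow> real" where
  "flat n x = (if x > 0 then exp (- (1 / x)) / x ^ n else 0)"

lemma flat_nonneg: "0 \<le> flat n x" and flat_pos: "x > 0 \<Longrightarrow> 0 < flat n x"
  and flat_zero: "x \<le> 0 \<Longrightarrow> flat n x = 0"
  by (auto simp: flat_def)

lemma flat_tendsto_0: "(flat n \<longlongrightarrow> 0) (at_right 0)"
proof -
  have "((\<lambda>y::real. y ^ n / exp y) \<longlongrightarrow> 0) at_top"
    by (rule tendsto_power_div_exp_0)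
  moreover have "filterlim (\<lambda>x::real. inverse x) at_top (at_right 0)"
    by (rule filterlim_inverse_at_top_right)
  ultimately have "((\<lambda>x::real. inverse x ^ n / exp (inverse x)) \<longlongrightarrow> 0) (at_right 0)"
    by (rule filterlim_compose)
  moreover have "\<forall>\<^sub>F x::real in at_right 0. inverse x ^ n / exp (inverse x) = flat n x"
    by (auto simp: eventually_at_right_field flat_def exp_minus field_simps intro!: exI[of _ 1])
  ultimately show ?thesis
    by (rule Lim_transform_eventually)
qed

lemma flat_has_derivative:
  "(flat n has_real_derivative flat (n + 2) x - real n * flat (n + 1) x) (at x)"
proof (cases x "0::real" rule: linorder_cases)
  case less
  have "(flat n has_real_derivative 0) (at x)"
    by (rule has_field_derivative_transform_within_open[of "\<lambda>_. 0" _ _ "{..<0}"])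
      (use less in \<open>auto simp: flat_def\<close>)
  then show ?thesis using less by (simp add: flat_def)
next
  case equal
  \<comment> \<open>For y > 0 the difference quotient at 0 is \<open>flat (Suc n) y\<close>, so the
    limit of the next member of the family gives the one-sided derivative.\<close>
  have "((\<lambda>y. (flat n y - flat n 0) / (y - 0)) \<longlongrightarrow> 0) (at_right 0)"
  proof (rule Lim_transform_eventually[OF flat_tendsto_0[of "Suc n"]])
    show "\<forall>\<^sub>F y in at_right 0. flat (Suc n) y = (flat n y - flat n 0) / (y - 0)"
      by (auto simp: eventually_at_right_field flat_def field_simps intro!: exI[of _ 1])
  qed
  moreover have "((\<lambda>y. (flat n y - flat n 0) / (y - 0)) \<longlongrightarrow> 0) (at_left 0)"
  proof (rule Lim_transform_eventually[of "\<lambda>_. 0"])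
    show "\<forall>\<^sub>F y in at_left 0. 0 = (flat n y - flat n 0) / (y - 0)"
      by (auto simp: eventually_at_left_field flat_def field_simps intro!: exI[of _ "-1"])
  qed auto
  ultimately have "((\<lambda>y. (flat n y - flat n 0) / (y - 0)) \<longlongrightarrow> 0) (at 0)"
    by (simp add: filterlim_at_split)
  then show ?thesis
    using equal by (simp add: has_field_derivative_iff flat_def)
next
  case greater
  have "((\<lambda>x. exp (- (1 / x)) / x ^ n) has_real_derivative
      flat (n + 2) x - real n * flat (n + 1) x) (at x)"
  proof -
    have "((\<lambda>x. exp (- (1 / x)) / x ^ n) has_real_derivative
      (exp (- (1 / x)) * (1 / x\<^sup>2) * x ^ n - exp (- (1 / x)) * (real n * x ^ (n - 1))) / (x ^ n * x ^ n)) (at x)"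
      by (rule derivative_eq_intros refl | use greater in \<open>simp add: power2_eq_square\<close>)+
    moreover have "(exp (- (1 / x)) * (1 / x\<^sup>2) * x ^ n - exp (- (1 / x)) * (real n * x ^ (n - 1))) / (x ^ n * x ^ n)
       = flat (n + 2) x - real n * flat (n + 1) x"
      using greater by (cases n) (auto simp: flat_def field_simps power2_eq_square)
    ultimately show ?thesis by simp
  qed
  then show ?thesis
    by (rule has_field_derivative_transform_within_open[of _ _ _ "{0<..}"])
      (use greater in \<open>auto simp: flat_def\<close>)
qed

text \<open>The affine argument covers all four factors of \<open>bump\<close> at once.\<close>

lemma C_k_flat: "C_k k (\<lambda>p::'a::euclidean_space. flat n (c + inner a p))"
proof (induction k arbitrary: n)
  case 0
  have "continuous_on UNIV (flat n)"
    by (rule DERIV_continuous_on, rule has_field_derivative_at_within, rule flat_has_derivative)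
  then have "continuous_on UNIV (\<lambda>p::'a. flat n (c + inner a p))"
    by (rule continuous_on_compose2) (auto intro!: continuous_intros)
  then show ?case by simp
next
  case (Suc k)
  show ?case
  proof (rule C_k_SucI)
    fix p :: 'a
    show "((\<lambda>p. flat n (c + inner a p)) has_derivative
        (\<lambda>b. inner a b * (flat (n + 2) (c + inner a p) - real n * flat (n + 1) (c + inner a p)))) (at p)"
      by (rule has_derivative_eq_rhs,
          rule has_derivative_compose[OF _ flat_has_derivative[unfolded has_field_derivative_def]])
        (auto intro!: derivative_eq_intros)
  next
    fix b :: 'a
    have "C_k k (\<lambda>p. inner a b * (flat (n + 2) (c + inner a p) + (- real n) * flat (n + 1) (c + inner a p)))"
      by (intro C_k_mult C_k_add C_k_const Suc.IH)
    then show "C_k k (\<lambda>p. inner a b * (flat (n + 2) (c + inner a p) - real n * flat (n + 1) (c + inner a p)))"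
      by simp
  qed
qed

text \<open>One factor for each side of the square with centre 0 and half side 1 / m, outside of
  which the product vanishes (for m > 0).\<close>

definition bump :: "real \<Rightarrow> real \<times> real \<Rightarrow> real" where
  "bump m z = flat 0 (1 + m * fst z) * flat 0 (1 - m * fst z) *
     (flat 0 (1 + m * snd z) * flat 0 (1 - m * snd z))"

lemma C_k_bump: "C_k k (bump m)"
proof -
  have "C_k k (\<lambda>z::real\<times>real. flat 0 (1 + inner (m, 0) z) * flat 0 (1 + inner (- m, 0) z) *
     (flat 0 (1 + inner (0, m) z) * flat 0 (1 + inner (0, - m) z)))"
    by (intro C_k_mult C_k_flat)
  moreover have "(\<lambda>z::real\<times>real. flat 0 (1 + inner (m, 0) z) * flat 0 (1 + inner (- m, 0) z) *
     (flat 0 (1 + inner (0, m) z) * flat 0 (1 + inner (0, - m) z))) = bump m"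
    by (auto simp: bump_def inner_prod_def fun_eq_iff)
  ultimately show ?thesis by metis
qed

lemma bump_nonneg: "0 \<le> bump m z"
  by (simp add: bump_def flat_nonneg)

lemma bump_eq_0:
  assumes "0 < m" "1 / m \<le> \<bar>fst z\<bar> \<or> 1 / m \<le> \<bar>snd z\<bar>" shows "bump m z = 0"
proof -
  have "1 + m * t \<le> 0 \<or> 1 - m * t \<le> 0" if "1 / m \<le> \<bar>t\<bar>" for t
    using that \<open>0 < m\<close> by (auto simp: field_simps abs_if split: if_splits)
  from this[of "fst z"] this[of "snd z"] show ?thesis
    using assms(2) by (auto simp: bump_def flat_zero)
qed

lemma bump_0_pos: "0 < bump m 0"
  by (simp add: bump_def flat_pos)

section \<open>Square integrable functions\<close>

lemma L2_measurable: "f \<in> L2 D \<Longrightarrow> f \<in> borel_measurable (lebesgue_on D)"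
  and L2_integrable_square: "f \<in> L2 D \<Longrightarrow> integrable (lebesgue_on D) (\<lambda>x. (f x)\<^sup>2)"
  by (auto simp: L2_def)

lemma L2_integrable_mult:
  assumes "f \<in> L2 D" "h \<in> L2 D"
  shows "integrable (lebesgue_on D) (\<lambda>x. f x * h x)"
proof (rule Bochner_Integration.integrable_bound)
  show "integrable (lebesgue_on D) (\<lambda>x. (f x)\<^sup>2 + (h x)\<^sup>2)"
    using assms by (intro Bochner_Integration.integrable_add L2_integrable_square)
  show "(\<lambda>x. f x * h x) \<in> borel_measurable (lebesgue_on D)"
    using assms[THEN L2_measurable] by (rule borel_measurable_times)
  have "\<bar>a * b\<bar> \<le> a\<^sup>2 + b\<^sup>2" for a b :: real
    using sum_squares_bound[of "\<bar>a\<bar>" "\<bar>b\<bar>"] mult_nonneg_nonneg[of "\<bar>a\<bar>" "\<bar>b\<bar>"]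
    unfolding abs_mult power2_abs by linarith
  then show "AE x in lebesgue_on D. norm (f x * h x) \<le> norm ((f x)\<^sup>2 + (h x)\<^sup>2)"
    by simp
qed

lemma L2_add: assumes "f \<in> L2 D" "h \<in> L2 D" shows "(\<lambda>x. f x + h x) \<in> L2 D"
proof -
  have "integrable (lebesgue_on D) (\<lambda>x. (f x)\<^sup>2 + (h x)\<^sup>2 + 2 * (f x * h x))"
    using assms by (intro Bochner_Integration.integrable_add L2_integrable_square
      Bochner_Integration.integrable_mult_right L2_integrable_mult)
  then show ?thesis
    using assms[THEN L2_measurable] by (auto simp: L2_def power2_sum algebra_simps)
qed

lemma L2_cmult: "f \<in> L2 D \<Longrightarrow> (\<lambda>x. c * f x) \<in> L2 D"
  by (auto simp: L2_def power_mult_distrib)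

lemma L2_diff: assumes "f \<in> L2 D" "h \<in> L2 D" shows "(\<lambda>x. f x - h x) \<in> L2 D"
  using L2_add[OF assms(1) L2_cmult[OF assms(2), of "-1"]] by simp

lemma L2_bounded:
  assumes "D \<in> lmeasurable" "f \<in> borel_measurable (lebesgue_on D)" "AE x in lebesgue_on D. \<bar>f x\<bar> \<le> M"
  shows "f \<in> L2 D"
proof -
  interpret finite_measure "lebesgue_on D"
    using assms(1) by (rule finite_measure_lebesgue_on)
  have "AE x in lebesgue_on D. norm ((f x)\<^sup>2) \<le> M\<^sup>2"
    using assms(3)
  proof eventually_elim
    case (elim x)
    then show ?case by (simp add: abs_le_square_iff[symmetric])
  qed
  then have "integrable (lebesgue_on D) (\<lambda>x. (f x)\<^sup>2)"
    using assms(2) by (intro integrable_const_bound) auto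
  then show ?thesis using assms(2) by (simp add: L2_def)
qed

lemma L2_integrable:
  assumes "D \<in> lmeasurable" "f \<in> L2 D" shows "integrable (lebesgue_on D) f"
  using L2_integrable_mult[OF assms(2) L2_bounded[OF assms(1), of "\<lambda>_. 1" 1]] by simp

lemma inner_L2_add_left:
  "f \<in> L2 D \<Longrightarrow> f' \<in> L2 D \<Longrightarrow> h \<in> L2 D \<Longrightarrow>
    inner_L2 D (\<lambda>x. f x + f' x) h = inner_L2 D f h + inner_L2 D f' h"
  by (simp add: inner_L2_def distrib_right L2_integrable_mult)

lemma inner_L2_cmult_left: "inner_L2 D (\<lambda>x. c * f x) h = c * inner_L2 D f h"
  by (simp add: inner_L2_def mult.assoc)

lemma inner_L2_commute: "inner_L2 D f h = inner_L2 D h f"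
  by (simp add: inner_L2_def mult.commute)

lemma inner_L2_self_nonneg: "0 \<le> inner_L2 D f f"
  by (simp add: inner_L2_def)

lemma inner_L2_add_self_le:
  assumes "f \<in> L2 D" "h \<in> L2 D"
  shows "inner_L2 D (\<lambda>x. f x + h x) (\<lambda>x. f x + h x) \<le> 2 * inner_L2 D f f + 2 * inner_L2 D h h"
proof -
  have "inner_L2 D (\<lambda>x. f x + h x) (\<lambda>x. f x + h x) \<le> (LINT x|lebesgue_on D. 2 * (f x * f x) + 2 * (h x * h x))"
    unfolding inner_L2_def
  proof (rule integral_mono)
    show "integrable (lebesgue_on D) (\<lambda>x. (f x + h x) * (f x + h x))"
      by (intro L2_integrable_mult L2_add assms)
    show "integrable (lebesgue_on D) (\<lambda>x. 2 * (f x * f x) + 2 * (h x * h x))"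
      by (intro Bochner_Integration.integrable_add integrable_mult_right L2_integrable_mult assms)
    show "(f x + h x) * (f x + h x) \<le> 2 * (f x * f x) + 2 * (h x * h x)" for x
      using zero_le_power2[of "f x - h x"] by (simp add: power2_eq_square algebra_simps)
  qed
  also have "\<dots> = 2 * inner_L2 D f f + 2 * inner_L2 D h h"
    unfolding inner_L2_def using assms[THEN L2_integrable_mult, OF assms(1)] assms[THEN L2_integrable_mult, OF assms(2)]
    by (subst Bochner_Integration.integral_add) auto
  finally show ?thesis .
qed

lemma inner_L2_cong_AE:
  assumes "AE x in lebesgue_on D. f x = f' x" "AE x in lebesgue_on D. h x = h' x"
    and "f \<in> borel_measurable (lebesgue_on D)" "f' \<in> borel_measurable (lebesgue_on D)"
    and "h \<in> borel_measurable (lebesgue_on D)" "h' \<in> borel_measurable (lebesgue_on D)"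
  shows "inner_L2 D f h = inner_L2 D f' h'"
  unfolding inner_L2_def
proof (rule integral_cong_AE)
  show "AE x in lebesgue_on D. f x * h x = f' x * h' x"
    using assms(1,2) by eventually_elim simp
qed (use assms in auto)

section \<open>Mollification on the unit square\<close>

lemma unit_square_eq_box: "unit_square = box (0, 0) (1, 1)"
  by (auto simp: unit_square_def mem_box Basis_prod_def)

lemma closure_unit_square: "closure unit_square = cbox (0, 0) (1, 1)"
  unfolding unit_square_eq_box by (rule closure_box) (auto simp: box_eq_empty Basis_prod_def)

lemma open_unit_square: "open unit_square"
  by (simp add: unit_square_eq_box open_box)

lemma lmeasurable_unit_square: "unit_square \<in> lmeasurable"
  by (simp add: unit_square_eq_box)

lemma sets_unit_square: "unit_square \<in> sets lebesgue"
  using lmeasurable_unit_square by blast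

lemma unit_square_subset: "unit_square \<subseteq> cbox (0, 0) (1, 1)"
  using closure_subset closure_unit_square by metis

lemma mem_cbox_unit: "x \<in> cbox (0, 0) (1, 1) \<longleftrightarrow> fst x \<in> {0..1} \<and> snd x \<in> {0..1}" for x :: "real \<times> real"
  by (cases x) (auto simp: mem_box Basis_prod_def)

lemma measure_unit_square: "measure lebesgue unit_square = 1"
proof -
  have "measure lebesgue unit_square = measure lborel unit_square"
    by (rule measure_completion) (simp add: unit_square_eq_box)
  also have "\<dots> = 1"
    unfolding unit_square_eq_box by (subst measure_lborel_box_eq) (auto simp: Basis_prod_def)
  finally show ?thesis .
qed

lemma continuous_on_cbox_bound:
  fixes f :: "'a::euclidean_space \<Rightarrow> real"
  assumes "continuous_on (cbox a b) f"
  obtains A where "\<And>x. x \<in> cbox a b \<Longrightarrow> norm (f x) \<le> A"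
proof -
  have "bounded (f ` cbox a b)"
    by (intro compact_imp_bounded compact_continuous_image assms compact_cbox)
  then show ?thesis
    using that by (auto simp: bounded_iff)
qed

lemma continuous_on_L2_unit_square:
  assumes "continuous_on (cbox (0, 0) (1, 1)) f" shows "f \<in> L2 unit_square"
proof -
  obtain M where "\<And>x. x \<in> cbox (0, 0) (1, 1) \<Longrightarrow> norm (f x) \<le> M"
    using continuous_on_cbox_bound[OF assms] by blast
  then have "AE x in lebesgue_on unit_square. \<bar>f x\<bar> \<le> M"
    using unit_square_subset by (intro AE_I2) auto
  moreover have "f \<in> borel_measurable (lebesgue_on unit_square)"
    using assms continuous_on_subset unit_square_subset
    by (intro continuous_imp_measurable_on_sets_lebesgue sets_unit_square) blast
  ultimately show ?thesis
    by (intro L2_bounded lmeasurable_unit_square)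
qed

subsection \<open>The kernel\<close>

lemma not_mem_cbox_pairD:
  "z \<notin> cbox (- 1 / m, - 1 / m) (1 / m, 1 / m) \<Longrightarrow> 1 / m \<le> \<bar>fst z\<bar> \<or> 1 / m \<le> \<bar>snd z\<bar>" for z :: "real \<times> real"
  by (cases z) (auto simp: mem_box Basis_prod_def abs_if)

lemma bump_integrable_pos:
  assumes "0 < m"
  shows "integrable lborel (bump m)" "0 < integral\<^sup>L lborel (bump m)"
proof -
  have cont: "continuous_on UNIV (bump m)"
    using C_k_continuous[OF C_k_bump[of 0]] .
  have supp: "bump m z = 0" if "z \<notin> cbox (- 1 / m, - 1 / m) (1 / m, 1 / m)" for z
    using that by (intro bump_eq_0[OF assms] not_mem_cbox_pairD)
  have ind: "indicator (cbox (- 1 / m, - 1 / m) (1 / m, 1 / m)) z *\<^sub>R bump m z = bump m z" for z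
    using supp[of z] unfolding indicator_def by fastforce
  show int: "integrable lborel (bump m)"
    using borel_integrable_compact[of "cbox (- 1 / m, - 1 / m) (1 / m, 1 / m)" "bump m"]
      continuous_on_subset[OF cont] by (simp only: ind compact_cbox subset_UNIV)
  have "integral\<^sup>L lborel (bump m) \<noteq> 0"
  proof
    assume "integral\<^sup>L lborel (bump m) = 0"
    then have "AE z in lborel. bump m z = 0"
      using int by (simp add: integral_nonneg_eq_0_iff_AE bump_nonneg)
    then have "AE z in lebesgue. bump m z = 0"
      by (rule AE_completion)
    moreover have op: "open {z. bump m z \<noteq> 0}"
      using cont by (simp add: open_Collect_neq)
    ultimately have "{z. bump m z \<noteq> 0} \<in> null_sets lebesgue"
      using borel_open[OF op] by (subst AE_iff_null_sets) auto
    then have "{z. bump m z \<noteq> 0} = {}"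
      using negligible_iff_null_sets open_not_negligible op by blast
    then have "bump m 0 = 0" by blast
    then show False using bump_0_pos[of m] by linarith
  qed
  moreover have "0 \<le> integral\<^sup>L lborel (bump m)"
    by (simp add: bump_nonneg)
  ultimately show "0 < integral\<^sup>L lborel (bump m)" by simp
qed

definition mollifier :: "real \<Rightarrow> real \<times> real \<Rightarrow> real" where
  "mollifier m z = bump m z / integral\<^sup>L lborel (bump m)"

lemma C_k_mollifier: "C_k k (mollifier m)"
  using C_k_mult[OF C_k_bump[of k m] C_k_const[of k "1 / integral\<^sup>L lborel (bump m)"]]
  by (simp add: mollifier_def[abs_def])

lemma mollifier_nonneg: "0 < m \<Longrightarrow> 0 \<le> mollifier m z"
  using bump_integrable_pos(2)[of m] by (simp add: mollifier_def bump_nonneg)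

lemma mollifier_eq_0: "0 < m \<Longrightarrow> 1 / m \<le> \<bar>fst z\<bar> \<or> 1 / m \<le> \<bar>snd z\<bar> \<Longrightarrow> mollifier m z = 0"
  by (simp add: mollifier_def bump_eq_0)

lemma continuous_mollifier: "continuous_on S (mollifier m)"
  using C_k_continuous[OF C_k_mollifier[of 0]] continuous_on_subset by blast

lemma mollifier_uminus: "mollifier m (- z) = mollifier m z"
  by (simp add: mollifier_def bump_def)

lemma mollifier_bounded:
  assumes "0 < m" obtains B where "\<And>z. \<bar>mollifier m z\<bar> \<le> B"
proof -
  let ?Q = "cbox (- 1 / m, - 1 / m) (1 / m, 1 / m)"
  obtain B where B: "\<And>x. x \<in> ?Q \<Longrightarrow> norm (mollifier m x) \<le> B"
    using continuous_on_cbox_bound[OF continuous_mollifier] by blast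
  have "mollifier m z = 0" if "z \<notin> ?Q" for z
    using that by (intro mollifier_eq_0[OF assms] not_mem_cbox_pairD)
  then have "\<bar>mollifier m z\<bar> \<le> max B 0" for z
    using B[of z] by (cases "z \<in> ?Q") auto
  then show ?thesis using that by blast
qed

lemma mollifier_reflected:
  assumes "0 < m"
  shows "integrable lborel (\<lambda>w. mollifier m (p - w))" "(LINT w|lborel. mollifier m (p - w)) = 1"
proof -
  have eq: "mollifier m (p - w) = mollifier m (- p + w)" for w
    using mollifier_uminus[of m "p - w"] by simp
  have int: "integrable lborel (mollifier m)"
    using bump_integrable_pos(1)[OF assms] by (simp add: mollifier_def[abs_def])
  have one: "integral\<^sup>L lborel (mollifier m) = 1"
    using bump_integrable_pos(2)[OF assms] by (simp add: mollifier_def[abs_def])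
  have meas: "mollifier m \<in> borel_measurable borel"
    by (intro borel_measurable_continuous_onI continuous_mollifier)
  have "integrable (distr lborel borel ((+) (- p))) (mollifier m)"
    using int by (simp only: lborel_distr_plus)
  then have "integrable lborel (\<lambda>w. mollifier m (- p + w))"
    by (subst (asm) integrable_distr_eq) (use meas in auto)
  then show "integrable lborel (\<lambda>w. mollifier m (p - w))"
    by (simp only: eq)
  have "integral\<^sup>L (distr lborel borel ((+) (- p))) (mollifier m) = 1"
    using one by (simp only: lborel_distr_plus)
  then show "(LINT w|lborel. mollifier m (p - w)) = 1"
    by (subst (asm) integral_distr) (use meas in \<open>auto simp: eq\<close>)
qed

text \<open>Near the boundary part of the kernel may leave the square and only the inequality is
  available, which suffices for maximum bounds; the equality is for interior points, where
  convergence is proved.\<close>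

lemma mollifier_reflected_on:
  assumes "0 < m" "S \<in> sets lebesgue"
  shows "integrable (lebesgue_on S) (\<lambda>w. mollifier m (p - w))"
    "(LINT w|lebesgue_on S. mollifier m (p - w)) \<le> 1"
    "\<lbrakk>\<And>w. w \<notin> S \<Longrightarrow> mollifier m (p - w) = 0\<rbrakk> \<Longrightarrow> (LINT w|lebesgue_on S. mollifier m (p - w)) = 1"
proof -
  have meas: "(\<lambda>w. mollifier m (p - w)) \<in> borel_measurable borel"
    by (intro borel_measurable_continuous_onI continuous_on_compose2[OF continuous_mollifier[of UNIV]])
      (auto intro!: continuous_intros)
  have leb: "integrable lebesgue (\<lambda>w. mollifier m (p - w))" "(LINT w|lebesgue. mollifier m (p - w)) = 1"
    using mollifier_reflected[OF assms(1), of p] meas by (auto simp: integrable_completion integral_completion)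
  show int: "integrable (lebesgue_on S) (\<lambda>w. mollifier m (p - w))"
    using integrable_mult_indicator[OF assms(2) leb(1)] assms(2)
    by (simp add: integrable_restrict_space)
  have eq: "(LINT w|lebesgue_on S. mollifier m (p - w)) = (LINT w|lebesgue. indicator S w *\<^sub>R mollifier m (p - w))"
    using assms(2) by (simp add: integral_restrict_space)
  have "(LINT w|lebesgue. indicator S w *\<^sub>R mollifier m (p - w)) \<le> (LINT w|lebesgue. mollifier m (p - w))"
    by (intro integral_mono integrable_mult_indicator leb assms)
      (auto simp: indicator_def mollifier_nonneg assms)
  then show "(LINT w|lebesgue_on S. mollifier m (p - w)) \<le> 1"
    by (simp add: eq leb)
  show "(LINT w|lebesgue_on S. mollifier m (p - w)) = 1" if "\<And>w. w \<notin> S \<Longrightarrow> mollifier m (p - w) = 0"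
  proof -
    have "indicator S w *\<^sub>R mollifier m (p - w) = mollifier m (p - w)" for w
      using that[of w] by (auto simp: indicator_def)
    then show ?thesis by (simp only: eq leb)
  qed
qed

subsection \<open>Convolutions are smooth\<close>

text \<open>Differentiation under the integral sign. The integral is the gauge integral over a
  closed box, for which \<open>leibniz_rule\<close> is stated; the argument
  \<open>s *\<^sub>R x + c\<close> accommodates the dilation in \<open>mollify\<close>.\<close>

lemma convolution_derivative:
  fixes f :: "'a::euclidean_space \<Rightarrow> real" and s :: real and c :: 'a
  assumes "\<And>k. C_k k Q" "continuous_on (cbox a b) f"
  defines "F \<equiv> \<lambda>x. integral (cbox a b) (\<lambda>w. Q (s *\<^sub>R x + c - w) * f w)"
  shows "F differentiable (at x)"
    and "i \<in> Basis \<Longrightarrow> partial i F x = integral (cbox a b) (\<lambda>w. (s * partial i Q (s *\<^sub>R x + c - w)) * f w)"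
proof -
  have dQ: "(Q has_derivative frechet_derivative Q (at x)) (at x)" for x
    using C_k_has_derivative[OF assms(1)[of 1, unfolded One_nat_def]] .
  have contQ: "continuous_on UNIV Q"
    using assms(1)[of 0] by simp
  have contp: "continuous_on UNIV (partial i Q)" if "i \<in> Basis" for i
    using assms(1)[of "Suc 0"] that by simp
  \<comment> \<open>The derivative of the integrand as a bounded linear function, expanded over
    \<open>Basis\<close> so that its joint continuity follows from that of the partial
    derivatives.\<close>
  define fx where "fx x w = (f w * s) *\<^sub>R (\<Sum>i\<in>Basis. partial i Q (s *\<^sub>R x + c - w) *\<^sub>R blinfun_inner_left i)" for x w
  have cfx: "continuous_on (UNIV \<times> cbox a b) (\<lambda>(x, w). fx x w)"
    unfolding split_def fx_def
    by (intro continuous_intros continuous_on_compose2[OF contp] continuous_on_compose2[OF assms(2)]) auto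
  have lin: "frechet_derivative Q (at y) (s *\<^sub>R h) = s * (\<Sum>i\<in>Basis. partial i Q y * inner h i)" for y h
  proof -
    have l: "linear (frechet_derivative Q (at y))"
      using dQ has_derivative_linear by blast
    have "frechet_derivative Q (at y) h = (\<Sum>i\<in>Basis. inner h i * partial i Q y)"
      using linear_sum[OF l, of "\<lambda>i. inner h i *\<^sub>R i" Basis]
      by (simp add: euclidean_representation linear_cmul[OF l])
    then show ?thesis
      by (simp add: linear_cmul[OF l] mult.commute)
  qed
  have der: "(F has_derivative integral (cbox a b) (fx x)) (at x)" for x
    unfolding F_def
  proof (rule leibniz_rule[of UNIV, simplified])
    fix x w assume "w \<in> cbox a b"
    have "((\<lambda>x. Q (s *\<^sub>R x + c - w)) has_derivative (\<lambda>h. frechet_derivative Q (at (s *\<^sub>R x + c - w)) (s *\<^sub>R h))) (at x)"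
      by (rule has_derivative_compose[OF _ dQ]) (auto intro!: derivative_eq_intros)
    then have "((\<lambda>x. Q (s *\<^sub>R x + c - w) * f w) has_derivative (\<lambda>h. frechet_derivative Q (at (s *\<^sub>R x + c - w)) (s *\<^sub>R h) * f w)) (at x)"
      by (rule has_derivative_mult_left)
    moreover have "(\<lambda>h. frechet_derivative Q (at (s *\<^sub>R x + c - w)) (s *\<^sub>R h) * f w) = blinfun_apply (fx x w)"
      by (auto simp: fun_eq_iff lin fx_def blinfun.scaleR_left blinfun.sum_left sum_distrib_left sum_distrib_right mult_ac inner_commute)
    ultimately show "((\<lambda>x. Q (s *\<^sub>R x + c - w) * f w) has_derivative blinfun_apply (fx x w)) (at x)"
      by simp
  next
    fix x show "(\<lambda>w. Q (s *\<^sub>R x + c - w) * f w) integrable_on cbox a b"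
      by (intro integrable_continuous continuous_intros continuous_on_compose2[OF contQ] assms(2)) auto
  qed (use cfx in auto)
  then show "F differentiable (at x)"
    by (auto simp: differentiable_def)
  assume i: "i \<in> Basis"
  have int: "fx x integrable_on cbox a b" for x
    unfolding fx_def
    by (intro integrable_continuous continuous_intros continuous_on_compose2[OF contp] assms(2)) auto
  have fxi: "blinfun_apply (fx x w) i = (s * partial i Q (s *\<^sub>R x + c - w)) * f w" for x w
  proof -
    have "(\<Sum>j\<in>Basis. partial j Q (s *\<^sub>R x + c - w) * inner i j) = (\<Sum>j\<in>Basis. if j = i then partial i Q (s *\<^sub>R x + c - w) else 0)"
      by (rule sum.cong) (use i in \<open>auto simp: inner_Basis\<close>)
    then show ?thesis
      using i by (simp add: fx_def blinfun.scaleR_left blinfun.sum_left inner_commute mult_ac)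
  qed
  have "blinfun_apply (integral (cbox a b) (fx x)) i = integral (cbox a b) (\<lambda>w. (s * partial i Q (s *\<^sub>R x + c - w)) * f w)"
    using integral_linear[OF int, of "\<lambda>F. blinfun_apply F i" x] by (simp add: o_def fxi bounded_linear_intros)
  then show "partial i F x = integral (cbox a b) (\<lambda>w. (s * partial i Q (s *\<^sub>R x + c - w)) * f w)"
    using frechet_derivative_at[OF der[of x]] by simp
qed

text \<open>A partial derivative of the convolution is again a convolution, with the kernel
  \<open>s * partial i Q\<close>; hence the induction generalises over \<open>Q\<close>.\<close>

lemma C_k_convolution:
  fixes f :: "'a::euclidean_space \<Rightarrow> real"
  assumes "\<And>k. C_k k Q" "continuous_on (cbox a b) f"
  shows "C_k k (\<lambda>x. integral (cbox a b) (\<lambda>w. Q (s *\<^sub>R x + c - w) * f w))"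
  using assms(1)
proof (induction k arbitrary: Q)
  case 0
  have "continuous_on UNIV Q"
    using 0[of 0] by simp
  then have "continuous_on (UNIV \<times> cbox a b) (\<lambda>(x, w). Q (s *\<^sub>R x + c - w) * f w)"
    unfolding split_def
    by (intro continuous_intros continuous_on_compose2[OF \<open>continuous_on UNIV Q\<close>] continuous_on_compose2[OF assms(2)]) auto
  then show ?case
    by (auto intro: integral_continuous_on_param)
next
  case (Suc k)
  have "C_k k (\<lambda>x. integral (cbox a b) (\<lambda>w. (s * partial i Q (s *\<^sub>R x + c - w)) * f w))"
    if "i \<in> Basis" for i
  proof -
    have "C_k j (\<lambda>x. s * partial i Q x)" for j
      using Suc.prems[of "Suc j"] that by (intro C_k_mult C_k_const) simp
    then show ?thesis by (rule Suc.IH)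
  qed
  then show ?case
    using convolution_derivative[OF Suc.prems assms(2)] by simp
qed

text \<open>Dilating about the centre of the square by \<open>1 + 1 / (n + 1)\<close> makes the mollified
  function vanish near the boundary.\<close>

definition dilation :: "nat \<Rightarrow> real" where
  "dilation n = 1 + 1 / (real n + 1)"

text \<open>The translation for which the dilated map fixes the centre (1/2, 1/2).\<close>

definition shift :: "nat \<Rightarrow> real \<times> real" where
  "shift n = (- (1 / (2 * (real n + 1))), - (1 / (2 * (real n + 1))))"

text \<open>With d = 1 / (n + 1) the kernel has radius d / 4, half of the distance d / 2 by which
  the dilation pushes the sides of the square outwards.\<close>

definition sharpness :: "nat \<Rightarrow> real" where
  "sharpness n = 4 * (real n + 1)"

definition mollify :: "nat \<Rightarrow> (real \<times> real \<Rightarrow> real) \<Rightarrow> real \<times> real \<Rightarrow> real" where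
  "mollify n f x =
     (LINT w|lebesgue_on unit_square. mollifier (sharpness n) (dilation n *\<^sub>R x + shift n - w) * f w)"

lemma sharpness_pos: "0 < sharpness n"
  by (simp add: sharpness_def)

lemma mollifier_translate_measurable:
  "S \<in> sets lebesgue \<Longrightarrow> (\<lambda>w. mollifier m (p - w)) \<in> borel_measurable (lebesgue_on S)"
  by (intro continuous_imp_measurable_on_sets_lebesgue
      continuous_on_compose2[OF continuous_mollifier[of UNIV]]) (auto intro!: continuous_intros)

lemma mollify_integrable:
  assumes "f \<in> L2 unit_square"
  shows "integrable (lebesgue_on unit_square) (\<lambda>w. mollifier (sharpness n) (p - w) * f w)"
proof -
  obtain B where B: "\<And>z. \<bar>mollifier (sharpness n) z\<bar> \<le> B"
    using mollifier_bounded[OF sharpness_pos] by blast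
  have "(\<lambda>w. mollifier (sharpness n) (p - w)) \<in> L2 unit_square"
    by (rule L2_bounded[OF lmeasurable_unit_square mollifier_translate_measurable[OF sets_unit_square]])
      (rule AE_I2, rule B)
  then show ?thesis
    using assms by (intro L2_integrable_mult)
qed

text \<open>Bridge between the Lebesgue integral in \<open>mollify\<close>, which also accepts
  discontinuous gradients, and the box integral of the smoothness lemmas.\<close>

lemma integral_cbox_unit_square:
  fixes f :: "real \<times> real \<Rightarrow> real"
  assumes "integrable (lebesgue_on unit_square) f"
  shows "(LINT w|lebesgue_on unit_square. f w) = integral (cbox (0, 0) (1, 1)) f"
  using has_integral_integral_lebesgue_on[OF assms sets_unit_square]
  unfolding unit_square_eq_box by (metis integral_unique integral_open_interval)

lemma mollify_eq_integral:
  assumes "continuous_on (cbox (0, 0) (1, 1)) f"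
  shows "mollify n f = (\<lambda>x. integral (cbox (0, 0) (1, 1))
    (\<lambda>w. mollifier (sharpness n) (dilation n *\<^sub>R x + shift n - w) * f w))"
  unfolding mollify_def
  by (intro ext integral_cbox_unit_square mollify_integrable continuous_on_L2_unit_square assms)

lemma C_k_mollify:
  assumes "continuous_on (cbox (0, 0) (1, 1)) f" shows "C_k k (mollify n f)"
  unfolding mollify_eq_integral[OF assms]
  by (intro C_k_convolution C_k_mollifier assms)

text \<open>The margin t = 1 / (4 * (n + 2)) solves (1 + d) * t = d / 4 with d = 1 / (n + 1): a
  point at that distance from a side is sent d / 4 outside the square, exactly the kernel
  radius.\<close>

lemma mollify_eq_0:
  assumes "mollify n f x \<noteq> 0"
  shows "x \<in> cbox (1 / (4 * (real n + 2)), 1 / (4 * (real n + 2))) (1 - 1 / (4 * (real n + 2)), 1 - 1 / (4 * (real n + 2)))"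
proof (rule ccontr)
  assume "\<not> ?thesis"
  then have out: "fst x < 1 / (4 * (real n + 2)) \<or> fst x > 1 - 1 / (4 * (real n + 2)) \<or>
      snd x < 1 / (4 * (real n + 2)) \<or> snd x > 1 - 1 / (4 * (real n + 2))"
    by (cases x) (auto simp: mem_box Basis_prod_def)
  have far: "1 / sharpness n \<le> \<bar>dilation n * t - 1 / (2 * (real n + 1)) - w\<bar>"
    if "t < 1 / (4 * (real n + 2)) \<or> t > 1 - 1 / (4 * (real n + 2))" "0 < w" "w < 1" for t w
  proof -
    define d where "d = 1 / (real n + 1)"
    have d: "0 < d" "dilation n = 1 + d" "1 / sharpness n = d / 4" "1 / (2 * (real n + 1)) = d / 2"
      by (auto simp: d_def dilation_def sharpness_def)
    have e: "(1 + d) * (1 / (4 * (real n + 2))) = d / 4"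
    proof -
      have "(1 + d) * (real n + 1) = real n + 2" "d * (real n + 1) = 1"
        by (auto simp: d_def field_simps)
      then have "d * (real n + 2) = 1 + d" by (simp add: algebra_simps)
      then show ?thesis by (simp add: divide_eq_eq algebra_simps)
    qed
    from that(1) show ?thesis
    proof
      assume "t < 1 / (4 * (real n + 2))"
      then have "(1 + d) * t < d / 4"
        using mult_strict_left_mono[of t "1 / (4 * (real n + 2))" "1 + d"] d(1) unfolding e by simp
      then show ?thesis
        using d that by simp
    next
      assume "t > 1 - 1 / (4 * (real n + 2))"
      then have "(1 + d) * t > (1 + d) - d / 4"
        using mult_strict_left_mono[of "1 - 1 / (4 * (real n + 2))" t "1 + d"] d(1)
        unfolding right_diff_distrib e by simp
      then show ?thesis
        using d that by simp
    qed
  qed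
  have "mollifier (sharpness n) (dilation n *\<^sub>R x + shift n - w) = 0" if "w \<in> unit_square" for w
    using out that far[of "fst x" "fst w"] far[of "snd x" "snd w"]
    by (intro mollifier_eq_0[OF sharpness_pos]) (auto simp: unit_square_def shift_def)
  then have "mollify n f x = (LINT w|lebesgue_on unit_square. 0)"
    unfolding mollify_def by (intro Bochner_Integration.integral_cong) auto
  then show False using assms by simp
qed

lemma test_function_mollify:
  assumes "continuous_on (cbox (0, 0) (1, 1)) f"
  shows "test_function unit_square (mollify n f)"
proof -
  let ?c = "1 / (4 * (real n + 2))"
  let ?Q = "cbox (?c, ?c) (1 - ?c, 1 - ?c)"
  have sub: "closure {x. mollify n f x \<noteq> 0} \<subseteq> ?Q"
    using mollify_eq_0 by (intro closure_minimal) auto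
  then have "compact (closure {x. mollify n f x \<noteq> 0})"
    by (meson bounded_cbox bounded_subset closed_closure compact_eq_bounded_closed)
  moreover have "0 < ?c" "?c < 1"
    by (auto simp: field_simps)
  then have "?Q \<subseteq> unit_square"
    unfolding unit_square_eq_box by (intro subset_box_imp) (auto simp: Basis_prod_def)
  ultimately show ?thesis
    using sub C_k_mollify[OF assms] by (auto simp: test_function_def)
qed

lemma mollify_bounded:
  assumes "f \<in> borel_measurable (lebesgue_on unit_square)" "AE x in lebesgue_on unit_square. \<bar>f x\<bar> \<le> M"
  shows "\<bar>mollify n f x\<bar> \<le> M"
proof -
  define K where "K w = mollifier (sharpness n) (dilation n *\<^sub>R x + shift n - w)" for w
  have K0: "0 \<le> K w" for w
    by (simp add: K_def mollifier_nonneg sharpness_pos)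
  have intK: "integrable (lebesgue_on unit_square) K" and K1: "integral\<^sup>L (lebesgue_on unit_square) K \<le> 1"
    unfolding K_def using mollifier_reflected_on[OF sharpness_pos sets_unit_square] by auto
  have "f \<in> L2 unit_square"
    using assms by (intro L2_bounded lmeasurable_unit_square)
  then have intf: "integrable (lebesgue_on unit_square) (\<lambda>w. K w * f w)"
    unfolding K_def by (rule mollify_integrable)
  \<comment> \<open>The kernel mass may be less than 1, so the last estimate uses 0 \<le> M; this
    follows from the almost everywhere bound because the square has positive measure.\<close>
  have "emeasure lebesgue unit_square \<noteq> 0"
    using measure_unit_square by (auto simp: measure_def)
  then have "ae_filter (lebesgue_on unit_square) \<noteq> bot"
    by (simp add: ae_filter_eq_bot_iff emeasure_restrict_space sets_unit_square)
  then have M0: "0 \<le> M"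
    using assms(2) eventually_happens' by (metis abs_ge_zero order_trans)
  have "\<bar>mollify n f x\<bar> \<le> (LINT w|lebesgue_on unit_square. \<bar>K w * f w\<bar>)"
    unfolding mollify_def K_def by (rule integral_abs_bound)
  also have "\<dots> \<le> (LINT w|lebesgue_on unit_square. K w * M)"
  proof (rule integral_mono_AE)
    show "AE w in lebesgue_on unit_square. \<bar>K w * f w\<bar> \<le> K w * M"
      using assms(2) by eventually_elim (simp add: abs_mult K0 mult_left_mono)
  qed (use intf intK in auto)
  also have "\<dots> \<le> M"
    using K1 M0 mult_right_mono[of "integral\<^sup>L (lebesgue_on unit_square) K" 1 M] by simp
  finally show ?thesis .
qed

lemma mollify_tendsto:
  assumes f: "f \<in> L2 unit_square" and x: "x \<in> unit_square" and cont: "isCont f x"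
  shows "(\<lambda>n. mollify n f x) \<longlonglongrightarrow> f x"
proof (rule LIMSEQ_I)
  fix r :: real assume "0 < r"
  then obtain a where a: "0 < a" "\<And>w. dist w x < a \<Longrightarrow> dist (f w) (f x) < r / 2"
    using cont unfolding continuous_at_eps_delta by (meson half_gt_zero)
  obtain b where b: "0 < b" "ball x b \<subseteq> unit_square"
    using x open_unit_square open_contains_ball by blast
  \<comment> \<open>For d = 1 / (n + 1) < e the kernel support lies within 4 * d of
    \<open>x\<close>: in each coordinate d / 4 from the kernel and at most d from dilation and
    shift, which is below 2 * d. Hence it lies inside both the ball of continuity and the
    square.\<close>
  define e where "e = min a b / 8"
  have "e > 0" using a b by (simp add: e_def)
  then obtain N where N: "1 / (real N + 1) < e"
    using reals_Archimedean by (metis inverse_eq_divide of_nat_Suc add.commute)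
  show "\<exists>no. \<forall>n\<ge>no. norm (mollify n f x - f x) < r"
  proof (intro exI allI impI)
    fix n assume "N \<le> n"
    define p where "p = dilation n *\<^sub>R x + shift n"
    define K where "K w = mollifier (sharpness n) (p - w)" for w
    define d where "d = 1 / (real n + 1)"
    have d: "0 < d" "d < e"
      using N \<open>N \<le> n\<close> frac_le[of 1 1 "real N + 1" "real n + 1"] by (auto simp: d_def)
    have close: "dist w x < 8 * e" if "K w \<noteq> 0" for w
    proof -
      have "\<bar>fst p - fst w\<bar> < d / 4" "\<bar>snd p - snd w\<bar> < d / 4"
        using that mollifier_eq_0[OF sharpness_pos, of n "p - w"]
        unfolding K_def d_def sharpness_def by (auto simp: not_le[symmetric] mult.commute)
      moreover have "\<bar>fst p - fst x\<bar> \<le> d" "\<bar>snd p - snd x\<bar> \<le> d"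
      proof -
        have "\<bar>d * t - d / 2\<bar> \<le> d" if "0 < t" "t < 1" for t
        proof -
          have "d * t < d" "0 < d * t" using that d by auto
          then show ?thesis using d by linarith
        qed
        moreover have "fst p - fst x = d * fst x - d / 2" "snd p - snd x = d * snd x - d / 2"
          by (auto simp: p_def d_def dilation_def shift_def algebra_simps)
        ultimately show "\<bar>fst p - fst x\<bar> \<le> d" "\<bar>snd p - snd x\<bar> \<le> d"
          using x by (auto simp: unit_square_def)
      qed
      ultimately have "\<bar>fst w - fst x\<bar> \<le> 2 * d" "\<bar>snd w - snd x\<bar> \<le> 2 * d"
        using d by linarith+
      then have "dist w x \<le> 4 * d"
        using sqrt_sum_squares_le_sum_abs[of "fst w - fst x" "snd w - snd x"]
        by (simp add: dist_prod_def dist_real_def)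
      then show ?thesis using d by linarith
    qed
    have K0: "0 \<le> K w" for w
      by (simp add: K_def mollifier_nonneg sharpness_pos)
    have supp: "K w = 0" if "w \<notin> unit_square" for w
    proof (rule ccontr)
      assume "K w \<noteq> 0"
      then have "w \<in> ball x b"
        using close[of w] a b by (simp add: e_def dist_commute)
      then show False using that b by blast
    qed
    have intK: "integrable (lebesgue_on unit_square) K"
      and K1: "integral\<^sup>L (lebesgue_on unit_square) K = 1"
      unfolding K_def using mollifier_reflected_on[OF sharpness_pos sets_unit_square] supp
      by (auto simp: K_def)
    have intf: "integrable (lebesgue_on unit_square) (\<lambda>w. K w * f w)"
      unfolding K_def using f by (rule mollify_integrable)
    have "mollify n f x - f x = (LINT w|lebesgue_on unit_square. K w * f w) - (LINT w|lebesgue_on unit_square. K w * f x)"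
      using K1 by (simp add: mollify_def flip: K_def p_def)
    also have "\<dots> = (LINT w|lebesgue_on unit_square. K w * f w - K w * f x)"
      using intf intK by simp
    finally have "\<bar>mollify n f x - f x\<bar> \<le> (LINT w|lebesgue_on unit_square. \<bar>K w * f w - K w * f x\<bar>)"
      by (simp add: integral_abs_bound)
    also have "\<dots> \<le> (LINT w|lebesgue_on unit_square. K w * (r / 2))"
    proof (rule integral_mono)
      fix w
      show "\<bar>K w * f w - K w * f x\<bar> \<le> K w * (r / 2)"
      proof (cases "K w = 0")
        case False
        then have "dist w x < a"
          using close[of w] a b by (simp add: e_def)
        then have "\<bar>f w - f x\<bar> \<le> r / 2"
          using a(2)[of w] by (simp add: dist_real_def)
        from mult_left_mono[OF this K0[of w]] show ?thesis
          by (simp add: right_diff_distrib[symmetric] abs_mult K0)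
      qed simp
    qed (use intf intK in auto)
    also have "\<dots> < r" using K1 \<open>0 < r\<close> by simp
    finally show "norm (mollify n f x - f x) < r" by simp
  qed
qed

section \<open>Uniqueness of weak derivatives\<close>

text \<open>Orthogonality passes from test functions to bounded continuous \<open>G\<close> by
  mollifying \<open>G\<close>, and from these to sgn h by approximating a measurable function with
  continuous ones. Both limits are dominated by the modulus of \<open>h\<close>, and testing with
  sgn h gives the integral of that modulus.\<close>

lemma AE_eq_0_if_orthogonal_to_test_functions:
  assumes h: "h \<in> L2 unit_square"
    and orth: "\<And>\<phi>. test_function unit_square \<phi> \<Longrightarrow> inner_L2 unit_square h \<phi> = 0"
  shows "AE x in lebesgue_on unit_square. h x = 0"
proof -
  let ?M = "lebesgue_on unit_square"
  have inth: "integrable ?M h"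
    using h lmeasurable_unit_square by (intro L2_integrable)
  have cont0: "(LINT x|?M. h x * G x) = 0" if G: "continuous_on UNIV G" "\<And>x. \<bar>G x\<bar> \<le> 1" for G
  proof -
    have contG: "continuous_on (cbox (0, 0) (1, 1)) G"
      using G(1) continuous_on_subset by blast
    have GL2: "G \<in> L2 unit_square"
      using contG by (rule continuous_on_L2_unit_square)
    have "(\<lambda>n. LINT x|?M. h x * mollify n G x) \<longlonglongrightarrow> (LINT x|?M. h x * G x)"
    proof (rule integral_dominated_convergence[where w = "\<lambda>x. \<bar>h x\<bar>"])
      show "(\<lambda>x. h x * G x) \<in> borel_measurable ?M"
        using L2_integrable_mult[OF h GL2] by (rule borel_measurable_integrable)
      show "(\<lambda>x. h x * mollify n G x) \<in> borel_measurable ?M" for n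
      proof -
        have "mollify n G \<in> L2 unit_square"
          using C_k_continuous[OF C_k_mollify[OF contG, of 0]] continuous_on_subset
          by (intro continuous_on_L2_unit_square) blast
        then show ?thesis
          using L2_integrable_mult[OF h] by blast
      qed
      show "AE x in ?M. (\<lambda>n. h x * mollify n G x) \<longlonglongrightarrow> h x * G x"
        using G(1) by (intro AE_I2 tendsto_mult_left mollify_tendsto[OF GL2])
          (auto simp: continuous_on_eq_continuous_at)
      show "AE x in ?M. norm (h x * mollify n G x) \<le> \<bar>h x\<bar>" for n
      proof (intro AE_I2)
        fix x
        have "\<bar>mollify n G x\<bar> \<le> 1"
          using G(2) L2_measurable[OF GL2] by (intro mollify_bounded) auto
        then show "norm (h x * mollify n G x) \<le> \<bar>h x\<bar>"
          using mult_left_mono[of "\<bar>mollify n G x\<bar>" 1 "\<bar>h x\<bar>"] by (simp add: abs_mult)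
      qed
    qed (use inth in auto)
    moreover have "(LINT x|?M. h x * mollify n G x) = 0" for n
      using orth[OF test_function_mollify[OF contG]] by (simp add: inner_L2_def)
    ultimately have "(\<lambda>n::nat. 0::real) \<longlonglongrightarrow> (LINT x|?M. h x * G x)"
      by simp
    then show ?thesis
      using LIMSEQ_unique tendsto_const by metis
  qed
  have meas: "(\<lambda>x. sgn (h x)) \<in> borel_measurable ?M"
    using L2_measurable[OF h] by measurable
  then have "(\<lambda>x. sgn (h x)) measurable_on unit_square"
    by (simp add: measurable_on_iff_borel_measurable sets_unit_square)
  then obtain N g where N: "negligible N" and g: "\<And>n. continuous_on UNIV (g n :: real \<times> real \<Rightarrow> real)"
    and lim: "\<And>x. x \<notin> N \<Longrightarrow> (\<lambda>n. g n x) \<longlonglongrightarrow> (if x \<in> unit_square then sgn (h x) else 0)"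
    unfolding measurable_on_def by blast
  \<comment> \<open>Truncation keeps the modulus of \<open>h\<close> as a majorant and leaves the
    limit unchanged, as sgn takes values in [-1, 1].\<close>
  define G where "G n x = max (-1) (min 1 (g n x))" for n x
  have contG: "continuous_on UNIV (G n)" for n
    unfolding G_def by (intro continuous_intros g)
  have G1: "\<bar>G n x\<bar> \<le> 1" for n x
    by (simp add: G_def abs_le_iff)
  have "AE x in lebesgue. x \<notin> N"
    using N by (simp add: AE_not_in negligible_iff_null_sets)
  then have N': "AE x in ?M. x \<notin> N"
    by (subst AE_restrict_space_iff) (auto simp: sets_unit_square elim: eventually_mono)
  have "(\<lambda>n. LINT x|?M. h x * G n x) \<longlonglongrightarrow> (LINT x|?M. h x * sgn (h x))"
  proof (rule integral_dominated_convergence[where w = "\<lambda>x. \<bar>h x\<bar>"])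
    show "(\<lambda>x. h x * sgn (h x)) \<in> borel_measurable ?M"
      using meas L2_measurable[OF h] by (rule borel_measurable_times[rotated])
    show "(\<lambda>x. h x * G n x) \<in> borel_measurable ?M" for n
    proof -
      have "G n \<in> L2 unit_square"
        using contG continuous_on_subset by (intro continuous_on_L2_unit_square) blast
      then show ?thesis
        using L2_integrable_mult[OF h] by blast
    qed
    show "AE x in ?M. (\<lambda>n. h x * G n x) \<longlonglongrightarrow> h x * sgn (h x)"
      using N' AE_space[of ?M]
    proof eventually_elim
      case (elim x)
      then have "(\<lambda>n. g n x) \<longlonglongrightarrow> sgn (h x)"
        using lim[of x] by simp
      then have "(\<lambda>n. G n x) \<longlonglongrightarrow> max (-1) (min 1 (sgn (h x)))"
        unfolding G_def by (intro tendsto_intros)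
      also have "max (-1) (min 1 (sgn (h x))) = sgn (h x)"
        by (simp add: sgn_real_def)
      finally show ?case by (intro tendsto_mult_left)
    qed
    show "AE x in ?M. norm (h x * G n x) \<le> \<bar>h x\<bar>" for n
    proof (intro AE_I2)
      fix x show "norm (h x * G n x) \<le> \<bar>h x\<bar>"
        using mult_left_mono[OF G1[of n x], of "\<bar>h x\<bar>"] by (simp add: abs_mult)
    qed
  qed (use inth in auto)
  moreover have "(LINT x|?M. h x * G n x) = 0" for n
    by (rule cont0[OF contG G1])
  ultimately have "(\<lambda>n::nat. 0::real) \<longlonglongrightarrow> (LINT x|?M. h x * sgn (h x))"
    by simp
  then have "(LINT x|?M. h x * sgn (h x)) = 0"
    using LIMSEQ_unique tendsto_const by metis
  then have "(LINT x|?M. \<bar>h x\<bar>) = 0"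
    by (simp add: abs_sgn[symmetric])
  then have "AE x in ?M. \<bar>h x\<bar> = 0"
    using inth by (subst (asm) integral_nonneg_eq_0_iff_AE) auto
  then show ?thesis by simp
qed

section \<open>The weak gradient on the unit square\<close>

lemma test_functionD:
  assumes "test_function D \<phi>"
  shows "C_k k \<phi>" "(\<phi> has_derivative frechet_derivative \<phi> (at x)) (at x)" "x \<notin> D \<Longrightarrow> \<phi> x = 0"
    "b \<in> Basis \<Longrightarrow> continuous_on S (partial b \<phi>)" "continuous_on S \<phi>"
proof -
  have C: "C_k k \<phi>" for k
    using assms by (simp add: test_function_def)
  then show "C_k k \<phi>" .
  show "(\<phi> has_derivative frechet_derivative \<phi> (at x)) (at x)"
    using C[of "Suc 0"] by (rule C_k_has_derivative)
  show "b \<in> Basis \<Longrightarrow> continuous_on S (partial b \<phi>)"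
    using C[of "Suc 0"] by (auto intro: continuous_on_subset[of UNIV])
  show "continuous_on S \<phi>"
    using C[of 0] by (auto intro: continuous_on_subset[of UNIV])
  have "{x. \<phi> x \<noteq> 0} \<subseteq> D"
    using assms closure_subset[of "{x. \<phi> x \<noteq> 0}"] unfolding test_function_def by (meson subset_trans)
  then show "x \<notin> D \<Longrightarrow> \<phi> x = 0" by blast
qed

lemma test_function_L2:
  assumes "test_function unit_square \<phi>"
  shows "\<phi> \<in> L2 unit_square" "b \<in> Basis \<Longrightarrow> partial b \<phi> \<in> L2 unit_square"
  by (intro continuous_on_L2_unit_square test_functionD[OF assms]; assumption)+

lemma weak_partial_props:
  assumes "f \<in> H1 D" "b \<in> Basis"
  shows "weak_partial D b f \<in> L2 D" "is_weak_partial D b f (weak_partial D b f)"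
proof -
  have "\<exists>h. h \<in> L2 D \<and> is_weak_partial D b f h"
    using assms by (auto simp: H1_def)
  from someI_ex[OF this] show "weak_partial D b f \<in> L2 D" "is_weak_partial D b f (weak_partial D b f)"
    by (auto simp: weak_partial_def)
qed

text \<open>Makes the choice in \<open>weak_partial\<close> harmless: under an integral any weak
  derivative at hand may replace it.\<close>

lemma weak_partial_unique:
  assumes "f \<in> H1 unit_square" "b \<in> Basis" "h \<in> L2 unit_square" "is_weak_partial unit_square b f h"
  shows "AE x in lebesgue_on unit_square. weak_partial unit_square b f x = h x"
proof -
  let ?w = "weak_partial unit_square b f"
  note w = weak_partial_props[OF assms(1,2)]
  have "AE x in lebesgue_on unit_square. ?w x + (- 1) * h x = 0"
  proof (rule AE_eq_0_if_orthogonal_to_test_functions)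
    show "(\<lambda>x. ?w x + (- 1) * h x) \<in> L2 unit_square"
      by (intro L2_add L2_cmult w assms)
    fix \<phi> assume \<phi>: "test_function unit_square \<phi>"
    then have "inner_L2 unit_square ?w \<phi> = inner_L2 unit_square h \<phi>"
      using w(2) assms(4) by (simp add: is_weak_partial_def)
    moreover have "inner_L2 unit_square (\<lambda>x. ?w x + (- 1) * h x) \<phi> =
        inner_L2 unit_square ?w \<phi> + inner_L2 unit_square (\<lambda>x. (- 1) * h x) \<phi>"
      by (intro inner_L2_add_left w(1) L2_cmult assms test_function_L2 \<phi>)
    ultimately show "inner_L2 unit_square (\<lambda>x. ?w x + (- 1) * h x) \<phi> = 0"
      unfolding inner_L2_cmult_left by simp
  qed
  then show ?thesis by simp
qed

lemma is_weak_partial_add: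
  assumes "f \<in> L2 unit_square" "f' \<in> L2 unit_square" "h \<in> L2 unit_square" "h' \<in> L2 unit_square" "b \<in> Basis"
    and "is_weak_partial unit_square b f h" "is_weak_partial unit_square b f' h'"
  shows "is_weak_partial unit_square b (\<lambda>x. f x + f' x) (\<lambda>x. h x + h' x)"
  using assms test_function_L2 by (simp add: is_weak_partial_def inner_L2_add_left)

lemma is_weak_partial_cmult:
  "is_weak_partial D b f h \<Longrightarrow> is_weak_partial D b (\<lambda>x. c * f x) (\<lambda>x. c * h x)"
  by (simp add: is_weak_partial_def inner_L2_cmult_left)

lemma H1_L2: "f \<in> H1 D \<Longrightarrow> f \<in> L2 D"
  by (simp add: H1_def)

lemma H1_I: "f \<in> L2 D \<Longrightarrow> (\<And>b. b \<in> Basis \<Longrightarrow> h b \<in> L2 D) \<Longrightarrow>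
    (\<And>b. b \<in> Basis \<Longrightarrow> is_weak_partial D b f (h b)) \<Longrightarrow> f \<in> H1 D"
  by (auto simp: H1_def)

lemma H1_add:
  assumes "f \<in> H1 unit_square" "f' \<in> H1 unit_square"
  shows "(\<lambda>x. f x + f' x) \<in> H1 unit_square"
  by (rule H1_I[where h = "\<lambda>b x. weak_partial unit_square b f x + weak_partial unit_square b f' x"])
    (intro L2_add is_weak_partial_add assms[THEN H1_L2] weak_partial_props assms; assumption)+

lemma H1_cmult: "f \<in> H1 unit_square \<Longrightarrow> (\<lambda>x. c * f x) \<in> H1 unit_square"
  by (rule H1_I[where h = "\<lambda>b x. c * weak_partial unit_square b f x"])
    (auto intro!: L2_cmult is_weak_partial_cmult weak_partial_props dest: H1_L2)

lemma H1_diff: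
  assumes "f \<in> H1 unit_square" "f' \<in> H1 unit_square"
  shows "(\<lambda>x. f x - f' x) \<in> H1 unit_square"
  using H1_add[OF assms(1) H1_cmult[OF assms(2), of "-1"]] by simp

text \<open>The chosen representatives are additive only almost everywhere, by uniqueness; this is
  enough under the integrals.\<close>

lemma inner_grad_add_left:
  assumes "f \<in> H1 unit_square" "f' \<in> H1 unit_square" "h \<in> H1 unit_square"
  shows "inner_grad unit_square (\<lambda>x. f x + f' x) h = inner_grad unit_square f h + inner_grad unit_square f' h"
proof -
  have "inner_L2 unit_square (weak_partial unit_square b (\<lambda>x. f x + f' x)) (weak_partial unit_square b h) =
    inner_L2 unit_square (weak_partial unit_square b f) (weak_partial unit_square b h) +
    inner_L2 unit_square (weak_partial unit_square b f') (weak_partial unit_square b h)"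
    if b: "b \<in> Basis" for b
  proof -
    note w = weak_partial_props[OF assms(1) b] weak_partial_props[OF assms(2) b] weak_partial_props[OF assms(3) b]
    have L: "(\<lambda>x. weak_partial unit_square b f x + weak_partial unit_square b f' x) \<in> L2 unit_square"
      by (intro L2_add w)
    have eq: "AE x in lebesgue_on unit_square. weak_partial unit_square b (\<lambda>x. f x + f' x) x =
        weak_partial unit_square b f x + weak_partial unit_square b f' x"
      by (intro weak_partial_unique H1_add is_weak_partial_add assms L w b assms[THEN H1_L2])
    have "inner_L2 unit_square (weak_partial unit_square b (\<lambda>x. f x + f' x)) (weak_partial unit_square b h) =
      inner_L2 unit_square (\<lambda>x. weak_partial unit_square b f x + weak_partial unit_square b f' x) (weak_partial unit_square b h)"
      using L2_measurable[OF L] L2_measurable[OF w(5)]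
        L2_measurable[OF weak_partial_props(1)[OF H1_add[OF assms(1,2)] b]]
      by (intro inner_L2_cong_AE eq) auto
    then show ?thesis
      using w by (simp add: inner_L2_add_left)
  qed
  then show ?thesis
    by (simp add: inner_grad_def sum.distrib[symmetric])
qed

lemma inner_grad_cmult_left:
  assumes "f \<in> H1 unit_square" "h \<in> H1 unit_square"
  shows "inner_grad unit_square (\<lambda>x. c * f x) h = c * inner_grad unit_square f h"
proof -
  have "inner_L2 unit_square (weak_partial unit_square b (\<lambda>x. c * f x)) (weak_partial unit_square b h) =
    c * inner_L2 unit_square (weak_partial unit_square b f) (weak_partial unit_square b h)"
    if b: "b \<in> Basis" for b
  proof -
    note w = weak_partial_props[OF assms(1) b] weak_partial_props[OF assms(2) b]
    have L: "(\<lambda>x. c * weak_partial unit_square b f x) \<in> L2 unit_square"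
      by (intro L2_cmult w)
    have eq: "AE x in lebesgue_on unit_square. weak_partial unit_square b (\<lambda>x. c * f x) x =
        c * weak_partial unit_square b f x"
      by (intro weak_partial_unique H1_cmult is_weak_partial_cmult assms L w b)
    have "inner_L2 unit_square (weak_partial unit_square b (\<lambda>x. c * f x)) (weak_partial unit_square b h) =
      inner_L2 unit_square (\<lambda>x. c * weak_partial unit_square b f x) (weak_partial unit_square b h)"
      using L2_measurable[OF L] L2_measurable[OF w(3)]
        L2_measurable[OF weak_partial_props(1)[OF H1_cmult[OF assms(1)] b]]
      by (intro inner_L2_cong_AE eq) auto
    then show ?thesis
      by (simp add: inner_L2_cmult_left)
  qed
  then show ?thesis
    by (simp add: inner_grad_def sum_distrib_left)
qed

lemma inner_grad_commute: "inner_grad D f h = inner_grad D h f"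
  by (simp add: inner_grad_def inner_L2_commute)

lemma inner_grad_self_nonneg: "0 \<le> inner_grad D f f"
  by (simp add: inner_grad_def inner_L2_self_nonneg sum_nonneg)

lemma inner_grad_diff_left:
  assumes "f \<in> H1 unit_square" "f' \<in> H1 unit_square" "h \<in> H1 unit_square"
  shows "inner_grad unit_square (\<lambda>x. f x - f' x) h = inner_grad unit_square f h - inner_grad unit_square f' h"
  using inner_grad_add_left[OF assms(1) H1_cmult[OF assms(2), of "-1"] assms(3)]
    inner_grad_cmult_left[OF assms(2,3), of "-1"] by simp

lemma inner_grad_diff_self:
  assumes "f \<in> H1 unit_square" "h \<in> H1 unit_square"
  shows "inner_grad unit_square (\<lambda>x. f x - h x) (\<lambda>x. f x - h x) =
    inner_grad unit_square f f - 2 * inner_grad unit_square f h + inner_grad unit_square h h"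
  using assms H1_diff[OF assms]
  by (simp add: inner_grad_diff_left inner_grad_commute[of _ f "\<lambda>x. f x - h x"] inner_grad_commute[of _ h "\<lambda>x. f x - h x"]
      inner_grad_commute[of _ h f])

lemma inner_grad_add_self:
  assumes "f \<in> H1 unit_square" "h \<in> H1 unit_square"
  shows "inner_grad unit_square (\<lambda>x. f x + h x) (\<lambda>x. f x + h x) =
    inner_grad unit_square f f + 2 * inner_grad unit_square f h + inner_grad unit_square h h"
  using assms H1_add[OF assms]
  by (simp add: inner_grad_add_left inner_grad_commute[of _ f "\<lambda>x. f x + h x"] inner_grad_commute[of _ h "\<lambda>x. f x + h x"]
      inner_grad_commute[of _ h f])

lemma inner_grad_add_self_le:
  assumes "f \<in> H1 unit_square" "h \<in> H1 unit_square"
  shows "inner_grad unit_square (\<lambda>x. f x + h x) (\<lambda>x. f x + h x) \<le>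
    2 * inner_grad unit_square f f + 2 * inner_grad unit_square h h"
  using inner_grad_add_self[OF assms] inner_grad_diff_self[OF assms]
    inner_grad_self_nonneg[of unit_square "\<lambda>x. f x - h x"] by linarith

lemma seminorm_H1_square: "(seminorm_H1 D f)\<^sup>2 = inner_grad D f f"
  by (simp add: seminorm_H1_def inner_grad_self_nonneg)

lemma norm_L2_square: "(norm_L2 D f)\<^sup>2 = inner_L2 D f f"
  by (simp add: norm_L2_def inner_L2_self_nonneg)

section \<open>Integration by parts\<close>

lemma difference_quotient_tendsto:
  fixes f :: "'a::real_normed_vector \<Rightarrow> real"
  assumes "(f has_derivative f') (at x)"
  shows "(\<lambda>n. (f (x + (1 / real (Suc n)) *\<^sub>R b) - f x) * real (Suc n)) \<longlonglongrightarrow> f' b"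
proof -
  have "((\<lambda>t. f (x + t *\<^sub>R b)) has_derivative (\<lambda>t. f' (t *\<^sub>R b))) (at 0)"
    by (rule has_derivative_compose[where g = f]) (use assms in \<open>auto intro!: derivative_eq_intros\<close>)
  moreover have "(\<lambda>t. f' (t *\<^sub>R b)) = (*) (f' b)"
    using has_derivative_linear[OF assms] by (auto simp: linear_cmul)
  ultimately have "((\<lambda>t. f (x + t *\<^sub>R b)) has_real_derivative f' b) (at 0)"
    by (simp add: has_field_derivative_def)
  then have lim: "((\<lambda>h. (f (x + h *\<^sub>R b) - f x) / h) \<longlongrightarrow> f' b) (at 0)"
    by (simp add: DERIV_def)
  have "(\<lambda>n. 1 / real (Suc n)) \<longlonglongrightarrow> 0"
    using LIMSEQ_inverse_real_of_nat by (simp add: inverse_eq_divide)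
  then have "filterlim (\<lambda>n. 1 / real (Suc n)) (at 0) sequentially"
    by (auto simp: filterlim_at)
  from filterlim_compose[OF lim this] show ?thesis
    by simp
qed

text \<open>The mean value theorem along a segment in the convex box. It provides the majorants for
  difference quotients.\<close>

lemma Lipschitz_along_direction:
  fixes f :: "'a::euclidean_space \<Rightarrow> real"
  assumes "\<And>x. (f has_derivative f' x) (at x)" "continuous_on UNIV (\<lambda>x. f' x b)"
  obtains A where "0 \<le> A" "\<And>x. x \<in> cbox p q \<Longrightarrow> \<bar>f x\<bar> \<le> A"
    "\<And>x t. x \<in> cbox p q \<Longrightarrow> x + t *\<^sub>R b \<in> cbox p q \<Longrightarrow> \<bar>f (x + t *\<^sub>R b) - f x\<bar> \<le> A * \<bar>t\<bar>"
proof -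
  have "continuous_on UNIV f"
    using assms(1) by (meson continuous_at_imp_continuous_on has_derivative_continuous)
  then obtain A1 where A1: "\<And>x. x \<in> cbox p q \<Longrightarrow> norm (f x) \<le> A1"
    by (rule continuous_on_cbox_bound[OF continuous_on_subset[OF _ subset_UNIV]]) blast
  obtain A2 where A2: "\<And>x. x \<in> cbox p q \<Longrightarrow> norm (f' x b) \<le> A2"
    by (rule continuous_on_cbox_bound[OF continuous_on_subset[OF assms(2) subset_UNIV]]) blast
  define A where "A = max 0 (max A1 A2)"
  have "\<bar>f (x + t *\<^sub>R b) - f x\<bar> \<le> A * \<bar>t\<bar>" if x: "x \<in> cbox p q" "x + t *\<^sub>R b \<in> cbox p q" for x t
  proof -
    have der: "((\<lambda>s. f (x + s *\<^sub>R t *\<^sub>R b)) has_real_derivative t * f' (x + s *\<^sub>R t *\<^sub>R b) b) (at s)" for s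
    proof -
      have "((\<lambda>s. f (x + s *\<^sub>R t *\<^sub>R b)) has_derivative (\<lambda>r. f' (x + s *\<^sub>R t *\<^sub>R b) (r *\<^sub>R t *\<^sub>R b))) (at s)"
        by (rule has_derivative_compose[where g = f]) (use assms in \<open>auto intro!: derivative_eq_intros\<close>)
      moreover have "(\<lambda>r. f' (x + s *\<^sub>R t *\<^sub>R b) (r *\<^sub>R t *\<^sub>R b)) = (*) (t * f' (x + s *\<^sub>R t *\<^sub>R b) b)"
        using has_derivative_linear[OF assms(1)] by (auto simp: linear_cmul)
      ultimately show ?thesis by (simp add: has_field_derivative_def)
    qed
    have "x + s *\<^sub>R t *\<^sub>R b \<in> cbox p q" if "s \<in> {0..1}" for s
    proof -
      have "(1 - s) *\<^sub>R x + s *\<^sub>R (x + t *\<^sub>R b) \<in> cbox p q"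
        using x that by (intro convexD[OF convex_box(1)]) auto
      then show ?thesis by (simp add: algebra_simps)
    qed
    then have "norm (t * f' (x + s *\<^sub>R t *\<^sub>R b) b) \<le> A * \<bar>t\<bar>" if "s \<in> {0..1}" for s
      using A2[of "x + s *\<^sub>R t *\<^sub>R b"] that
      by (auto simp: abs_mult A_def mult.commute[of "\<bar>t\<bar>"] intro!: mult_right_mono)
    then have "norm (f (x + 1 *\<^sub>R t *\<^sub>R b) - f (x + 0 *\<^sub>R t *\<^sub>R b)) \<le> A * \<bar>t\<bar> * norm (1 - 0 :: real)"
      by (intro field_differentiable_bound[of "{0..1::real}" "\<lambda>s. f (x + s *\<^sub>R t *\<^sub>R b)" "\<lambda>s. t * f' (x + s *\<^sub>R t *\<^sub>R b) b"]
          has_field_derivative_at_within[OF der]) auto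
    then show ?thesis by simp
  qed
  moreover have "\<bar>f x\<bar> \<le> A" if "x \<in> cbox p q" for x
    using A1[OF that] by (simp add: A_def)
  moreover have "0 \<le> A" by (simp add: A_def)
  ultimately show ?thesis using that by blast
qed

lemma negligible_frontier_unit_square: "negligible (frontier unit_square)"
  by (simp add: unit_square_eq_box negligible_convex_frontier convex_box)

lemma lborel_integral_translate:
  fixes f :: "'a::euclidean_space \<Rightarrow> real"
  assumes "f \<in> borel_measurable borel"
  shows "(LINT x|lborel. f (c + x)) = (LINT x|lborel. f x)"
proof -
  have "(LINT x|distr lborel borel ((+) c). f x) = (LINT x|lborel. f (c + x))"
    using assms by (subst integral_distr) auto
  then show ?thesis by (simp only: lborel_distr_plus)
qed

lemma Basis_square: "b \<in> Basis \<longleftrightarrow> b = (1, 0) \<or> b = (0, 1)" for b :: "real \<times> real"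
  by (auto simp: Basis_prod_def)

text \<open>By translation invariance, integrating difference quotients of \<open>F\<close> against \<open>\<psi>\<close> amounts to
  integrating \<open>F\<close> against difference quotients of \<open>\<psi>\<close>; this avoids Fubini.\<close>

lemma integration_by_parts:
  fixes F \<psi> dF :: "real \<times> real \<Rightarrow> real"
  assumes b: "b \<in> Basis"
    and cF: "continuous_on UNIV F" and F0: "\<And>x. x \<notin> unit_square \<Longrightarrow> F x = 0"
    and lipF: "\<And>x t. 0 \<le> t \<Longrightarrow> t \<le> 1 \<Longrightarrow> \<bar>F (x + t *\<^sub>R b) - F x\<bar> \<le> M * t"
    and dF: "AE x in lebesgue_on unit_square.
        (\<lambda>n. (F (x + (1 / real (Suc n)) *\<^sub>R b) - F x) * real (Suc n)) \<longlonglongrightarrow> dF x"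
    and mdF: "dF \<in> borel_measurable (lebesgue_on unit_square)"
    and d\<psi>: "\<And>x. (\<psi> has_derivative \<psi>' x) (at x)" and c\<psi>: "continuous_on UNIV (\<lambda>x. \<psi>' x b)"
  shows "(LINT x|lebesgue_on unit_square. F x * \<psi>' x b) = - (LINT x|lebesgue_on unit_square. dF x * \<psi> x)"
proof -
  \<comment> \<open>Contains every point of the square moved by at most 1 along \<open>b\<close>, so
    all translated supports stay inside and constants on this box serve as integrable
    majorants.\<close>
  let ?Q = "cbox (- 1, - 1) (2, 2) :: (real \<times> real) set"
  define t where "t n = 1 / real (Suc n)" for n
  have t: "0 < t n" "t n \<le> 1" "real (Suc n) * t n = 1" for n
    by (auto simp: t_def)
  obtain A where A: "0 \<le> A" "\<And>x. x \<in> ?Q \<Longrightarrow> \<bar>\<psi> x\<bar> \<le> A"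
    "\<And>x t. x \<in> ?Q \<Longrightarrow> x + t *\<^sub>R b \<in> ?Q \<Longrightarrow> \<bar>\<psi> (x + t *\<^sub>R b) - \<psi> x\<bar> \<le> A * \<bar>t\<bar>"
    using Lipschitz_along_direction[OF d\<psi> c\<psi>] by blast
  have Q: "x + s *\<^sub>R b \<in> ?Q" if "x \<in> unit_square" "\<bar>s\<bar> \<le> 1" for x s
    using b that by (cases x) (auto simp: unit_square_def Basis_square mem_box Basis_prod_def)
  have F_Q: "F (x + t n *\<^sub>R b) = 0" "F x = 0" if "x \<notin> ?Q" for x n
  proof -
    have "x + t n *\<^sub>R b \<notin> unit_square"
      using Q[of "x + t n *\<^sub>R b" "- t n"] that t[of n] by auto
    then show "F (x + t n *\<^sub>R b) = 0" using F0 by blast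
    show "F x = 0" using Q[of x 0] F0[of x] that by auto
  qed
  have M: "0 \<le> M"
    using lipF[of 1 0] by simp
  have c\<psi>0: "continuous_on UNIV \<psi>"
    using d\<psi> by (meson continuous_at_imp_continuous_on has_derivative_continuous)
  have compact_int: "integrable lborel f" if "continuous_on UNIV f" "\<And>x. x \<notin> ?Q \<Longrightarrow> f x = 0" for f :: "real \<times> real \<Rightarrow> real"
  proof -
    have "integrable lborel (\<lambda>x. indicator ?Q x *\<^sub>R f x)"
      using that(1) continuous_on_subset by (intro borel_integrable_compact) auto
    moreover have "(\<lambda>x. indicator ?Q x *\<^sub>R f x) = f"
      using that(2) by (force simp: indicator_def)
    ultimately show ?thesis by simp
  qed
  define G where "G n x = (F (x + t n *\<^sub>R b) - F x) * real (Suc n) * \<psi> x" for n x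
  define G' where "G' n x = F x * ((\<psi> (x + (- t n) *\<^sub>R b) - \<psi> x) * real (Suc n))" for n x
  have cG: "continuous_on UNIV (G n)" "continuous_on UNIV (G' n)" for n
    unfolding G_def G'_def
    by (intro continuous_intros continuous_on_compose2[OF cF] continuous_on_compose2[OF c\<psi>0] cF c\<psi>0; simp)+
  have G_out: "G n x = 0" "G' n x = 0" if "x \<notin> ?Q" for n x
    using F_Q[OF that] by (auto simp: G_def G'_def)
  \<comment> \<open>The product splits into a translated and an untranslated term, each integrable;
    only the former is moved by translation invariance.\<close>
  have GG': "(LINT x|lborel. G n x) = (LINT x|lborel. G' n x)" for n
  proof -
    let ?h = "\<lambda>x. F x * \<psi> (x + (- t n) *\<^sub>R b) * real (Suc n)"
    have ch: "continuous_on UNIV ?h" "continuous_on UNIV (\<lambda>x. ?h (t n *\<^sub>R b + x))"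
      by (intro continuous_intros continuous_on_compose2[OF cF] continuous_on_compose2[OF c\<psi>0] cF; simp)+
    have h0: "?h x = 0" "?h (t n *\<^sub>R b + x) = 0" if "x \<notin> ?Q" for x
      using F_Q[OF that] by (auto simp: add.commute)
    have c3: "continuous_on UNIV (\<lambda>x. F x * \<psi> x * real (Suc n))"
      by (intro continuous_intros cF c\<psi>0)
    have i3: "integrable lborel (\<lambda>x. F x * \<psi> x * real (Suc n))"
      using F_Q(2) by (intro compact_int c3) auto
    have "(LINT x|lborel. G n x) = (LINT x|lborel. ?h (t n *\<^sub>R b + x) - F x * \<psi> x * real (Suc n))"
      by (rule Bochner_Integration.integral_cong) (auto simp: G_def algebra_simps)
    also have "\<dots> = (LINT x|lborel. ?h (t n *\<^sub>R b + x)) - (LINT x|lborel. F x * \<psi> x * real (Suc n))"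
      by (intro Bochner_Integration.integral_diff i3 compact_int ch h0)
    also have "(LINT x|lborel. ?h (t n *\<^sub>R b + x)) = (LINT x|lborel. ?h x)"
      using borel_measurable_continuous_onI[OF ch(1)] by (rule lborel_integral_translate)
    also have "(LINT x|lborel. ?h x) - (LINT x|lborel. F x * \<psi> x * real (Suc n)) = (LINT x|lborel. ?h x - F x * \<psi> x * real (Suc n))"
      by (intro Bochner_Integration.integral_diff[symmetric] i3 compact_int ch h0)
    also have "\<dots> = (LINT x|lborel. G' n x)"
      by (rule Bochner_Integration.integral_cong) (auto simp: G'_def algebra_simps)
    finally show ?thesis .
  qed
  have to_lebesgue: "(LINT x|lborel. G n x) = (LINT x|lebesgue. G n x)"
    "(LINT x|lborel. G' n x) = (LINT x|lebesgue. G' n x)" for n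
    using cG[of n] by (auto simp: integral_completion borel_measurable_continuous_onI)
  have restrict: "(LINT x|lebesgue. indicator unit_square x *\<^sub>R h x) = (LINT x|lebesgue_on unit_square. h x)" for h :: "real \<times> real \<Rightarrow> real"
    by (simp add: integral_restrict_space sets_unit_square)
  have meas: "G n \<in> borel_measurable lebesgue" "G' n \<in> borel_measurable lebesgue" for n
    using cG[of n] by (auto intro!: measurable_completion borel_measurable_continuous_onI)
  have intind: "integrable lebesgue (\<lambda>x. c * indicator ?Q x)" for c :: real
    by (intro integrable_mult_right) (simp add: lmeasurable_iff_integrable[symmetric])
  have Gbound: "norm (G n x) \<le> M * A * indicator ?Q x" for n x
  proof (cases "x \<in> ?Q")
    case True
    have "\<bar>F (x + t n *\<^sub>R b) - F x\<bar> * real (Suc n) \<le> M * t n * real (Suc n)"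
      using t[of n] by (intro mult_right_mono lipF) auto
    also have "\<dots> = M * (real (Suc n) * t n)"
      by (simp only: mult_ac)
    also have "\<dots> = M"
      by (simp only: t mult_1_right)
    finally have "\<bar>F (x + t n *\<^sub>R b) - F x\<bar> * real (Suc n) \<le> M" .
    then have "\<bar>F (x + t n *\<^sub>R b) - F x\<bar> * real (Suc n) * \<bar>\<psi> x\<bar> \<le> M * A"
      using A(2)[OF True] M by (intro mult_mono) auto
    then show ?thesis
      using True by (simp add: G_def abs_mult)
  qed (use G_out in auto)
  \<comment> \<open>On the frontier the quotients may pick up a nonzero one-sided slope instead of
    tending to 0; it is discarded as a null set.\<close>
  have "AE x in lebesgue. x \<notin> frontier unit_square"
    using negligible_frontier_unit_square by (simp add: AE_not_in negligible_iff_null_sets)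
  moreover have "AE x in lebesgue. x \<in> unit_square \<longrightarrow> (\<lambda>n. (F (x + t n *\<^sub>R b) - F x) * real (Suc n)) \<longlonglongrightarrow> dF x"
    using dF by (simp add: AE_restrict_space_iff sets_unit_square t_def)
  ultimately have limG: "AE x in lebesgue. (\<lambda>n. G n x) \<longlonglongrightarrow> indicator unit_square x *\<^sub>R (dF x * \<psi> x)"
  proof eventually_elim
    case (elim x)
    show ?case
    proof (cases "x \<in> unit_square")
      case True
      then show ?thesis
        using elim(2) unfolding G_def by (auto intro!: tendsto_mult_right)
    next
      case False
      then have "x \<in> - closure unit_square"
        using elim(1) open_unit_square by (auto simp: frontier_def interior_open)
      then obtain r where r: "0 < r" "ball x r \<subseteq> - closure unit_square"
        using open_contains_ball by (metis closed_closure open_Compl)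
      have "t \<longlonglongrightarrow> 0"
        unfolding t_def using LIMSEQ_inverse_real_of_nat by (simp add: inverse_eq_divide)
      then have "\<forall>\<^sub>F n in sequentially. t n < r"
        using r(1) by (auto dest: order_tendstoD)
      then have "\<forall>\<^sub>F n in sequentially. G n x = 0"
      proof eventually_elim
        case (elim n)
        have "x + t n *\<^sub>R b \<in> ball x r"
          using elim t[of n] b by (simp add: dist_norm)
        then have "F (x + t n *\<^sub>R b) = 0" "F x = 0"
          using r False closure_subset F0 by blast+
        then show ?case by (simp add: G_def)
      qed
      then show ?thesis
        using False by (simp add: tendsto_eventually)
    qed
  qed
  have c\<psi>m: "\<psi> \<in> borel_measurable (lebesgue_on unit_square)" "(\<lambda>x. \<psi>' x b) \<in> borel_measurable (lebesgue_on unit_square)"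
     "F \<in> borel_measurable (lebesgue_on unit_square)"
    using c\<psi>0 c\<psi> cF continuous_on_subset
    by (auto intro!: continuous_imp_measurable_on_sets_lebesgue sets_unit_square)
  have ind_meas: "(\<lambda>x. indicator unit_square x *\<^sub>R h x) \<in> borel_measurable lebesgue"
    if "h \<in> borel_measurable (lebesgue_on unit_square)" for h :: "real \<times> real \<Rightarrow> real"
    using that by (subst borel_measurable_restrict_space_iff[symmetric]) (auto simp: sets_unit_square)
  have "(\<lambda>n. LINT x|lebesgue. G n x) \<longlonglongrightarrow> (LINT x|lebesgue. indicator unit_square x *\<^sub>R (dF x * \<psi> x))"
    by (rule integral_dominated_convergence[where w = "\<lambda>x. M * A * indicator ?Q x"])
      (intro ind_meas borel_measurable_times mdF c\<psi>m meas intind limG AE_I2 Gbound)+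
  moreover have "(\<lambda>n. LINT x|lebesgue. G' n x) \<longlonglongrightarrow> (LINT x|lebesgue. indicator unit_square x *\<^sub>R (- (F x * \<psi>' x b)))"
  proof -
    obtain B where B: "\<And>x. x \<in> ?Q \<Longrightarrow> norm (F x) \<le> B"
      by (rule continuous_on_cbox_bound[OF continuous_on_subset[OF cF subset_UNIV]]) blast
    have B: "\<bar>F x\<bar> \<le> max B 0" for x
      using F_Q(2)[of x] B[of x] by (cases "x \<in> ?Q") simp_all
    have "norm (G' n x) \<le> max B 0 * A * indicator ?Q x" for n x
    proof (cases "x \<in> unit_square")
      case True
      then have "\<bar>\<psi> (x + (- t n) *\<^sub>R b) - \<psi> x\<bar> \<le> A * t n"
        using A(3)[of x "- t n"] Q[of x 0] Q[of x "- t n"] t[of n] by simp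
      then have "\<bar>\<psi> (x + (- t n) *\<^sub>R b) - \<psi> x\<bar> * real (Suc n) \<le> A * t n * real (Suc n)"
        by (intro mult_right_mono) auto
      also have "\<dots> = A * (real (Suc n) * t n)"
        by (simp only: mult_ac)
      also have "\<dots> = A"
        by (simp only: t mult_1_right)
      finally have "\<bar>\<psi> (x + (- t n) *\<^sub>R b) - \<psi> x\<bar> * real (Suc n) \<le> A" .
      then have "\<bar>F x\<bar> * (\<bar>\<psi> (x + (- t n) *\<^sub>R b) - \<psi> x\<bar> * real (Suc n)) \<le> max B 0 * A"
        using B[of x] by (intro mult_mono) auto
      then show ?thesis
        using True Q[of x 0] by (simp add: G'_def abs_mult)
    qed (use F0 A(1) in \<open>auto simp: G'_def\<close>)
    moreover have "(\<lambda>n. G' n x) \<longlonglongrightarrow> indicator unit_square x *\<^sub>R (- (F x * \<psi>' x b))" for x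
    proof (cases "x \<in> unit_square")
      case True
      \<comment> \<open>After translation the quotient of \<psi> steps backwards. Its limit is the
        derivative along -b, the source of the minus sign.\<close>
      have "(\<lambda>n. (\<psi> (x + t n *\<^sub>R (- b)) - \<psi> x) * real (Suc n)) \<longlonglongrightarrow> \<psi>' x (- b)"
        unfolding t_def by (rule difference_quotient_tendsto[OF d\<psi>])
      moreover have "\<psi>' x (- b) = - \<psi>' x b"
        using has_derivative_linear[OF d\<psi>] linear_neg by blast
      ultimately have "(\<lambda>n. F x * ((\<psi> (x + (- t n) *\<^sub>R b) - \<psi> x) * real (Suc n))) \<longlonglongrightarrow> F x * (- \<psi>' x b)"
        by (intro tendsto_mult_left) simp
      then show ?thesis
        using True by (simp add: G'_def)
    qed (use F0 in \<open>auto simp: G'_def\<close>)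
    ultimately show ?thesis
      by (intro integral_dominated_convergence[where w = "\<lambda>x. max B 0 * A * indicator ?Q x"]
        ind_meas borel_measurable_times borel_measurable_uminus c\<psi>m meas intind AE_I2)
  qed
  ultimately have "(LINT x|lebesgue. indicator unit_square x *\<^sub>R (dF x * \<psi> x)) = (LINT x|lebesgue. indicator unit_square x *\<^sub>R (- (F x * \<psi>' x b)))"
    using LIMSEQ_unique by (simp only: GG' flip: to_lebesgue) blast
  then show ?thesis
    unfolding restrict by simp
qed

lemma is_weak_partial_test_function:
  assumes \<phi>: "test_function unit_square \<phi>" and b: "b \<in> Basis"
  shows "is_weak_partial unit_square b \<phi> (partial b \<phi>)"
proof -
  let ?Q = "cbox (- 1, - 1) (2, 2) :: (real \<times> real) set"
  obtain A where A: "0 \<le> A"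
    "\<And>x t. x \<in> ?Q \<Longrightarrow> x + t *\<^sub>R b \<in> ?Q \<Longrightarrow> \<bar>\<phi> (x + t *\<^sub>R b) - \<phi> x\<bar> \<le> A * \<bar>t\<bar>"
    using Lipschitz_along_direction[OF test_functionD(2)[OF \<phi>] test_functionD(4)[OF \<phi> b]] by metis
  have Q: "x + s *\<^sub>R b \<in> ?Q" if "x \<in> unit_square" "\<bar>s\<bar> \<le> 1" for x s
    using b that by (cases x) (auto simp: unit_square_def Basis_square mem_box Basis_prod_def)
  have lip: "\<bar>\<phi> (x + t *\<^sub>R b) - \<phi> x\<bar> \<le> A * t" if t: "0 \<le> t" "t \<le> 1" for x t
  proof -
    \<comment> \<open>If one end point lies in the square, both lie in the box where the Lipschitz
      bound holds; otherwise both values are 0.\<close>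
    consider "x \<in> unit_square" | "x + t *\<^sub>R b \<in> unit_square" | "x \<notin> unit_square" "x + t *\<^sub>R b \<notin> unit_square"
      by blast
    then show ?thesis
    proof cases
      case 1
      then show ?thesis
        using A(2)[of x t] Q[of x 0] Q[of x t] t by simp
    next
      case 2
      then show ?thesis
        using A(2)[of x t] Q[of "x + t *\<^sub>R b" 0] Q[of "x + t *\<^sub>R b" "- t"] t by simp
    next
      case 3
      then show ?thesis
        using test_functionD(3)[OF \<phi>] A(1) t by simp
    qed
  qed
  show ?thesis
    unfolding is_weak_partial_def inner_L2_def
  proof (intro allI impI)
    fix \<psi> assume \<psi>: "test_function unit_square \<psi>"
    show "(LINT x|lebesgue_on unit_square. \<phi> x * partial b \<psi> x) = - (LINT x|lebesgue_on unit_square. partial b \<phi> x * \<psi> x)"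
    proof (rule integration_by_parts[OF b test_functionD(5)[OF \<phi>] test_functionD(3)[OF \<phi>] lip])
      show "AE x in lebesgue_on unit_square.
          (\<lambda>n. (\<phi> (x + (1 / real (Suc n)) *\<^sub>R b) - \<phi> x) * real (Suc n)) \<longlonglongrightarrow> partial b \<phi> x"
        by (intro AE_I2 difference_quotient_tendsto test_functionD(2)[OF \<phi>])
      show "partial b \<phi> \<in> borel_measurable (lebesgue_on unit_square)"
        using test_function_L2(2)[OF \<phi> b] by (rule L2_measurable)
    qed (use test_functionD(2,4)[OF \<psi>] b in auto)
  qed
qed

lemma test_function_H1: "test_function unit_square \<phi> \<Longrightarrow> \<phi> \<in> H1 unit_square"
  by (rule H1_I[where h = "\<lambda>b. partial b \<phi>"])
    (auto intro: is_weak_partial_test_function test_function_L2)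

lemma integral_square_tendsto_0:
  fixes f :: "nat \<Rightarrow> 'a::euclidean_space \<Rightarrow> real"
  assumes D: "D \<in> lmeasurable" and meas: "\<And>n. f n \<in> borel_measurable (lebesgue_on D)"
    and lim: "AE x in lebesgue_on D. (\<lambda>n. f n x) \<longlonglongrightarrow> 0"
    and bound: "\<And>n. AE x in lebesgue_on D. \<bar>f n x\<bar> \<le> B"
  shows "(\<lambda>n. inner_L2 D (f n) (f n)) \<longlonglongrightarrow> 0"
proof -
  interpret finite_measure "lebesgue_on D"
    using D by (rule finite_measure_lebesgue_on)
  have "(\<lambda>n. LINT x|lebesgue_on D. f n x * f n x) \<longlonglongrightarrow> (LINT x|lebesgue_on D. 0)"
  proof (rule integral_dominated_convergence[where w = "\<lambda>_. B * B"])
    show "AE x in lebesgue_on D. (\<lambda>n. f n x * f n x) \<longlonglongrightarrow> 0"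
      using lim
    proof eventually_elim
      case (elim x)
      from tendsto_mult[OF this this] show ?case by simp
    qed
    show "AE x in lebesgue_on D. norm (f n x * f n x) \<le> B * B" for n
      using bound[of n]
    proof eventually_elim
      case (elim x)
      then have "0 \<le> B" by (smt (verit) abs_ge_zero)
      with elim show ?case unfolding real_norm_def abs_mult by (intro mult_mono) auto
    qed
  qed (use meas in auto)
  then show ?thesis by (simp add: inner_L2_def)
qed

section \<open>Piecewise bilinear functions belong to \<open>H1_0\<close>\<close>

text \<open>Gives meaning to difference quotients that step across the boundary.\<close>

definition zero_extension :: "(real \<times> real \<Rightarrow> real) \<Rightarrow> real \<times> real \<Rightarrow> real" where
  "zero_extension v x = (if x \<in> unit_square then v x else 0)"

lemma frontier_unit_square: "frontier unit_square = cbox (0, 0) (1, 1) - unit_square"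
  using open_unit_square by (simp add: frontier_def closure_unit_square interior_open)

text \<open>Isolates what places an element function in \<open>H1_0\<close>. \<open>Z\<close> stands
  for the lines across which the gradient may jump; linear elements are the case e = 0.\<close>

locale piecewise_bilinear_function =
  fixes v :: "real \<times> real \<Rightarrow> real" and M :: real and Z :: "(real \<times> real) set"
  assumes cont: "continuous_on (cbox (0, 0) (1, 1)) v"
    and boundary: "\<And>z. z \<in> frontier unit_square \<Longrightarrow> v z = 0"
    and Lipschitz: "\<And>b x t. b \<in> Basis \<Longrightarrow> x \<in> cbox (0, 0) (1, 1) \<Longrightarrow> x + t *\<^sub>R b \<in> cbox (0, 0) (1, 1) \<Longrightarrow>
        \<bar>v (x + t *\<^sub>R b) - v x\<bar> \<le> M * \<bar>t\<bar>"
    and negligible: "negligible Z"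
    and bilinear: "\<And>x. x \<in> unit_square - Z \<Longrightarrow>
        \<exists>a b c e. \<forall>\<^sub>F z in nhds x. v z = a + b * fst z + c * snd z + e * fst z * snd z"
begin

lemma M_nonneg: "0 \<le> M"
  using Lipschitz[of "(1, 0)" "(0, 0)" 1] by (simp add: mem_cbox_unit Basis_square)

lemma continuous_zero_extension: "continuous_on UNIV (zero_extension v)"
proof -
  have "continuous_on (cbox (0, 0) (1, 1) \<union> - unit_square) (\<lambda>x. if x \<in> unit_square then v x else 0)"
  proof (rule continuous_on_cases)
    show "closed (- unit_square)"
      using open_unit_square by (simp add: closed_Compl)
    show "\<forall>x. x \<in> cbox (0, 0) (1, 1) \<and> x \<notin> unit_square \<or> x \<in> - unit_square \<and> x \<in> unit_square \<longrightarrow> v x = 0"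
      using boundary unfolding frontier_unit_square by blast
  qed (use cont in \<open>auto\<close>)
  moreover have "cbox (0, 0) (1, 1) \<union> - unit_square = UNIV"
    using unit_square_subset by blast
  ultimately show ?thesis
    by (simp add: zero_extension_def[abs_def])
qed

lemma Lipschitz_zero_extension:
  assumes b: "b \<in> Basis" and t: "0 \<le> t"
  shows "\<bar>zero_extension v (x + t *\<^sub>R b) - zero_extension v x\<bar> \<le> M * t"
proof -
  \<comment> \<open>Clamping to [0, 1] is nonexpansive. On an axis-parallel line through the square
    the zero extension is \<open>v\<close> after clamping, because \<open>v\<close> vanishes at both
    boundary points; on a line missing the square it is 0.\<close>
  define cl :: "real \<Rightarrow> real" where "cl s = max 0 (min 1 s)" for s
  have cl: "0 \<le> cl s" "cl s \<le> 1" "\<bar>cl (s + t) - cl s\<bar> \<le> t" for s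
    using t by (auto simp: cl_def)
  obtain p q where x: "x = (p, q)" by (cases x)
  have bd: "z \<in> cbox (0, 0) (1, 1) \<Longrightarrow> z \<notin> unit_square \<Longrightarrow> v z = 0" for z
    using boundary[of z] unfolding frontier_unit_square by blast
  have ext: "zero_extension v (p, q) = v (cl p, q)" if "0 < q" "q < 1" for p q
    using that bd[of "(cl p, q)"]
    by (auto simp: zero_extension_def unit_square_def cl_def mem_cbox_unit max_def min_def split: if_splits)
  have ext': "zero_extension v (p, q) = v (p, cl q)" if "0 < p" "p < 1" for p q
    using that bd[of "(p, cl q)"]
    by (auto simp: zero_extension_def unit_square_def cl_def mem_cbox_unit max_def min_def split: if_splits)
  consider "b = (1, 0)" | "b = (0, 1)"
    using b by (auto simp: Basis_square)
  then show ?thesis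
  proof cases
    case 1
    show ?thesis
    proof (cases "0 < q \<and> q < 1")
      case True
      have "\<bar>v (cl (p + t), q) - v (cl p, q)\<bar> \<le> M * \<bar>cl (p + t) - cl p\<bar>"
        using Lipschitz[OF b, of "(cl p, q)" "cl (p + t) - cl p"] True cl 1 by (simp add: mem_cbox_unit)
      also have "\<dots> \<le> M * t"
        using cl M_nonneg by (intro mult_left_mono) auto
      finally show ?thesis using True ext 1 x by simp
    next
      case False
      then show ?thesis
        using M_nonneg t 1 x by (auto simp: zero_extension_def unit_square_def)
    qed
  next
    case 2
    show ?thesis
    proof (cases "0 < p \<and> p < 1")
      case True
      have "\<bar>v (p, cl (q + t)) - v (p, cl q)\<bar> \<le> M * \<bar>cl (q + t) - cl q\<bar>"
        using Lipschitz[OF b, of "(p, cl q)" "cl (q + t) - cl q"] True cl 2 by (simp add: mem_cbox_unit)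
      also have "\<dots> \<le> M * t"
        using cl M_nonneg by (intro mult_left_mono) auto
      finally show ?thesis using True ext' 2 x by simp
    next
      case False
      then show ?thesis
        using M_nonneg t 2 x by (auto simp: zero_extension_def unit_square_def)
    qed
  qed
qed

lemma eventually_eq_zero_extension:
  "x \<in> unit_square \<Longrightarrow> \<forall>\<^sub>F z in nhds x. zero_extension v z = v z"
  using eventually_nhds_in_open[OF open_unit_square, of x]
  by (auto elim!: eventually_mono simp: zero_extension_def)

lemma local_derivative:
  assumes "\<forall>\<^sub>F z in nhds x. v z = a + b * fst z + c * snd z + e * fst z * snd z"
  shows "(v has_derivative (\<lambda>h. b * fst h + c * snd h + e * (fst x * snd h + fst h * snd x))) (at x)"
proof -
  have "((\<lambda>z. a + b * fst z + c * snd z + e * fst z * snd z) has_derivative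
      (\<lambda>h. b * fst h + c * snd h + e * (fst x * snd h + fst h * snd x))) (at x)"
    by (auto intro!: derivative_eq_intros simp: algebra_simps)
  then show ?thesis
  proof (rule has_derivative_transform_eventually)
    show "\<forall>\<^sub>F z in at x. a + b * fst z + c * snd z + e * fst z * snd z = v z"
      using assms by (auto simp: eventually_at_filter elim: eventually_mono)
    show "a + b * fst x + c * snd x + e * fst x * snd x = v x"
      using eventually_nhds_x_imp_x[OF assms] by simp
  qed simp
qed

lemma has_derivative_v:
  assumes "x \<in> unit_square - Z" shows "(v has_derivative frechet_derivative v (at x)) (at x)"
  using bilinear[OF assms] local_derivative frechet_derivative_works differentiable_def by blast

lemma difference_quotient_zero_extension:
  assumes x: "x \<in> unit_square - Z"
  shows "(\<lambda>n. (zero_extension v (x + (1 / real (Suc n)) *\<^sub>R b) - zero_extension v x) * real (Suc n))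
    \<longlonglongrightarrow> partial b v x"
proof (rule difference_quotient_tendsto)
  show "(zero_extension v has_derivative frechet_derivative v (at x)) (at x)"
  proof (rule has_derivative_transform_eventually[OF has_derivative_v[OF x]])
    show "\<forall>\<^sub>F z in at x. v z = zero_extension v z"
      using eventually_eq_zero_extension[of x] x by (auto simp: eventually_at_filter elim: eventually_mono)
  qed (use x in \<open>auto simp: zero_extension_def\<close>)
qed

lemma partial_bound:
  assumes "x \<in> unit_square - Z" "b \<in> Basis" shows "\<bar>partial b v x\<bar> \<le> M"
proof -
  have "\<bar>(zero_extension v (x + (1 / real (Suc n)) *\<^sub>R b) - zero_extension v x) * real (Suc n)\<bar> \<le> M" for n
  proof -
    have "\<bar>zero_extension v (x + (1 / real (Suc n)) *\<^sub>R b) - zero_extension v x\<bar> * real (Suc n) \<le> M * (1 / real (Suc n)) * real (Suc n)"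
      by (intro mult_right_mono Lipschitz_zero_extension assms) auto
    then show ?thesis by (simp add: abs_mult)
  qed
  then show ?thesis
    using LIMSEQ_le_const2[OF tendsto_rabs[OF difference_quotient_zero_extension[OF assms(1)]]] by blast
qed

lemma isCont_partial:
  assumes "x \<in> unit_square - Z" shows "isCont (partial i v) x"
proof -
  obtain a b c e where "\<forall>\<^sub>F z in nhds x. v z = a + b * fst z + c * snd z + e * fst z * snd z"
    using bilinear[OF assms] by blast
  \<comment> \<open>The polynomial form near \<open>x\<close> is inherited by every nearby
    \<open>y\<close>, so the partial derivative is an explicit affine function near
    \<open>x\<close>.\<close>
  then have "\<forall>\<^sub>F y in nhds x. \<forall>\<^sub>F z in nhds y. v z = a + b * fst z + c * snd z + e * fst z * snd z"
    by (simp add: eventually_eventually)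
  then have ev: "\<forall>\<^sub>F y in nhds x. partial i v y = b * fst i + c * snd i + e * (fst y * snd i + fst i * snd y)"
  proof eventually_elim
    case (elim y)
    from frechet_derivative_at[OF local_derivative[OF elim]] show ?case
      by (metis (no_types, lifting))
  qed
  have "isCont (\<lambda>y. b * fst i + c * snd i + e * (fst y * snd i + fst i * snd y)) x"
    by (intro continuous_intros)
  then show ?thesis
    using isCont_cong[OF ev] by simp
qed

lemma null_Z: "AE x in lebesgue_on unit_square. x \<in> unit_square - Z"
proof -
  have "AE x in lebesgue. x \<notin> Z"
    using negligible by (simp add: AE_not_in negligible_iff_null_sets)
  then show ?thesis
    by (subst AE_restrict_space_iff) (auto simp: sets_unit_square elim: eventually_mono)
qed

text \<open>Continuity holds off \<open>Z\<close> only; changing a function on a null set preserves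
  Lebesgue measurability.\<close>

lemma partial_measurable: "partial b v \<in> borel_measurable (lebesgue_on unit_square)"
proof -
  have Z: "Z \<in> null_sets lebesgue"
    using negligible by (simp add: negligible_iff_null_sets)
  have N: "Z \<inter> unit_square \<in> null_sets (lebesgue_on unit_square)"
    using Z sets_unit_square by (auto simp: null_sets_restrict_space null_set_Int2)
  have "continuous_on (unit_square - Z) (partial b v)"
    using isCont_partial continuous_at_imp_continuous_on by blast
  moreover have "unit_square - Z \<in> sets lebesgue"
    using Z sets_unit_square by auto
  ultimately have "partial b v \<in> borel_measurable (lebesgue_on (unit_square - Z))"
    by (rule continuous_imp_measurable_on_sets_lebesgue)
  moreover have "unit_square - Z \<inter> unit_square = unit_square - Z"
    by blast
  ultimately show ?thesis
    using borel_measurable_diff_null[OF N sets_unit_square, of "partial b v"] by simp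
qed

lemma partial_bound_AE: "b \<in> Basis \<Longrightarrow> AE x in lebesgue_on unit_square. \<bar>partial b v x\<bar> \<le> M"
  using null_Z by eventually_elim (rule partial_bound)

lemma partial_L2: "b \<in> Basis \<Longrightarrow> partial b v \<in> L2 unit_square"
  by (intro L2_bounded[OF lmeasurable_unit_square partial_measurable partial_bound_AE])

lemma v_L2: "v \<in> L2 unit_square"
  using cont by (rule continuous_on_L2_unit_square)

lemma integration_by_parts_v:
  assumes b: "b \<in> Basis"
    and d\<psi>: "\<And>x. (\<psi> has_derivative \<psi>' x) (at x)" and c\<psi>: "continuous_on UNIV (\<lambda>x. \<psi>' x b)"
  shows "(LINT x|lebesgue_on unit_square. v x * \<psi>' x b) = - (LINT x|lebesgue_on unit_square. partial b v x * \<psi> x)"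
proof -
  have "(LINT x|lebesgue_on unit_square. v x * \<psi>' x b) = (LINT x|lebesgue_on unit_square. zero_extension v x * \<psi>' x b)"
    by (rule Bochner_Integration.integral_cong) (auto simp: zero_extension_def)
  also have "\<dots> = - (LINT x|lebesgue_on unit_square. partial b v x * \<psi> x)"
  proof (rule integration_by_parts[OF b continuous_zero_extension _ Lipschitz_zero_extension[OF b] _ partial_measurable d\<psi> c\<psi>])
    show "AE x in lebesgue_on unit_square.
        (\<lambda>n. (zero_extension v (x + (1 / real (Suc n)) *\<^sub>R b) - zero_extension v x) * real (Suc n)) \<longlonglongrightarrow> partial b v x"
      using null_Z by eventually_elim (rule difference_quotient_zero_extension)
  qed (auto simp: zero_extension_def)
  finally show ?thesis .
qed

lemma is_weak_partial_v: "b \<in> Basis \<Longrightarrow> is_weak_partial unit_square b v (partial b v)"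
  unfolding is_weak_partial_def inner_L2_def
  by (intro allI impI integration_by_parts_v) (auto intro: test_functionD)

lemma v_H1: "v \<in> H1 unit_square"
  by (rule H1_I[where h = "\<lambda>b. partial b v"]) (auto intro: is_weak_partial_v partial_L2 v_L2)

lemma weak_partial_v:
  "b \<in> Basis \<Longrightarrow> AE x in lebesgue_on unit_square. weak_partial unit_square b v x = partial b v x"
  by (intro weak_partial_unique v_H1 partial_L2 is_weak_partial_v)

text \<open>Differentiation in \<open>x\<close> falls on the kernel. As the kernel depends on
  \<open>p - w\<close>, this is minus its derivative in \<open>w\<close>, and integration by parts
  moves it to \<open>v\<close>; no boundary term arises because \<open>v\<close> vanishes on the
  frontier. The factor \<open>dilation n\<close> is the chain rule.\<close>

lemma partial_mollify:
  assumes b: "b \<in> Basis"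
  shows "partial b (mollify n v) x = dilation n * mollify n (partial b v) x"
proof -
  define p where "p = dilation n *\<^sub>R x + shift n"
  let ?K = "mollifier (sharpness n)"
  have CK: "C_k k ?K" for k
    by (rule C_k_mollifier)
  have dK: "(?K has_derivative frechet_derivative ?K (at y)) (at y)" for y
    using C_k_has_derivative[OF CK[of "Suc 0"]] .
  have cK: "continuous_on UNIV (partial b ?K)"
    using CK[of "Suc 0"] b by simp
  have cr: "continuous_on UNIV (\<lambda>w. partial b ?K (p - w))"
    by (rule continuous_on_compose2[OF cK]) (auto intro!: continuous_intros)
  have dr: "((\<lambda>w. ?K (p - w)) has_derivative (\<lambda>h. frechet_derivative ?K (at (p - w)) (- h))) (at w)" for w
    by (rule has_derivative_compose[OF _ dK]) (auto intro!: derivative_eq_intros)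
  have neg: "frechet_derivative ?K (at y) (- b) = - partial b ?K y" for y
    using has_derivative_linear[OF dK] linear_neg by blast
  have "(\<lambda>w. partial b ?K (p - w)) \<in> L2 unit_square"
    using cr continuous_on_subset by (intro continuous_on_L2_unit_square) blast
  then have int: "integrable (lebesgue_on unit_square) (\<lambda>w. dilation n * partial b ?K (p - w) * v w)"
    using L2_integrable_mult[OF L2_cmult v_L2] by blast
  have "partial b (mollify n v) x =
      integral (cbox (0, 0) (1, 1)) (\<lambda>w. dilation n * partial b ?K (p - w) * v w)"
    unfolding mollify_eq_integral[OF cont] p_def
    by (rule convolution_derivative(2)[OF CK cont b])
  also have "\<dots> = (LINT w|lebesgue_on unit_square. dilation n * partial b ?K (p - w) * v w)"
    by (rule integral_cbox_unit_square[OF int, symmetric])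
  also have "\<dots> = - dilation n * (LINT w|lebesgue_on unit_square. v w * frechet_derivative ?K (at (p - w)) (- b))"
    by (simp add: neg mult_ac flip: integral_mult_right_zero)
  also have "\<dots> = - dilation n * - (LINT w|lebesgue_on unit_square. partial b v w * ?K (p - w))"
    by (subst integration_by_parts_v[OF b dr]) (auto simp: neg intro!: continuous_intros cr)
  also have "\<dots> = dilation n * mollify n (partial b v) x"
    by (simp add: mollify_def p_def mult.commute)
  finally show ?thesis .
qed

lemma v_H1_0: "v \<in> H1_0 unit_square"
proof -
  define \<phi> where "\<phi> n = mollify n v" for n
  have test: "test_function unit_square (\<phi> n)" for n
    unfolding \<phi>_def using cont by (rule test_function_mollify)
  have isC: "isCont v x" if "x \<in> unit_square" for x
    using continuous_on_subset[OF cont unit_square_subset] that open_unit_square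
    by (simp add: continuous_on_eq_continuous_at)
  obtain B where B: "\<And>x. x \<in> cbox (0, 0) (1, 1) \<Longrightarrow> norm (v x) \<le> B"
    using continuous_on_cbox_bound[OF cont] by blast
  have BAE: "AE x in lebesgue_on unit_square. \<bar>v x\<bar> \<le> B"
    using B unit_square_subset by (intro AE_I2) auto
  have "(\<lambda>n. inner_L2 unit_square (\<lambda>x. v x - \<phi> n x) (\<lambda>x. v x - \<phi> n x)) \<longlonglongrightarrow> 0"
  proof (rule integral_square_tendsto_0[where B = "B + B", OF lmeasurable_unit_square])
    show "(\<lambda>x. v x - \<phi> n x) \<in> borel_measurable (lebesgue_on unit_square)" for n
      by (intro borel_measurable_diff L2_measurable v_L2 test_function_L2 test)
    have "(\<lambda>n. v x - \<phi> n x) \<longlonglongrightarrow> v x - v x" if "x \<in> unit_square" for x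
      unfolding \<phi>_def by (intro tendsto_intros mollify_tendsto v_L2 isC that)
    then show "AE x in lebesgue_on unit_square. (\<lambda>n. v x - \<phi> n x) \<longlonglongrightarrow> 0"
      by (intro AE_I2) simp
    show "AE x in lebesgue_on unit_square. \<bar>v x - \<phi> n x\<bar> \<le> B + B" for n
      using BAE
    proof eventually_elim
      case (elim x)
      then show ?case
        using mollify_bounded[OF L2_measurable[OF v_L2] BAE, of n x] unfolding \<phi>_def by linarith
    qed
  qed
  then have L2_conv: "(\<lambda>n. norm_L2 unit_square (\<lambda>x. v x - \<phi> n x)) \<longlonglongrightarrow> 0"
    unfolding norm_L2_def using tendsto_real_sqrt by force
  have "(\<lambda>n. inner_L2 unit_square (weak_partial unit_square b (\<lambda>x. v x - \<phi> n x))
      (weak_partial unit_square b (\<lambda>x. v x - \<phi> n x))) \<longlonglongrightarrow> 0" if b: "b \<in> Basis" for b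
  proof -
    have H: "(\<lambda>x. v x - \<phi> n x) \<in> H1 unit_square" for n
      by (intro H1_diff v_H1 test_function_H1 test)
    have eq: "AE x in lebesgue_on unit_square. weak_partial unit_square b (\<lambda>x. v x - \<phi> n x) x
        = partial b v x - dilation n * mollify n (partial b v) x" for n
    proof -
      have p: "partial b (\<phi> n) x = dilation n * mollify n (partial b v) x" for x
        unfolding \<phi>_def by (rule partial_mollify[OF b])
      have "is_weak_partial unit_square b (\<lambda>x. v x + (- 1) * \<phi> n x) (\<lambda>x. partial b v x + (- 1) * partial b (\<phi> n) x)"
        by (intro is_weak_partial_add L2_cmult v_L2 partial_L2 test_function_L2 test b
            is_weak_partial_v is_weak_partial_cmult is_weak_partial_test_function)
      moreover have "(\<lambda>x. partial b v x - partial b (\<phi> n) x) \<in> L2 unit_square"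
        by (intro L2_diff partial_L2 test_function_L2 test b)
      ultimately show ?thesis
        using weak_partial_unique[OF H[of n] b, of "\<lambda>x. partial b v x - partial b (\<phi> n) x"]
        by (simp add: p)
    qed
    have dil: "dilation n \<le> 2" "0 \<le> dilation n" for n
      by (auto simp: dilation_def field_simps)
    have dil_lim: "dilation \<longlonglongrightarrow> 1"
    proof -
      have "(\<lambda>n. 1 + inverse (real (Suc n))) \<longlonglongrightarrow> 1 + 0"
        by (intro tendsto_intros LIMSEQ_inverse_real_of_nat)
      then show ?thesis
        by (simp add: dilation_def[abs_def] inverse_eq_divide add.commute)
    qed
    \<comment> \<open>The bound \<open>3 * M\<close> consists of M for the gradient of
      \<open>v\<close> and 2 * M for its mollification, since \<open>dilation n\<close> is at most
      2.\<close>
    show ?thesis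
    proof (rule integral_square_tendsto_0[where B = "3 * M", OF lmeasurable_unit_square])
      show "weak_partial unit_square b (\<lambda>x. v x - \<phi> n x) \<in> borel_measurable (lebesgue_on unit_square)" for n
        by (intro L2_measurable weak_partial_props(1)[OF H b])
      have "AE x in lebesgue_on unit_square. \<forall>n. weak_partial unit_square b (\<lambda>x. v x - \<phi> n x) x
        = partial b v x - dilation n * mollify n (partial b v) x"
        using eq by (simp add: AE_all_countable)
      with null_Z show "AE x in lebesgue_on unit_square. (\<lambda>n. weak_partial unit_square b (\<lambda>x. v x - \<phi> n x) x) \<longlonglongrightarrow> 0"
      proof eventually_elim
        case (elim x)
        have "(\<lambda>n. partial b v x - dilation n * mollify n (partial b v) x) \<longlonglongrightarrow> partial b v x - 1 * partial b v x"
          using elim(1) by (intro tendsto_intros dil_lim mollify_tendsto partial_L2 b isCont_partial) auto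
        then show ?case using elim(2) by simp
      qed
      show "AE x in lebesgue_on unit_square. \<bar>weak_partial unit_square b (\<lambda>x. v x - \<phi> n x) x\<bar> \<le> 3 * M" for n
        using eq[of n] partial_bound_AE[OF b]
      proof eventually_elim
        case (elim x)
        have "\<bar>dilation n * mollify n (partial b v) x\<bar> \<le> 2 * M"
          unfolding abs_mult using mollify_bounded[OF partial_measurable partial_bound_AE[OF b], of n x] dil[of n]
          by (intro mult_mono) auto
        then show ?case using elim by linarith
      qed
    qed
  qed
  then have "(\<lambda>n. inner_grad unit_square (\<lambda>x. v x - \<phi> n x) (\<lambda>x. v x - \<phi> n x)) \<longlonglongrightarrow> (\<Sum>b\<in>(Basis::(real\<times>real) set). 0)"
    unfolding inner_grad_def by (intro tendsto_sum)
  then have "(\<lambda>n. seminorm_H1 unit_square (\<lambda>x. v x - \<phi> n x)) \<longlonglongrightarrow> 0"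
    unfolding seminorm_H1_def using tendsto_real_sqrt by force
  with L2_conv test v_H1 show ?thesis
    unfolding H1_0_def by blast
qed

end

section \<open>Elements\<close>

datatype cell_kind = Quad | Diag | Anti

text \<open>The finite element function on the unit reference cell with corner values
  \<open>a\<close> at \<open>(0, 0)\<close>, \<open>b\<close> at \<open>(1, 0)\<close>, \<open>c\<close> at \<open>(1, 1)\<close> and \<open>e\<close> at \<open>(0, 1)\<close>.\<close>

fun shape :: "cell_kind \<Rightarrow> real \<Rightarrow> real \<Rightarrow> real \<Rightarrow> real \<Rightarrow> real \<Rightarrow> real \<Rightarrow> real" where
  "shape Quad a b c e s t = (1 - s) * (1 - t) * a + s * (1 - t) * b + s * t * c + (1 - s) * t * e"
| "shape Diag a b c e s t = (1 - max s t) * a + max 0 (s - t) * b + min s t * c + max 0 (t - s) * e"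
| "shape Anti a b c e s t = max 0 (1 - s - t) * a + min s (1 - t) * b + max 0 (s + t - 1) * c + min (1 - s) t * e"

lemma shape_add: "shape k (a + a') (b + b') (c + c') (e + e') s t = shape k a b c e s t + shape k a' b' c' e' s t"
  by (cases k) (auto simp: algebra_simps)

lemma shape_diff: "shape k (a - a') (b - b') (c - c') (e - e') s t = shape k a b c e s t - shape k a' b' c' e' s t"
  by (cases k) (auto simp: algebra_simps)

text \<open>On an edge every kind reduces to linear interpolation of the two end values. This is why
  cells of different kinds fit together continuously.\<close>

lemma shape_edges:
  assumes "0 \<le> r" "r \<le> 1"
  shows "shape k a b c e 0 r = (1 - r) * a + r * e" "shape k a b c e 1 r = (1 - r) * b + r * c"
    "shape k a b c e r 0 = (1 - r) * a + r * b" "shape k a b c e r 1 = (1 - r) * e + r * c"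
  using assms by (cases k; auto simp: max_def min_def algebra_simps)+

text \<open>For each kind the value is a convex combination of the corner values.\<close>

lemma shape_abs_le:
  assumes "0 \<le> s" "s \<le> 1" "0 \<le> t" "t \<le> 1" "\<bar>a\<bar> \<le> m" "\<bar>b\<bar> \<le> m" "\<bar>c\<bar> \<le> m" "\<bar>e\<bar> \<le> m"
  shows "\<bar>shape k a b c e s t\<bar> \<le> m"
proof -
  have *: "\<bar>w1 * a + w2 * b + w3 * c + w4 * e\<bar> \<le> m"
    if "0 \<le> w1" "0 \<le> w2" "0 \<le> w3" "0 \<le> w4" "w1 + w2 + w3 + w4 = 1" for w1 w2 w3 w4
  proof -
    have "\<bar>w1 * a + w2 * b + w3 * c + w4 * e\<bar> \<le> \<bar>w1 * a\<bar> + \<bar>w2 * b\<bar> + \<bar>w3 * c\<bar> + \<bar>w4 * e\<bar>"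
      by linarith
    also have "\<dots> \<le> w1 * m + w2 * m + w3 * m + w4 * m"
      using that assms by (intro add_mono) (auto simp: abs_mult mult_left_mono)
    also have "\<dots> = m"
      using that by (simp flip: distrib_right)
    finally show ?thesis .
  qed
  have q: "0 \<le> (1 - s) * (1 - t)" "0 \<le> s * (1 - t)" "0 \<le> s * t" "0 \<le> (1 - s) * t"
    using assms by auto
  show ?thesis
  proof (cases k)
    case Quad
    show ?thesis
      unfolding Quad shape.simps by (intro * q) (simp add: algebra_simps)
  qed (use assms in \<open>simp only: shape.simps; intro *; auto simp: max_def min_def\<close>)+
qed

text \<open>When one coordinate moves, each of the four weights changes by at most the displacement;
  the factor 4 counts the weights.\<close>

lemma shape_Lipschitz:
  assumes "0 \<le> t" "t \<le> 1" "\<bar>a\<bar> \<le> m" "\<bar>b\<bar> \<le> m" "\<bar>c\<bar> \<le> m" "\<bar>e\<bar> \<le> m"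
  shows "\<bar>shape k a b c e s t - shape k a b c e s' t\<bar> \<le> 4 * m * \<bar>s - s'\<bar>"
    and "\<bar>shape k a b c e t s - shape k a b c e t s'\<bar> \<le> 4 * m * \<bar>s - s'\<bar>"
proof -
  have *: "\<bar>(w1 * a + w2 * b + w3 * c + w4 * e) - (w1' * a + w2' * b + w3' * c + w4' * e)\<bar> \<le> 4 * m * \<bar>s - s'\<bar>"
    if "\<bar>w1 - w1'\<bar> \<le> \<bar>s - s'\<bar>" "\<bar>w2 - w2'\<bar> \<le> \<bar>s - s'\<bar>" "\<bar>w3 - w3'\<bar> \<le> \<bar>s - s'\<bar>" "\<bar>w4 - w4'\<bar> \<le> \<bar>s - s'\<bar>"
    for w1 w2 w3 w4 w1' w2' w3' w4'
  proof -
    have "(w1 * a + w2 * b + w3 * c + w4 * e) - (w1' * a + w2' * b + w3' * c + w4' * e)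
      = (w1 - w1') * a + (w2 - w2') * b + (w3 - w3') * c + (w4 - w4') * e"
      by (simp add: algebra_simps)
    also have "\<bar>\<dots>\<bar> \<le> \<bar>(w1 - w1') * a\<bar> + \<bar>(w2 - w2') * b\<bar> + \<bar>(w3 - w3') * c\<bar> + \<bar>(w4 - w4') * e\<bar>"
      by linarith
    also have "\<dots> \<le> \<bar>s - s'\<bar> * m + \<bar>s - s'\<bar> * m + \<bar>s - s'\<bar> * m + \<bar>s - s'\<bar> * m"
      using that assms unfolding abs_mult by (intro add_mono mult_mono) auto
    finally show ?thesis by simp
  qed
  have le: "\<bar>u * w - u' * w\<bar> \<le> \<bar>s - s'\<bar>" "\<bar>w * u - w * u'\<bar> \<le> \<bar>s - s'\<bar>"
    if "0 \<le> w" "w \<le> 1" "\<bar>u - u'\<bar> = \<bar>s - s'\<bar>" for w u u'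
    using that mult_right_mono[of w 1 "\<bar>s - s'\<bar>"]
    by (simp_all add: abs_mult mult.commute flip: right_diff_distrib left_diff_distrib)
  show "\<bar>shape k a b c e s t - shape k a b c e s' t\<bar> \<le> 4 * m * \<bar>s - s'\<bar>"
  proof (cases k)
    case Quad
    show ?thesis
      unfolding Quad shape.simps by (intro * le) (use assms in auto)
  qed (simp only: shape.simps; intro *; auto simp: max_def min_def abs_if)+
  show "\<bar>shape k a b c e t s - shape k a b c e t s'\<bar> \<le> 4 * m * \<bar>s - s'\<bar>"
  proof (cases k)
    case Quad
    show ?thesis
      unfolding Quad shape.simps by (intro * le) (use assms in auto)
  qed (simp only: shape.simps; intro *; auto simp: max_def min_def abs_if)+
qed

lemma continuous_on_shape:
  assumes "continuous_on S f" "continuous_on S g"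
  shows "continuous_on S (\<lambda>p. shape k a b c e (f p) (g p))"
  by (cases k) (auto intro!: continuous_intros assms)

lemma eventually_less_nhds:
  fixes f g :: "'a::topological_space \<Rightarrow> real"
  assumes "continuous_on UNIV f" "continuous_on UNIV g" "f y < g y"
  shows "\<forall>\<^sub>F z in nhds y. f z < g z"
  using eventually_nhds_in_open[OF open_Collect_less[OF assms(1,2)], of y] assms(3) by simp

text \<open>Off the diagonals every max and min is locally resolved. Both diagonals are excluded
  whatever the kind, so that one exceptional set serves all kinds.\<close>

lemma shape_locally_polynomial:
  assumes "s \<noteq> t" "s + t \<noteq> 1"
  shows "\<exists>A B C E. \<forall>\<^sub>F z in nhds (s, t). shape k a b c e (fst z) (snd z) = A + B * fst z + C * snd z + E * fst z * snd z"
proof -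
  have op: "\<forall>\<^sub>F z in nhds (s, t). fst z < snd z" if "s < t"
    using that by (intro eventually_less_nhds continuous_intros) simp
  have op': "\<forall>\<^sub>F z in nhds (s, t). snd z < fst z" if "t < s"
    using that by (intro eventually_less_nhds continuous_intros) simp
  have op2: "\<forall>\<^sub>F z in nhds (s, t). fst z + snd z < 1" if "s + t < 1"
    using that by (intro eventually_less_nhds continuous_intros) simp
  have op2': "\<forall>\<^sub>F z in nhds (s, t). 1 < fst z + snd z" if "1 < s + t"
    using that by (intro eventually_less_nhds continuous_intros) simp
  show ?thesis
  proof (cases k)
    case Quad
    have "shape k a b c e (fst z) (snd z) = a + (b - a) * fst z + (e - a) * snd z + (a - b + c - e) * fst z * snd z" for z
      by (simp add: Quad algebra_simps)
    then show ?thesis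
      by (intro exI[of _ a] exI[of _ "b - a"] exI[of _ "e - a"] exI[of _ "a - b + c - e"] always_eventually allI)
  next
    case Diag
    show ?thesis
    proof (cases "s < t")
      case True
      have "\<forall>\<^sub>F z in nhds (s, t). shape k a b c e (fst z) (snd z) = a + (c - e) * fst z + (e - a) * snd z + 0 * fst z * snd z"
        using op[OF True] by eventually_elim (simp add: Diag algebra_simps)
      then show ?thesis by blast
    next
      case False
      then have "t < s" using assms by simp
      have "\<forall>\<^sub>F z in nhds (s, t). shape k a b c e (fst z) (snd z) = a + (b - a) * fst z + (c - b) * snd z + 0 * fst z * snd z"
        using op'[OF \<open>t < s\<close>] by eventually_elim (simp add: Diag algebra_simps)
      then show ?thesis by blast
    qed
  next
    case Anti
    show ?thesis
    proof (cases "s + t < 1")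
      case True
      have "\<forall>\<^sub>F z in nhds (s, t). shape k a b c e (fst z) (snd z) = a + (b - a) * fst z + (e - a) * snd z + 0 * fst z * snd z"
        using op2[OF True] by eventually_elim (simp add: Anti algebra_simps)
      then show ?thesis by blast
    next
      case False
      then have "1 < s + t" using assms by simp
      have "\<forall>\<^sub>F z in nhds (s, t). shape k a b c e (fst z) (snd z) = (b + e - c) + (c - e) * fst z + (c - b) * snd z + 0 * fst z * snd z"
        using op2'[OF \<open>1 < s + t\<close>] by eventually_elim (simp add: Anti algebra_simps)
      then show ?thesis by blast
    qed
  qed
qed

section \<open>Finite element functions on a tensor product mesh\<close>

text \<open>\<open>kind\<close> chooses for each cell between bilinear elements and the two
  diagonals, so both element types are treated together.\<close>

locale tensor_mesh =
  fixes x :: "nat \<Rightarrow> real" and N :: nat and kind :: "nat \<Rightarrow> nat \<Rightarrow> cell_kind"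
  assumes x_0: "x 0 = 0" and x_N: "x N = 1" and x_less: "\<And>i. i < N \<Longrightarrow> x i < x (Suc i)"
begin

definition cell :: "nat \<Rightarrow> nat \<Rightarrow> (real \<times> real) set" where
  "cell i j = {x i..x (Suc i)} \<times> {x j..x (Suc j)}"

definition loc :: "nat \<Rightarrow> real \<Rightarrow> real" where
  "loc i s = (s - x i) / (x (Suc i) - x i)"

definition cell_shape :: "(nat \<Rightarrow> nat \<Rightarrow> real) \<Rightarrow> nat \<Rightarrow> nat \<Rightarrow> real \<times> real \<Rightarrow> real" where
  "cell_shape c i j p = shape (kind i j) (c i j) (c (Suc i) j) (c (Suc i) (Suc j)) (c i (Suc j)) (loc i (fst p)) (loc j (snd p))"

definition nodal :: "(real \<times> real \<Rightarrow> real) \<Rightarrow> nat \<Rightarrow> nat \<Rightarrow> real" where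
  "nodal v i j = v (x i, x j)"

text \<open>Membership means coinciding with one's own nodal interpolant cell by cell.
  \<open>bilinear_space\<close> and \<open>linear_space\<close> turn out to be instances.\<close>

definition fe_space :: "(real \<times> real \<Rightarrow> real) set" where
  "fe_space = {v. continuous_on (cbox (0, 0) (1, 1)) v \<and> (\<forall>z\<in>frontier unit_square. v z = 0) \<and>
     (\<forall>i<N. \<forall>j<N. \<forall>p\<in>cell i j. v p = cell_shape (nodal v) i j p)}"

lemma x_mono: assumes "i \<le> j" "j \<le> N" shows "x i \<le> x j"
  using assms
proof (induction j rule: dec_induct)
  case (step n)
  then show ?case using x_less[of n] by simp
qed simp

lemma x_strict_mono: assumes "i < j" "j \<le> N" shows "x i < x j"
  using x_less[of i] x_mono[of "Suc i" j] assms by simp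

lemma x_unit: "i \<le> N \<Longrightarrow> x i \<in> {0..1}"
  using x_mono[of 0 i] x_mono[of i N] by (simp add: x_0 x_N)

lemma N_pos: "0 < N"
  using x_0 x_N by (cases N) auto

lemma loc_unit: "i < N \<Longrightarrow> s \<in> {x i..x (Suc i)} \<Longrightarrow> 0 \<le> loc i s \<and> loc i s \<le> 1"
  using x_less[of i] by (auto simp: loc_def field_simps)

lemma loc_nodes: "i < N \<Longrightarrow> loc i (x i) = 0" "i < N \<Longrightarrow> loc i (x (Suc i)) = 1"
  using x_less[of i] by (auto simp: loc_def)

lemma continuous_on_loc: "continuous_on S f \<Longrightarrow> continuous_on S (\<lambda>p. loc i (f p))"
  by (auto simp: loc_def divide_inverse intro!: continuous_intros)

lemma cell_subset: "i < N \<Longrightarrow> j < N \<Longrightarrow> cell i j \<subseteq> cbox (0, 0) (1, 1)"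
  using x_unit[of i] x_unit[of "Suc i"] x_unit[of j] x_unit[of "Suc j"]
  by (auto simp: cell_def mem_cbox_unit)

text \<open>An interior node is assigned to the cell on its left.\<close>

definition index :: "real \<Rightarrow> nat" where
  "index t = (LEAST i. t \<le> x (Suc i))"

lemma index:
  assumes "t \<in> {0..1}" shows "index t < N" "t \<in> {x (index t)..x (Suc (index t))}"
proof -
  have ex: "t \<le> x (Suc (N - 1))"
    using assms N_pos by (simp add: x_N)
  have "index t \<le> N - 1"
    unfolding index_def using Least_le[of "\<lambda>i. t \<le> x (Suc i)", OF ex] .
  then show "index t < N" using N_pos by simp
  have le: "t \<le> x (Suc (index t))"
    unfolding index_def using LeastI[of "\<lambda>i. t \<le> x (Suc i)", OF ex] .
  have "x (index t) \<le> t"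
  proof (cases "index t")
    case 0
    then show ?thesis using assms by (simp add: x_0)
  next
    case (Suc k)
    then have "\<not> t \<le> x (Suc k)"
      unfolding index_def by (intro not_less_Least) simp
    then show ?thesis using Suc by simp
  qed
  with le show "t \<in> {x (index t)..x (Suc (index t))}" by simp
qed

text \<open>At the left end of a cell other than the outermost one, \<open>index\<close> returns the
  neighbour; the second alternative records this shared node.\<close>

lemma index_cases:
  assumes "i < N" "t \<in> {x i..x (Suc i)}"
  obtains "index t = i" | k where "i = Suc k" "index t = k" "t = x i"
proof -
  have le: "index t \<le> i"
    unfolding index_def using assms by (intro Least_le) simp
  have "t \<in> {0..1}"
    using assms x_unit[of i] x_unit[of "Suc i"] by auto
  note ix = index[OF this]
  show ?thesis
  proof (cases "index t = i")
    case False
    with le have "index t < i" by simp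
    then have "x (Suc (index t)) \<le> x i"
      using assms by (intro x_mono) auto
    then have "t = x i" "x (Suc (index t)) = x i"
      using ix assms by auto
    moreover have "Suc (index t) = i"
      using x_strict_mono[of "Suc (index t)" i] \<open>index t < i\<close> assms calculation(2) by (cases "Suc (index t) = i") auto
    ultimately show ?thesis by (intro that(2)[of "index t"]) simp_all
  qed (use that in blast)
qed

lemma covering:
  assumes "p \<in> cbox (0, 0) (1, 1)" obtains i j where "i < N" "j < N" "p \<in> cell i j"
  using assms index[of "fst p"] index[of "snd p"] that[of "index (fst p)" "index (snd p)"]
  by (cases p) (auto simp: mem_cbox_unit cell_def)

text \<open>The function is defined by \<open>index\<close> and has to be shown independent of the
  cell used. On a shared edge the two neighbours agree by \<open>shape_edges\<close>; at a shared
  corner two such moves are combined.\<close>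

lemma interpolant_exists:
  assumes "\<And>i j. i = 0 \<or> i = N \<or> j = 0 \<or> j = N \<Longrightarrow> c i j = 0"
  obtains v where "v \<in> fe_space" "\<And>i j. i \<le> N \<Longrightarrow> j \<le> N \<Longrightarrow> nodal v i j = c i j"
proof -
  define v where "v p = cell_shape c (index (fst p)) (index (snd p)) p" for p
  have v: "v p = cell_shape c i j p" if ij: "i < N" "j < N" and p: "p \<in> cell i j" for i j p
  proof -
    have P: "fst p \<in> {x i..x (Suc i)}" "snd p \<in> {x j..x (Suc j)}"
      using p by (auto simp: cell_def)
    note lu = loc_unit[OF ij(1) P(1)] loc_unit[OF ij(2) P(2)]
    have 1: "cell_shape c i j p = cell_shape c k j p" if "i = Suc k" "fst p = x i" for k
      using that lu ij by (simp add: cell_shape_def loc_nodes shape_edges)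
    have 2: "cell_shape c i' j p = cell_shape c i' k p" if "j = Suc k" "snd p = x j" "i' < N" "fst p \<in> {x i'..x (Suc i')}" for k i'
      using that loc_unit[OF that(3,4)] ij by (simp add: cell_shape_def loc_nodes shape_edges)
    from ij(1) P(1) show ?thesis
    proof (cases rule: index_cases)
      case 1
      from ij(2) P(2) show ?thesis
        by (cases rule: index_cases) (use 1 2 ij P in \<open>auto simp: v_def\<close>)
    next
      case i: (2 k)
      have k: "k < N" "fst p \<in> {x k..x (Suc k)}"
        using i ij x_less[of k] by auto
      have e1: "cell_shape c i j p = cell_shape c k j p"
        using 1 i by blast
      from ij(2) P(2) show ?thesis
      proof (cases rule: index_cases)
        case 1
        then show ?thesis using e1 i by (simp add: v_def)
      next
        case (2 k')
        with \<open>\<And>k i'. \<lbrakk>j = Suc k; snd p = x j; i' < N; fst p \<in> {x i'..x (Suc i')}\<rbrakk> \<Longrightarrow> cell_shape c i' j p = cell_shape c i' k p\<close>[of k' k] k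
        show ?thesis using e1 i by (simp add: v_def)
      qed
    qed
  qed
  have nod: "nodal v i j = c i j" if le: "i \<le> N" "j \<le> N" for i j
  proof -
    have ex: "\<exists>i'<N. i = i' \<or> i = Suc i'" if "i \<le> N" for i
    proof (cases "i < N")
      case False
      then show ?thesis
        using that N_pos by (intro exI[of _ "N - 1"]) auto
    qed blast
    obtain i' where i': "i' < N" "i = i' \<or> i = Suc i'"
      using ex[OF le(1)] by auto
    obtain j' where j': "j' < N" "j = j' \<or> j = Suc j'"
      using ex[OF le(2)] by auto
    have "(x i, x j) \<in> cell i' j'"
      using i' j' x_less[of i'] x_less[of j'] by (auto simp: cell_def)
    then have "nodal v i j = cell_shape c i' j' (x i, x j)"
      using v i' j' by (simp add: nodal_def)
    also have "\<dots> = c i j"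
      using i' j' by (auto simp: cell_shape_def loc_nodes shape_edges)
    finally show ?thesis .
  qed
  have "v \<in> fe_space"
    unfolding fe_space_def
  proof (intro CollectI conjI allI impI ballI)
    have "cbox (0, 0) (1, 1) = (\<Union>(i, j)\<in>{..<N} \<times> {..<N}. cell i j)"
    proof (intro equalityI subsetI)
      fix p :: "real \<times> real" assume "p \<in> cbox (0, 0) (1, 1)"
      then obtain i j where "i < N" "j < N" "p \<in> cell i j"
        by (rule covering)
      then show "p \<in> (\<Union>(i, j)\<in>{..<N} \<times> {..<N}. cell i j)" by auto
    next
      fix p assume "p \<in> (\<Union>(i, j)\<in>{..<N} \<times> {..<N}. cell i j)"
      then obtain i j where "i < N" "j < N" "p \<in> cell i j" by auto
      then show "p \<in> cbox (0, 0) (1, 1)" using cell_subset by blast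
    qed
    moreover have "continuous_on (\<Union>(i, j)\<in>{..<N} \<times> {..<N}. cell i j) v"
    proof (rule continuous_on_closed_Union)
      fix ij assume "ij \<in> {..<N} \<times> {..<N}"
      then obtain i j where ij: "ij = (i, j)" "i < N" "j < N" by auto
      have "continuous_on (cell i j) (cell_shape c i j)"
        unfolding cell_shape_def[abs_def] by (intro continuous_on_shape continuous_on_loc continuous_intros)
      moreover have "continuous_on (cell i j) v = continuous_on (cell i j) (cell_shape c i j)"
        by (rule continuous_on_cong[OF refl v[OF ij(2,3)]])
      ultimately show "continuous_on (case ij of (i, j) \<Rightarrow> cell i j) v"
        unfolding ij by simp
      show "closed (case ij of (i, j) \<Rightarrow> cell i j)"
        using ij by (simp add: cell_def closed_Times)
    qed auto
    ultimately show "continuous_on (cbox (0, 0) (1, 1)) v" by simp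
  next
    fix z assume z: "z \<in> frontier unit_square"
    then have zc: "z \<in> cbox (0, 0) (1, 1)" and "fst z = 0 \<or> fst z = 1 \<or> snd z = 0 \<or> snd z = 1"
      unfolding frontier_unit_square by (auto simp: unit_square_def mem_cbox_unit mem_Times_iff)
    from zc obtain i j where ij: "i < N" "j < N" "z \<in> cell i j"
      by (rule covering)
    have P: "fst z \<in> {x i..x (Suc i)}" "snd z \<in> {x j..x (Suc j)}"
      using ij by (auto simp: cell_def)
    note lu = loc_unit[OF ij(1) P(1)] loc_unit[OF ij(2) P(2)]
    \<comment> \<open>A boundary point can lie only in an outermost cell and on its outer edge,
      where \<open>shape_edges\<close> involves boundary nodes alone.\<close>
    have first: "k = 0 \<and> loc k 0 = 0" if "k < N" "0 \<in> {x k..x (Suc k)}" for k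
      using that x_strict_mono[of 0 k] loc_nodes(1)[of 0] by (cases k) (auto simp: x_0)
    have last: "Suc k = N \<and> loc k 1 = 1" if "k < N" "1 \<in> {x k..x (Suc k)}" for k
    proof -
      have "Suc k = N"
        using that x_strict_mono[of "Suc k" N] by (cases "Suc k = N") (auto simp: x_N)
      then show ?thesis
        using loc_nodes(2)[of k] that x_N by auto
    qed
    have c0: "c 0 k = 0" "c N k = 0" "c k 0 = 0" "c k N = 0" for k
      using assms by auto
    have "cell_shape c i j z = 0"
      using \<open>fst z = 0 \<or> fst z = 1 \<or> snd z = 0 \<or> snd z = 1\<close>
    proof (elim disjE)
      assume z0: "fst z = 0"
      then show ?thesis using first[OF ij(1)] P lu by (auto simp add: cell_shape_def shape_edges c0)
    next
      assume z0: "fst z = 1"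
      then show ?thesis using last[OF ij(1)] P lu by (simp add: cell_shape_def shape_edges c0)
    next
      assume z0: "snd z = 0"
      then show ?thesis using first[OF ij(2)] P lu by (auto simp add: cell_shape_def shape_edges c0)
    next
      assume z0: "snd z = 1"
      then show ?thesis using last[OF ij(2)] P lu by (simp add: cell_shape_def shape_edges c0)
    qed
    then show "v z = 0" using v[OF ij] by simp
  next
    fix i j p assume ij: "i < N" "j < N" "p \<in> cell i j"
    then show "v p = cell_shape (nodal v) i j p"
      using v[OF ij] nod by (simp add: cell_shape_def)
  qed
  with nod show ?thesis using that by blast
qed

lemma fe_spaceD:
  assumes "v \<in> fe_space"
  shows "continuous_on (cbox (0, 0) (1, 1)) v" "\<And>z. z \<in> frontier unit_square \<Longrightarrow> v z = 0"
    "\<And>i j p. i < N \<Longrightarrow> j < N \<Longrightarrow> p \<in> cell i j \<Longrightarrow> v p = cell_shape (nodal v) i j p"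
  using assms by (auto simp: fe_space_def)

lemma fe_space_add: assumes "u \<in> fe_space" "v \<in> fe_space" shows "(\<lambda>p. u p + v p) \<in> fe_space"
  using fe_spaceD[OF assms(1)] fe_spaceD[OF assms(2)]
  by (auto simp: fe_space_def cell_shape_def nodal_def shape_add intro!: continuous_intros)

lemma fe_space_diff: assumes "u \<in> fe_space" "v \<in> fe_space" shows "(\<lambda>p. u p - v p) \<in> fe_space"
  using fe_spaceD[OF assms(1)] fe_spaceD[OF assms(2)]
  by (auto simp: fe_space_def cell_shape_def nodal_def shape_diff intro!: continuous_intros)

lemma nodal_boundary:
  assumes "v \<in> fe_space" "i \<le> N" "j \<le> N" "i = 0 \<or> i = N \<or> j = 0 \<or> j = N" shows "nodal v i j = 0"
proof -
  have "(x i, x j) \<in> frontier unit_square"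
    unfolding frontier_unit_square using assms x_unit[of i] x_unit[of j]
    by (auto simp: mem_cbox_unit unit_square_def x_0 x_N)
  then show ?thesis
    using fe_spaceD(2)[OF assms(1)] by (simp add: nodal_def)
qed

end

lemma rectangle_measure:
  assumes "a \<le> b" "c \<le> (d::real)"
  shows "{a<..<b::real} \<times> {c<..<d} \<in> lmeasurable" "measure lebesgue ({a<..<b} \<times> {c<..<d}) = (b - a) * (d - c)"
    "{a..b} \<times> {c..d} \<in> lmeasurable" "measure lebesgue ({a..b} \<times> {c..d}) = (b - a) * (d - c)"
proof -
  have o: "{a<..<b} \<times> {c<..<d} = box (a, c) (b, d)"
    by (auto simp: mem_box Basis_prod_def)
  have cl: "{a..b} \<times> {c..d} = cbox (a, c) (b, d)"
    by (auto simp: mem_box Basis_prod_def)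
  show "{a<..<b} \<times> {c<..<d} \<in> lmeasurable" "{a..b} \<times> {c..d} \<in> lmeasurable"
    unfolding o cl by simp_all
  have "measure lebesgue (box (a, c) (b, d)) = measure lborel (box (a, c) (b, d))"
    "measure lebesgue (cbox (a, c) (b, d)) = measure lborel (cbox (a, c) (b, d))"
    by (simp_all add: measure_completion)
  then show "measure lebesgue ({a<..<b} \<times> {c<..<d}) = (b - a) * (d - c)"
    "measure lebesgue ({a..b} \<times> {c..d}) = (b - a) * (d - c)"
    unfolding o cl using assms by (auto simp: measure_lborel_box_eq measure_lborel_cbox_eq Basis_prod_def)
qed

lemma negligible_line:
  fixes \<alpha> \<beta> \<gamma> :: real
  assumes "\<alpha> \<noteq> 0 \<or> \<beta> \<noteq> 0" shows "negligible {p. \<alpha> * fst p + \<beta> * snd p = \<gamma>}"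
proof -
  have "negligible {p. (\<alpha>, \<beta>) \<bullet> p = \<gamma>}"
    using assms by (intro negligible_hyperplane) (auto simp: zero_prod_def)
  then show ?thesis by (simp add: inner_prod_def)
qed

section \<open>Local bounds by corner values and membership in H1_0\<close>

context tensor_mesh
begin

text \<open>The common currency of the estimates: it bounds the square of \<open>v\<close> on the
  cell, bounds the squared gradient after division by squared steps, and is itself controlled by the
  mass of \<open>v\<close> on the cell.\<close>

definition corner_sum :: "(real \<times> real \<Rightarrow> real) \<Rightarrow> nat \<Rightarrow> nat \<Rightarrow> real" where
  "corner_sum v i j = (nodal v i j)\<^sup>2 + (nodal v (Suc i) j)\<^sup>2 + (nodal v (Suc i) (Suc j))\<^sup>2 + (nodal v i (Suc j))\<^sup>2"

lemma corner_sum_nonneg: "0 \<le> corner_sum v i j"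
  by (simp add: corner_sum_def)

lemma nodal_le_corner_sum:
  "\<bar>nodal v i j\<bar> \<le> sqrt (corner_sum v i j)" "\<bar>nodal v (Suc i) j\<bar> \<le> sqrt (corner_sum v i j)"
  "\<bar>nodal v (Suc i) (Suc j)\<bar> \<le> sqrt (corner_sum v i j)" "\<bar>nodal v i (Suc j)\<bar> \<le> sqrt (corner_sum v i j)"
  by (auto intro!: real_le_rsqrt simp: corner_sum_def)

lemma abs_le_corner_sum:
  assumes "v \<in> fe_space" "i < N" "j < N" "p \<in> cell i j"
  shows "\<bar>v p\<bar> \<le> sqrt (corner_sum v i j)"
  using fe_spaceD(3)[OF assms] assms loc_unit[of i "fst p"] loc_unit[of j "snd p"]
  by (auto simp: cell_shape_def cell_def intro!: shape_abs_le nodal_le_corner_sum)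

lemma square_le_corner_sum:
  assumes "v \<in> fe_space" "i < N" "j < N" "p \<in> cell i j"
  shows "(v p)\<^sup>2 \<le> corner_sum v i j"
  using abs_le_corner_sum[OF assms] corner_sum_nonneg[of v i j]
  by (metis abs_le_square_iff abs_of_nonneg real_sqrt_ge_zero real_sqrt_pow2)

definition step :: "nat \<Rightarrow> real" where "step i = x (Suc i) - x i"

lemma step_pos: "i < N \<Longrightarrow> 0 < step i"
  using x_less by (simp add: step_def)

lemma loc_diff: "loc i s - loc i s' = (s - s') / step i"
  by (simp add: loc_def step_def flip: diff_divide_distrib)

lemma cell_Lipschitz:
  assumes v: "v \<in> fe_space" and ij: "i < N" "j < N"
    and m: "\<bar>nodal v i j\<bar> \<le> m" "\<bar>nodal v (Suc i) j\<bar> \<le> m" "\<bar>nodal v (Suc i) (Suc j)\<bar> \<le> m" "\<bar>nodal v i (Suc j)\<bar> \<le> m"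
  shows "(s, t) \<in> cell i j \<Longrightarrow> (s', t) \<in> cell i j \<Longrightarrow> \<bar>v (s, t) - v (s', t)\<bar> \<le> 4 * m / step i * \<bar>s - s'\<bar>"
    and "(s, t) \<in> cell i j \<Longrightarrow> (s, t') \<in> cell i j \<Longrightarrow> \<bar>v (s, t) - v (s, t')\<bar> \<le> 4 * m / step j * \<bar>t - t'\<bar>"
proof -
  show "\<bar>v (s, t) - v (s', t)\<bar> \<le> 4 * m / step i * \<bar>s - s'\<bar>" if p: "(s, t) \<in> cell i j" "(s', t) \<in> cell i j"
  proof -
    have "\<bar>v (s, t) - v (s', t)\<bar> \<le> 4 * m * \<bar>loc i s - loc i s'\<bar>"
      unfolding fe_spaceD(3)[OF v ij p(1)] fe_spaceD(3)[OF v ij p(2)] cell_shape_def fst_conv snd_conv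
      using p loc_unit[OF ij(2), of t] by (intro shape_Lipschitz(1) m) (auto simp: cell_def)
    then show ?thesis
      using step_pos[OF ij(1)] by (simp add: loc_diff)
  qed
  show "\<bar>v (s, t) - v (s, t')\<bar> \<le> 4 * m / step j * \<bar>t - t'\<bar>" if p: "(s, t) \<in> cell i j" "(s, t') \<in> cell i j"
  proof -
    have "\<bar>v (s, t) - v (s, t')\<bar> \<le> 4 * m * \<bar>loc j t - loc j t'\<bar>"
      unfolding fe_spaceD(3)[OF v ij p(1)] fe_spaceD(3)[OF v ij p(2)] cell_shape_def fst_conv snd_conv
      using p loc_unit[OF ij(1), of s] by (intro shape_Lipschitz(2) m) (auto simp: cell_def)
    then show ?thesis
      using step_pos[OF ij(2)] by (simp add: loc_diff)
  qed
qed

text \<open>Splitting at the nodes between the two points keeps the constant, because the lengths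
  add up.\<close>

lemma Lipschitz_glue:
  fixes f :: "real \<Rightarrow> real"
  assumes f: "\<And>i s s'. i < N \<Longrightarrow> s \<in> {x i..x (Suc i)} \<Longrightarrow> s' \<in> {x i..x (Suc i)} \<Longrightarrow> \<bar>f s - f s'\<bar> \<le> M * \<bar>s - s'\<bar>"
    and "s \<in> {0..1}" "s' \<in> {0..1}"
  shows "\<bar>f s - f s'\<bar> \<le> M * \<bar>s - s'\<bar>"
proof -
  have ordered: "\<bar>f s - f s'\<bar> \<le> M * (s' - s)" if "n \<le> N" "0 \<le> s" "s \<le> s'" "s' \<le> x n" for n s s'
    using that
  proof (induction n arbitrary: s s')
    case 0
    then have "s = 0" "s' = 0" by (auto simp: x_0)
    then show ?case by simp
  next
    case (Suc n)
    show ?case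
    proof (cases "s' \<le> x n")
      case False
      show ?thesis
      proof (cases "x n \<le> s")
        case True
        then show ?thesis
          using f[of n s s'] Suc.prems False by simp
      next
        case s: False
        have "\<bar>f s - f (x n)\<bar> \<le> M * (x n - s)"
          using Suc s by simp
        moreover have "\<bar>f (x n) - f s'\<bar> \<le> M * (s' - x n)"
          using f[of n "x n" s'] Suc.prems False x_less[of n] by simp
        ultimately show ?thesis
          by (simp add: right_diff_distrib)
      qed
    qed (use Suc in simp)
  qed
  show ?thesis
    using ordered[of N s s'] ordered[of N s' s] assms by (auto simp: x_N abs_minus_commute abs_if split: if_splits)
qed

text \<open>Whole lines, and lines along both diagonals of every cell: a single null set off which
  each kind of element function is locally polynomial.\<close>

definition skeleton :: "(real \<times> real) set" where
  "skeleton = (\<Union>i\<le>N. {p. fst p = x i} \<union> {p. snd p = x i}) \<union>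
     (\<Union>i<N. \<Union>j<N. {p. loc i (fst p) = loc j (snd p)} \<union> {p. loc i (fst p) + loc j (snd p) = 1})"

lemma negligible_skeleton: "negligible skeleton"
proof -
  have v: "negligible {p::real\<times>real. fst p = c}" "negligible {p::real\<times>real. snd p = c}" for c
    using negligible_line[of 1 0 c] negligible_line[of 0 1 c] by simp_all
  have d: "negligible {p. loc i (fst p) = loc j (snd p)}" "negligible {p. loc i (fst p) + loc j (snd p) = 1}"
    if "i < N" "j < N" for i j
  proof -
    note pos = step_pos[OF that(1)] step_pos[OF that(2)]
    have l: "loc i s = (1 / step i) * s - x i / step i" for i s
      by (simp add: loc_def step_def diff_divide_distrib)
    have "{p. loc i (fst p) = loc j (snd p)} = {p. (1 / step i) * fst p + (- (1 / step j)) * snd p = x i / step i - x j / step j}"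
      unfolding l by auto
    then show "negligible {p. loc i (fst p) = loc j (snd p)}"
      using negligible_line[of "1 / step i" "- (1 / step j)"] pos by simp
    have "{p. loc i (fst p) + loc j (snd p) = 1} = {p. (1 / step i) * fst p + (1 / step j) * snd p = 1 + x i / step i + x j / step j}"
      unfolding l by auto
    then show "negligible {p. loc i (fst p) + loc j (snd p) = 1}"
      using negligible_line[of "1 / step i" "1 / step j"] pos by simp
  qed
  show ?thesis
    unfolding skeleton_def using v d by (intro negligible_Un negligible_Union) (auto intro!: negligible_Un negligible_Union)
qed

lemma interior_cell:
  assumes "p \<in> cell i j" "p \<notin> skeleton" "i < N" "j < N"
  shows "x i < fst p" "fst p < x (Suc i)" "x j < snd p" "snd p < x (Suc j)"
proof -
  have "fst p \<noteq> x k" "snd p \<noteq> x k" if "k \<le> N" for k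
    using assms(2) that by (auto simp: skeleton_def)
  from this[of i] this[of "Suc i"] this[of j] this[of "Suc j"]
  show "x i < fst p" "fst p < x (Suc i)" "x j < snd p" "snd p < x (Suc j)"
    using assms by (auto simp: cell_def less_le)
qed

lemma fe_space_locally_bilinear:
  assumes v: "v \<in> fe_space" and p: "p \<in> unit_square - skeleton"
  shows "\<exists>a b c e. \<forall>\<^sub>F z in nhds p. v z = a + b * fst z + c * snd z + e * fst z * snd z"
proof -
  have "p \<in> cbox (0, 0) (1, 1)"
    using p unit_square_subset by blast
  then obtain i j where ij: "i < N" "j < N" "p \<in> cell i j"
    by (rule covering)
  define L where "L z = (loc i (fst z), loc j (snd z))" for z
  have "fst (L p) \<noteq> snd (L p)" "fst (L p) + snd (L p) \<noteq> 1"
    using p ij by (auto simp: skeleton_def L_def)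
  from shape_locally_polynomial[OF this, of "kind i j" "nodal v i j" "nodal v (Suc i) j" "nodal v (Suc i) (Suc j)" "nodal v i (Suc j)"]
  obtain A B C E where poly: "\<forall>\<^sub>F z in nhds (L p). shape (kind i j) (nodal v i j) (nodal v (Suc i) j) (nodal v (Suc i) (Suc j)) (nodal v i (Suc j)) (fst z) (snd z)
      = A + B * fst z + C * snd z + E * fst z * snd z"
    by auto
  have "continuous_on UNIV L"
    unfolding L_def by (intro continuous_intros continuous_on_loc)
  then have "isCont L p"
    using continuous_on_eq_continuous_at open_UNIV by blast
  then have fl: "filterlim L (nhds (L p)) (nhds p)"
    by (simp add: isCont_def tendsto_at_iff_tendsto_nhds)
  have ev1: "\<forall>\<^sub>F z in nhds p. cell_shape (nodal v) i j z = A + B * loc i (fst z) + C * loc j (snd z) + E * loc i (fst z) * loc j (snd z)"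
    using eventually_compose_filterlim[OF poly fl] by (simp add: L_def cell_shape_def)
  have "open ({x i<..<x (Suc i)} \<times> {x j<..<x (Suc j)})" "p \<in> {x i<..<x (Suc i)} \<times> {x j<..<x (Suc j)}"
    using interior_cell[OF ij(3) _ ij(1,2)] p by (auto simp: mem_Times_iff intro: open_Times)
  then have "\<forall>\<^sub>F z in nhds p. z \<in> {x i<..<x (Suc i)} \<times> {x j<..<x (Suc j)}"
    by (rule eventually_nhds_in_open)
  then have ev2: "\<forall>\<^sub>F z in nhds p. v z = cell_shape (nodal v) i j z"
    by eventually_elim (rule fe_spaceD(3)[OF v ij(1,2)], auto simp: cell_def)
  let ?h = "step i" and ?k = "step j"
  \<comment> \<open>The coefficients result from expanding the affine map \<open>loc\<close> in the
    local polynomial.\<close>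
  have "\<forall>\<^sub>F z in nhds p. v z = (A - B * x i / ?h - C * x j / ?k + E * x i * x j / (?h * ?k)) +
     (B / ?h - E * x j / (?h * ?k)) * fst z + (C / ?k - E * x i / (?h * ?k)) * snd z + E / (?h * ?k) * fst z * snd z"
    using ev1 ev2
  proof eventually_elim
    case (elim z)
    show ?case
      unfolding elim loc_def step_def[symmetric] using step_pos[OF ij(1)] step_pos[OF ij(2)] by (simp add: field_simps)
  qed
  then show ?thesis by blast
qed

lemma piecewise_bilinear_fe_space:
  assumes v: "v \<in> fe_space" obtains M where "piecewise_bilinear_function v M skeleton"
proof -
  obtain B where B: "\<And>z. z \<in> cbox (0, 0) (1, 1) \<Longrightarrow> norm (v z) \<le> B"
    using continuous_on_cbox_bound[OF fe_spaceD(1)[OF v]] by blast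
  have nod: "\<bar>nodal v i j\<bar> \<le> B" if "i \<le> N" "j \<le> N" for i j
    using B[of "(x i, x j)"] x_unit that by (simp add: nodal_def mem_cbox_unit)
  have B0: "0 \<le> B"
    using nod[of 0 0] by simp
  \<comment> \<open>The Lipschitz constant may depend on the smallest step and on the maximum of
    \<open>v\<close>: it serves qualitative facts, not error bounds.\<close>
  define h where "h = Min (step ` {..<N})"
  have h: "0 < h" "\<And>i. i < N \<Longrightarrow> h \<le> step i"
  proof -
    have "step ` {..<N} \<noteq> {}" using N_pos by auto
    then show "0 < h"
      unfolding h_def using step_pos by (subst Min_gr_iff) auto
    show "\<And>i. i < N \<Longrightarrow> h \<le> step i"
      unfolding h_def by (rule Min_le) auto
  qed
  define M where "M = 4 * B / h"
  have M: "4 * B / step i * r \<le> M * r" if "i < N" "0 \<le> r" for i r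
    unfolding M_def using h(1) h(2)[OF that(1)] step_pos[OF that(1)] that B0
    by (intro mult_right_mono divide_left_mono) auto
  have M1: "\<bar>v (s, t) - v (s', t)\<bar> \<le> M * \<bar>s - s'\<bar>" if "s \<in> {0..1}" "s' \<in> {0..1}" "t \<in> {0..1}" for s s' t
  proof (rule Lipschitz_glue[OF _ that(1,2)])
    fix i s s' assume i: "i < N" "s \<in> {x i..x (Suc i)}" "s' \<in> {x i..x (Suc i)}"
    have "\<bar>v (s, t) - v (s', t)\<bar> \<le> 4 * B / step i * \<bar>s - s'\<bar>"
      using i index[OF that(3)] by (intro cell_Lipschitz(1)[OF v, where j = "index t"] nod) (auto simp: cell_def)
    then show "\<bar>v (s, t) - v (s', t)\<bar> \<le> M * \<bar>s - s'\<bar>"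
      using M[OF i(1), of "\<bar>s - s'\<bar>"] by simp
  qed
  have M2: "\<bar>v (t, s) - v (t, s')\<bar> \<le> M * \<bar>s - s'\<bar>" if "s \<in> {0..1}" "s' \<in> {0..1}" "t \<in> {0..1}" for s s' t
  proof (rule Lipschitz_glue[OF _ that(1,2)])
    fix i s s' assume i: "i < N" "s \<in> {x i..x (Suc i)}" "s' \<in> {x i..x (Suc i)}"
    have "\<bar>v (t, s) - v (t, s')\<bar> \<le> 4 * B / step i * \<bar>s - s'\<bar>"
      using i index[OF that(3)] by (intro cell_Lipschitz(2)[OF v, where i = "index t"] nod) (auto simp: cell_def)
    then show "\<bar>v (t, s) - v (t, s')\<bar> \<le> M * \<bar>s - s'\<bar>"
      using M[OF i(1), of "\<bar>s - s'\<bar>"] by simp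
  qed
  have "piecewise_bilinear_function v M skeleton"
  proof
    fix b y :: "real \<times> real" and t :: real
    assume b: "b \<in> Basis" and y: "y \<in> cbox (0, 0) (1, 1)" "y + t *\<^sub>R b \<in> cbox (0, 0) (1, 1)"
    obtain p q where pq: "y = (p, q)" by (cases y)
    from b consider "b = (1, 0)" | "b = (0, 1)" by (auto simp: Basis_square)
    then show "\<bar>v (y + t *\<^sub>R b) - v y\<bar> \<le> M * \<bar>t\<bar>"
    proof cases
      case 1
      then show ?thesis using M1[of "p + t" p q] y pq by (simp add: mem_cbox_unit)
    next
      case 2
      then show ?thesis using M2[of "q + t" q p] y pq by (simp add: mem_cbox_unit)
    qed
  qed (use fe_spaceD[OF v] negligible_skeleton fe_space_locally_bilinear[OF v] in auto)
  then show ?thesis using that by blast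
qed

lemma fe_space_H1_0: "v \<in> fe_space \<Longrightarrow> v \<in> H1_0 unit_square"
  by (meson piecewise_bilinear_fe_space piecewise_bilinear_function.v_H1_0)

lemma fe_space_H1: "v \<in> fe_space \<Longrightarrow> v \<in> H1 unit_square"
  by (meson piecewise_bilinear_fe_space piecewise_bilinear_function.v_H1)

text \<open>At an interior point of a cell the difference quotients eventually stay in that cell,
  where \<open>cell_Lipschitz\<close> bounds them; the bound passes to the limit.\<close>

lemma partial_le_corner_sum:
  assumes v: "v \<in> fe_space" and p: "p \<in> unit_square - skeleton" and ij: "i < N" "j < N" "p \<in> cell i j"
  shows "\<bar>partial (1, 0) v p\<bar> \<le> 4 * sqrt (corner_sum v i j) / step i"
    and "\<bar>partial (0, 1) v p\<bar> \<le> 4 * sqrt (corner_sum v i j) / step j"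
proof -
  obtain M where "piecewise_bilinear_function v M skeleton"
    using piecewise_bilinear_fe_space[OF v] .
  then have der: "(v has_derivative frechet_derivative v (at p)) (at p)"
    using p by (rule piecewise_bilinear_function.has_derivative_v)
  have int: "x i < fst p" "fst p < x (Suc i)" "x j < snd p" "snd p < x (Suc j)"
    using interior_cell[OF ij(3) _ ij(1,2)] p by auto
  have small: "\<forall>\<^sub>F n in sequentially. 1 / real (Suc n) < r" if "0 < r" for r :: real
    using LIMSEQ_inverse_real_of_nat that by (auto dest!: order_tendstoD simp: inverse_eq_divide)
  note lip = cell_Lipschitz[OF v ij(1,2) nodal_le_corner_sum]
  let ?m = "sqrt (corner_sum v i j)"
  have "\<forall>\<^sub>F n in sequentially. \<bar>(v (p + (1 / real (Suc n)) *\<^sub>R (1, 0)) - v p) * real (Suc n)\<bar> \<le> 4 * ?m / step i"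
  proof (rule eventually_mono[OF small[of "x (Suc i) - fst p"]])
    show "0 < x (Suc i) - fst p" using int by simp
    fix n assume n: "1 / real (Suc n) < x (Suc i) - fst p"
    have "\<bar>v (fst p + 1 / real (Suc n), snd p) - v (fst p, snd p)\<bar> \<le> 4 * ?m / step i * \<bar>fst p + 1 / real (Suc n) - fst p\<bar>"
      using n int by (intro lip(1)) (auto simp: cell_def mem_Times_iff intro: less_imp_le add_increasing2)
    then have "\<bar>v (fst p + 1 / real (Suc n), snd p) - v (fst p, snd p)\<bar> * real (Suc n) \<le> 4 * ?m / step i * (1 / real (Suc n)) * real (Suc n)"
      by (intro mult_right_mono) auto
    then show "\<bar>(v (p + (1 / real (Suc n)) *\<^sub>R (1, 0)) - v p) * real (Suc n)\<bar> \<le> 4 * ?m / step i"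
      by (cases p) (simp add: abs_mult)
  qed
  then show "\<bar>partial (1, 0) v p\<bar> \<le> 4 * ?m / step i"
    by (rule tendsto_upperbound[OF tendsto_rabs[OF difference_quotient_tendsto[OF der]]]) simp
  have "\<forall>\<^sub>F n in sequentially. \<bar>(v (p + (1 / real (Suc n)) *\<^sub>R (0, 1)) - v p) * real (Suc n)\<bar> \<le> 4 * ?m / step j"
  proof (rule eventually_mono[OF small[of "x (Suc j) - snd p"]])
    show "0 < x (Suc j) - snd p" using int by simp
    fix n assume n: "1 / real (Suc n) < x (Suc j) - snd p"
    have "\<bar>v (fst p, snd p + 1 / real (Suc n)) - v (fst p, snd p)\<bar> \<le> 4 * ?m / step j * \<bar>snd p + 1 / real (Suc n) - snd p\<bar>"
      using n int by (intro lip(2)) (auto simp: cell_def mem_Times_iff intro: less_imp_le add_increasing2)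
    then have "\<bar>v (fst p, snd p + 1 / real (Suc n)) - v (fst p, snd p)\<bar> * real (Suc n) \<le> 4 * ?m / step j * (1 / real (Suc n)) * real (Suc n)"
      by (intro mult_right_mono) auto
    then show "\<bar>(v (p + (1 / real (Suc n)) *\<^sub>R (0, 1)) - v p) * real (Suc n)\<bar> \<le> 4 * ?m / step j"
      by (cases p) (simp add: abs_mult)
  qed
  then show "\<bar>partial (0, 1) v p\<bar> \<le> 4 * ?m / step j"
    by (rule tendsto_upperbound[OF tendsto_rabs[OF difference_quotient_tendsto[OF der]]]) simp
qed

subsection \<open>Integrals cell by cell\<close>

lemma AE_skeleton: "AE p in lebesgue_on unit_square. p \<in> unit_square - skeleton"
proof -
  have "AE p in lebesgue. p \<notin> skeleton"
    using negligible_skeleton by (simp add: AE_not_in negligible_iff_null_sets)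
  then show ?thesis
    by (subst AE_restrict_space_iff) (auto simp: sets_unit_square elim: eventually_mono)
qed

text \<open>The cells overlap along edges, which only enlarges the sum of indicators that bounds
  \<open>f\<close>.\<close>

lemma integral_le_cells:
  assumes c: "\<And>i j. 0 \<le> c i j"
    and f: "\<And>p i j. p \<in> unit_square - skeleton \<Longrightarrow> i < N \<Longrightarrow> j < N \<Longrightarrow> p \<in> cell i j \<Longrightarrow> f p \<le> c i j"
  shows "(LINT p|lebesgue_on unit_square. f p) \<le> (\<Sum>i<N. \<Sum>j<N. c i j * (step i * step j))"
proof -
  let ?M = "lebesgue_on unit_square"
  have cellm: "cell i j \<in> lmeasurable" "measure lebesgue (cell i j) = step i * step j" if "i < N" "j < N" for i j
    unfolding cell_def step_def using rectangle_measure(3,4)[of "x i" "x (Suc i)" "x j" "x (Suc j)"] x_less[OF that(1)] x_less[OF that(2)] by auto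
  have ind: "integrable ?M (\<lambda>p. indicator (cell i j) p :: real)" "(LINT p|?M. indicator (cell i j) p) \<le> step i * step j"
    if "i < N" "j < N" for i j
  proof -
    have m: "cell i j \<inter> unit_square \<in> lmeasurable"
      using cellm(1)[OF that] sets_unit_square by (rule fmeasurable_Int_fmeasurable)
    have eq: "indicator unit_square p *\<^sub>R (indicator (cell i j) p :: real) = indicator (cell i j \<inter> unit_square) p" for p
      by (auto simp: indicator_def)
    have "integrable lebesgue (\<lambda>p. indicator unit_square p *\<^sub>R (indicator (cell i j) p :: real))"
      unfolding eq using m by (simp add: lmeasurable_iff_integrable)
    then show "integrable ?M (\<lambda>p. indicator (cell i j) p :: real)"
      by (simp add: integrable_restrict_space sets_unit_square)
    have "(LINT p|?M. indicator (cell i j) p) = (LINT p|lebesgue. indicator unit_square p *\<^sub>R (indicator (cell i j) p :: real))"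
      by (rule integral_restrict_space) (simp add: sets_unit_square)
    also have "\<dots> = (LINT p|lebesgue. indicator (cell i j \<inter> unit_square) p)"
      by (simp only: eq)
    also have "\<dots> = measure lebesgue (cell i j \<inter> unit_square)"
      by simp
    also have "\<dots> \<le> measure lebesgue (cell i j)"
      using cellm[OF that] m by (intro measure_mono_fmeasurable) auto
    finally show "(LINT p|?M. indicator (cell i j) p) \<le> step i * step j"
      using cellm[OF that] by simp
  qed
  let ?g = "\<lambda>p. \<Sum>i<N. \<Sum>j<N. c i j * indicator (cell i j) p"
  have int: "integrable ?M ?g"
    by (intro Bochner_Integration.integrable_sum integrable_mult_right ind) auto
  have "(LINT p|?M. f p) \<le> (LINT p|?M. ?g p)"
  proof (cases "integrable ?M f")
    case True
    show ?thesis
    proof (rule integral_mono_AE[OF True int])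
      show "AE p in ?M. f p \<le> ?g p"
        using AE_skeleton
      proof eventually_elim
        case (elim p)
        then have "p \<in> cbox (0, 0) (1, 1)"
          using unit_square_subset by blast
        then obtain i j where ij: "i < N" "j < N" "p \<in> cell i j"
          by (rule covering)
        have "f p \<le> c i j * indicator (cell i j) p"
          using f[OF elim ij] ij by simp
        also have "\<dots> \<le> (\<Sum>j<N. c i j * indicator (cell i j) p)"
          using ij c by (intro member_le_sum) auto
        also have "\<dots> \<le> ?g p"
          using ij c by (intro member_le_sum[of i "{..<N}" "\<lambda>i. \<Sum>j<N. c i j * indicator (cell i j) p"]) (auto intro!: sum_nonneg)
        finally show ?case .
      qed
    qed
  next
    case False
    \<comment> \<open>A non-integrable \<open>f\<close> has integral 0 by convention, so a
      nonnegative right-hand side is enough.\<close>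
    have "0 \<le> (LINT p|?M. ?g p)"
      using c by (intro integral_nonneg_AE AE_I2 sum_nonneg) auto
    then show ?thesis
      using False by (simp add: not_integrable_integral_eq)
  qed
  also have "\<dots> = (\<Sum>i<N. LINT p|?M. (\<Sum>j<N. c i j * indicator (cell i j) p))"
    by (intro Bochner_Integration.integral_sum Bochner_Integration.integrable_sum integrable_mult_right ind) auto
  also have "\<dots> = (\<Sum>i<N. \<Sum>j<N. (LINT p|?M. c i j * indicator (cell i j) p))"
    by (intro sum.cong refl Bochner_Integration.integral_sum integrable_mult_right ind) auto
  also have "\<dots> = (\<Sum>i<N. \<Sum>j<N. c i j * (LINT p|?M. indicator (cell i j) p))"
    by (simp only: integral_mult_right_zero)
  also have "\<dots> \<le> (\<Sum>i<N. \<Sum>j<N. c i j * (step i * step j))"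
    using c ind by (intro sum_mono mult_left_mono) auto
  finally show ?thesis .
qed

end

text \<open>Near a corner where the modulus is largest the element function stays above half of that value;
  this replaces the exact computation of the element mass matrix.\<close>

lemma shape_square_ge:
  obtains \<alpha> \<beta> :: real where "\<alpha> \<in> {0..15/16}" "\<beta> \<in> {0..15/16}"
    "\<And>s t. s \<in> {\<alpha>..\<alpha> + 1/16} \<Longrightarrow> t \<in> {\<beta>..\<beta> + 1/16} \<Longrightarrow> (a\<^sup>2 + b\<^sup>2 + c\<^sup>2 + e\<^sup>2) / 16 \<le> (shape k a b c e s t)\<^sup>2"
proof -
  define m where "m = max (max \<bar>a\<bar> \<bar>b\<bar>) (max \<bar>c\<bar> \<bar>e\<bar>)"
  have m: "\<bar>a\<bar> \<le> m" "\<bar>b\<bar> \<le> m" "\<bar>c\<bar> \<le> m" "\<bar>e\<bar> \<le> m"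
    unfolding m_def by (simp_all add: le_max_iff_disj)
  have "a\<^sup>2 \<le> m\<^sup>2" "b\<^sup>2 \<le> m\<^sup>2" "c\<^sup>2 \<le> m\<^sup>2" "e\<^sup>2 \<le> m\<^sup>2"
    using m by (auto simp flip: abs_le_square_iff)
  then have S: "(a\<^sup>2 + b\<^sup>2 + c\<^sup>2 + e\<^sup>2) / 16 \<le> (m / 2)\<^sup>2"
    by (simp add: power_divide)
  have core: "(a\<^sup>2 + b\<^sup>2 + c\<^sup>2 + e\<^sup>2) / 16 \<le> (shape k a b c e s t)\<^sup>2"
    if "\<bar>shape k a b c e \<sigma> \<tau>\<bar> = m" "\<bar>s - \<sigma>\<bar> \<le> 1/16" "\<bar>t - \<tau>\<bar> \<le> 1/16" "\<sigma> \<in> {0..1}" "t \<in> {0..1}" for \<sigma> \<tau> s t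
  proof -
    have "\<bar>shape k a b c e s t - shape k a b c e \<sigma> t\<bar> \<le> 4 * m * \<bar>s - \<sigma>\<bar>"
      using that m by (intro shape_Lipschitz) auto
    also have "\<dots> \<le> 4 * m * (1/16)"
      using that m by (intro mult_left_mono) auto
    finally have 1: "\<bar>shape k a b c e s t - shape k a b c e \<sigma> t\<bar> \<le> m / 4" by simp
    have "\<bar>shape k a b c e \<sigma> t - shape k a b c e \<sigma> \<tau>\<bar> \<le> 4 * m * \<bar>t - \<tau>\<bar>"
      using that m by (intro shape_Lipschitz) auto
    also have "\<dots> \<le> 4 * m * (1/16)"
      using that m by (intro mult_left_mono) auto
    finally have "\<bar>shape k a b c e \<sigma> t - shape k a b c e \<sigma> \<tau>\<bar> \<le> m / 4" by simp
    with 1 that(1) have "m / 2 \<le> \<bar>shape k a b c e s t\<bar>" by linarith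
    then have "(m / 2)\<^sup>2 \<le> \<bar>shape k a b c e s t\<bar>\<^sup>2"
      using m by (intro power_mono) auto
    then show ?thesis using S by simp
  qed
  have corners: "shape k a b c e 0 0 = a" "shape k a b c e 1 0 = b" "shape k a b c e 1 1 = c" "shape k a b c e 0 1 = e"
    by (simp_all add: shape_edges)
  have "\<bar>a\<bar> = m \<or> \<bar>b\<bar> = m \<or> \<bar>c\<bar> = m \<or> \<bar>e\<bar> = m"
    unfolding m_def max_def by auto
  then consider "\<bar>a\<bar> = m" | "\<bar>b\<bar> = m" | "\<bar>c\<bar> = m" | "\<bar>e\<bar> = m"
    by blast
  then show ?thesis
  proof cases
    case 1
    show ?thesis by (rule that[of 0 0]; (rule core[of 0 0])?) (use 1 corners in auto)
  next
    case 2
    show ?thesis by (rule that[of "15/16" 0]; (rule core[of 1 0])?) (use 2 corners in auto)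
  next
    case 3
    show ?thesis by (rule that[of "15/16" "15/16"]; (rule core[of 1 1])?) (use 3 corners in auto)
  next
    case 4
    show ?thesis by (rule that[of 0 "15/16"]; (rule core[of 0 1])?) (use 4 corners in auto)
  qed
qed

section \<open>Mass and stiffness in terms of nodal values\<close>

context tensor_mesh
begin

text \<open>The square of side 1/16 from \<open>shape_square_ge\<close>, pulled back to the cell,
  has 1/256 of the cell's area. It is taken open so that boxes of different cells are
  disjoint.\<close>

lemma corner_box:
  assumes v: "v \<in> fe_space" and ij: "i < N" "j < N"
  shows "\<exists>Q. Q \<in> lmeasurable \<and> Q \<subseteq> {x i<..<x (Suc i)} \<times> {x j<..<x (Suc j)} \<and>
    measure lebesgue Q = step i * step j / 256 \<and> (\<forall>p\<in>Q. corner_sum v i j / 16 \<le> (v p)\<^sup>2)"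
proof -
  obtain \<alpha> \<beta> :: real where ab: "\<alpha> \<in> {0..15/16}" "\<beta> \<in> {0..15/16}"
    and ge: "\<And>s t. s \<in> {\<alpha>..\<alpha> + 1/16} \<Longrightarrow> t \<in> {\<beta>..\<beta> + 1/16} \<Longrightarrow>
      ((nodal v i j)\<^sup>2 + (nodal v (Suc i) j)\<^sup>2 + (nodal v (Suc i) (Suc j))\<^sup>2 + (nodal v i (Suc j))\<^sup>2) / 16 \<le>
      (shape (kind i j) (nodal v i j) (nodal v (Suc i) j) (nodal v (Suc i) (Suc j)) (nodal v i (Suc j)) s t)\<^sup>2"
    using shape_square_ge[of "nodal v i j" "nodal v (Suc i) j" "nodal v (Suc i) (Suc j)" "nodal v i (Suc j)" "kind i j"] by blast
  define h k where "h = step i" and "k = step j"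
  have h: "0 < h" "x (Suc i) = x i + h" and k: "0 < k" "x (Suc j) = x j + k"
    using step_pos[OF ij(1)] step_pos[OF ij(2)] by (auto simp: h_def k_def step_def)
  define Q where "Q = {x i + \<alpha> * h<..<x i + (\<alpha> + 1/16) * h} \<times> {x j + \<beta> * k<..<x j + (\<beta> + 1/16) * k}"
  have scale: "0 \<le> \<gamma> * r" "(\<gamma> + 1/16) * r \<le> r" if "\<gamma> \<in> {0..15/16}" "0 < r" for \<gamma> r :: real
    using that mult_right_mono[of "\<gamma> + 1/16" 1 r] by auto
  have sub: "Q \<subseteq> {x i<..<x (Suc i)} \<times> {x j<..<x (Suc j)}"
    unfolding Q_def h k using scale[OF ab(1) h(1)] scale[OF ab(2) k(1)] by auto
  have "Q \<in> lmeasurable" "measure lebesgue Q = h / 16 * (k / 16)"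
    unfolding Q_def using rectangle_measure(1,2)[of "x i + \<alpha> * h" "x i + (\<alpha> + 1/16) * h" "x j + \<beta> * k" "x j + (\<beta> + 1/16) * k"] h k
    by (auto simp: algebra_simps)
  moreover have "corner_sum v i j / 16 \<le> (v p)\<^sup>2" if p: "p \<in> Q" for p
  proof -
    have "p \<in> cell i j"
      using p sub by (fastforce simp: cell_def)
    then have "v p = cell_shape (nodal v) i j p"
      by (rule fe_spaceD(3)[OF v ij])
    moreover have "loc i (fst p) \<in> {\<alpha>..\<alpha> + 1/16}" "loc j (snd p) \<in> {\<beta>..\<beta> + 1/16}"
      using p h(1) k(1) by (auto simp: Q_def loc_def h_def[symmetric] k_def[symmetric] step_def[symmetric] field_simps)
    ultimately show ?thesis
      using ge by (simp add: cell_shape_def corner_sum_def)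
  qed
  ultimately show ?thesis
    using sub by (intro exI[of _ Q]) (auto simp: h_def k_def)
qed

text \<open>On 1/256 of each cell the square of \<open>v\<close> is at least 1/16 of the corner sum,
  and these boxes are disjoint; 4096 = 16 * 256.\<close>

lemma corner_sums_le_integral:
  assumes v: "v \<in> fe_space"
  shows "(\<Sum>i<N. \<Sum>j<N. corner_sum v i j * (step i * step j)) \<le> 4096 * inner_L2 unit_square v v"
proof -
  let ?M = "lebesgue_on unit_square"
  let ?A = "{..<N} \<times> {..<N}"
  have "\<forall>q\<in>?A. \<exists>Q. Q \<in> lmeasurable \<and> Q \<subseteq> {x (fst q)<..<x (Suc (fst q))} \<times> {x (snd q)<..<x (Suc (snd q))} \<and>
    measure lebesgue Q = step (fst q) * step (snd q) / 256 \<and> (\<forall>p\<in>Q. corner_sum v (fst q) (snd q) / 16 \<le> (v p)\<^sup>2)"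
    using corner_box[OF v] by auto
  then obtain Q where "\<forall>q\<in>?A. Q q \<in> lmeasurable \<and> Q q \<subseteq> {x (fst q)<..<x (Suc (fst q))} \<times> {x (snd q)<..<x (Suc (snd q))} \<and>
    measure lebesgue (Q q) = step (fst q) * step (snd q) / 256 \<and> (\<forall>p\<in>Q q. corner_sum v (fst q) (snd q) / 16 \<le> (v p)\<^sup>2)"
    by (rule bchoice[THEN exE])
  then have Q: "\<And>q. q \<in> ?A \<Longrightarrow> Q q \<in> lmeasurable"
    "\<And>q. q \<in> ?A \<Longrightarrow> Q q \<subseteq> {x (fst q)<..<x (Suc (fst q))} \<times> {x (snd q)<..<x (Suc (snd q))}"
    "\<And>q. q \<in> ?A \<Longrightarrow> measure lebesgue (Q q) = step (fst q) * step (snd q) / 256"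
    "\<And>q p. q \<in> ?A \<Longrightarrow> p \<in> Q q \<Longrightarrow> corner_sum v (fst q) (snd q) / 16 \<le> (v p)\<^sup>2"
    by blast+
  have QU: "Q q \<subseteq> unit_square" if "q \<in> ?A" for q
    using Q(2)[OF that] that x_unit[of "fst q"] x_unit[of "Suc (fst q)"] x_unit[of "snd q"] x_unit[of "Suc (snd q)"]
    by (fastforce simp: unit_square_def)
  have same: "i = i'" if "x i < r" "r < x (Suc i)" "x i' < r" "r < x (Suc i')" "i < N" "i' < N" for i i' r
  proof (rule ccontr)
    assume "i \<noteq> i'"
    then consider "Suc i \<le> i'" | "Suc i' \<le> i" by linarith
    then show False
      using that x_mono[of "Suc i" i'] x_mono[of "Suc i'" i] by cases auto
  qed
  have disj: "q = q'" if "p \<in> Q q" "p \<in> Q q'" "q \<in> ?A" "q' \<in> ?A" for p q q'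
    using that Q(2)[OF that(3)] Q(2)[OF that(4)] same[of "fst q" "fst p" "fst q'"] same[of "snd q" "snd p" "snd q'"]
    by (force simp: prod_eq_iff mem_Times_iff)
  define c where "c q = corner_sum v (fst q) (snd q) / 16" for q
  have c0: "0 \<le> c q" for q
    using corner_sum_nonneg by (simp add: c_def)
  have ind: "integrable ?M (\<lambda>p. indicator (Q q) p :: real)" "(LINT p|?M. indicator (Q q) p) = measure lebesgue (Q q)"
    if "q \<in> ?A" for q
  proof -
    have eq: "indicator unit_square p *\<^sub>R (indicator (Q q) p :: real) = indicator (Q q) p" for p
      using QU[OF that] by (auto simp: indicator_def)
    show "integrable ?M (\<lambda>p. indicator (Q q) p :: real)"
      using Q(1)[OF that] by (simp add: integrable_restrict_space sets_unit_square eq lmeasurable_iff_integrable del: real_scaleR_def)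
    show "(LINT p|?M. indicator (Q q) p) = measure lebesgue (Q q)"
      by (subst integral_restrict_space) (auto simp: sets_unit_square eq simp del: real_scaleR_def)
  qed
  have "(\<Sum>q\<in>?A. c q * (step (fst q) * step (snd q) / 256)) = (\<Sum>q\<in>?A. c q * (LINT p|?M. indicator (Q q) p))"
    by (intro sum.cong refl arg_cong2[where f = "(*)"]) (simp only: ind(2) Q(3))
  also have "\<dots> = (LINT p|?M. (\<Sum>q\<in>?A. c q * indicator (Q q) p))"
    using ind by (subst Bochner_Integration.integral_sum) auto
  also have "\<dots> \<le> (LINT p|?M. v p * v p)"
  proof (rule integral_mono)
    show "integrable ?M (\<lambda>p. v p * v p)"
      using fe_space_H1[OF v] by (intro L2_integrable_mult H1_L2)
    show "integrable ?M (\<lambda>p. \<Sum>q\<in>?A. c q * indicator (Q q) p)"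
      using ind by (intro Bochner_Integration.integrable_sum integrable_mult_right) auto
    fix p
    show "(\<Sum>q\<in>?A. c q * indicator (Q q) p) \<le> v p * v p"
    proof (cases "\<exists>q\<in>?A. p \<in> Q q")
      case True
      then obtain q where q: "q \<in> ?A" "p \<in> Q q" by blast
      have "(\<Sum>q\<in>?A. c q * indicator (Q q) p) = (\<Sum>q\<in>{q}. c q * indicator (Q q) p)"
      proof (rule sum.mono_neutral_right)
        show "\<forall>r\<in>?A - {q}. c r * indicator (Q r) p = 0"
        proof
          fix r assume r: "r \<in> ?A - {q}"
          then have "p \<notin> Q r"
            using disj[of p q r] q by blast
          then show "c r * indicator (Q r) p = 0" by simp
        qed
      qed (use q in auto)
      also have "\<dots> \<le> v p * v p"
        using Q(4)[OF q] q by (simp add: c_def power2_eq_square)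
      finally show ?thesis .
    next
      case False
      have "(\<Sum>q\<in>?A. c q * indicator (Q q) p) = 0"
      proof (intro sum.neutral ballI)
        fix r assume "r \<in> ?A"
        then have "p \<notin> Q r" using False by blast
        then show "c r * indicator (Q r) p = 0" by simp
      qed
      then show ?thesis by simp
    qed
  qed
  finally have le: "(\<Sum>q\<in>?A. c q * (step (fst q) * step (snd q) / 256)) \<le> inner_L2 unit_square v v"
    by (simp add: inner_L2_def)
  have "(\<Sum>i<N. \<Sum>j<N. corner_sum v i j * (step i * step j)) = 4096 * (\<Sum>q\<in>?A. c q * (step (fst q) * step (snd q) / 256))"
    unfolding sum.cartesian_product sum_distrib_left
    by (intro sum.cong) (auto simp: c_def)
  then show ?thesis using le by simp
qed

text \<open>The squared bound 16 / step^2 times the cell area is 16 times the ratio of the two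
  sides, at most 16 * (H / h). The two directions give 32.\<close>

lemma inner_grad_le_corner_sums:
  assumes v: "v \<in> fe_space" and h: "0 < h" "\<And>i. i < N \<Longrightarrow> h \<le> step i" "\<And>i. i < N \<Longrightarrow> step i \<le> H"
  shows "inner_grad unit_square v v \<le> 32 * (H / h) * (\<Sum>i<N. \<Sum>j<N. corner_sum v i j)"
proof -
  obtain M where "piecewise_bilinear_function v M skeleton"
    using piecewise_bilinear_fe_space[OF v] .
  then interpret piecewise_bilinear_function v M skeleton .
  have eq: "inner_L2 unit_square (weak_partial unit_square b v) (weak_partial unit_square b v) =
      (LINT p|lebesgue_on unit_square. (partial b v p)\<^sup>2)" if b: "b \<in> Basis" for b
  proof -
    have "inner_L2 unit_square (weak_partial unit_square b v) (weak_partial unit_square b v) =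
      inner_L2 unit_square (partial b v) (partial b v)"
      by (intro inner_L2_cong_AE weak_partial_v b partial_measurable L2_measurable weak_partial_props(1)[OF v_H1])
    then show ?thesis by (simp add: inner_L2_def power2_eq_square)
  qed
  have ratio: "s / t \<le> H / h" if "i < N" "j < N" "s = step i" "t = step j" for i j s t
    using that h(2)[OF that(2)] h(3)[OF that(1)] h(1) step_pos[OF that(1)] by (intro frac_le) auto
  have sq: "(partial b v p)\<^sup>2 \<le> 16 * corner_sum v i j / s\<^sup>2" if "\<bar>partial b v p\<bar> \<le> 4 * sqrt (corner_sum v i j) / s" "0 < s" for b p i j s
  proof -
    have "(partial b v p)\<^sup>2 \<le> (4 * sqrt (corner_sum v i j) / s)\<^sup>2"
      using that abs_le_square_iff[of "partial b v p" "4 * sqrt (corner_sum v i j) / s"] corner_sum_nonneg[of v i j] by simp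
    then show ?thesis
      using corner_sum_nonneg[of v i j] by (simp add: power_divide power_mult_distrib)
  qed
  have 1: "(LINT p|lebesgue_on unit_square. (partial (1, 0) v p)\<^sup>2) \<le> (\<Sum>i<N. \<Sum>j<N. 16 * corner_sum v i j / (step i)\<^sup>2 * (step i * step j))"
    using partial_le_corner_sum(1)[OF v] sq step_pos corner_sum_nonneg by (intro integral_le_cells) auto
  have 2: "(LINT p|lebesgue_on unit_square. (partial (0, 1) v p)\<^sup>2) \<le> (\<Sum>i<N. \<Sum>j<N. 16 * corner_sum v i j / (step j)\<^sup>2 * (step i * step j))"
    using partial_le_corner_sum(2)[OF v] sq step_pos corner_sum_nonneg by (intro integral_le_cells) auto
  have 3: "16 * corner_sum v i j / (step i)\<^sup>2 * (step i * step j) \<le> 16 * (H / h) * corner_sum v i j"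
    "16 * corner_sum v i j / (step j)\<^sup>2 * (step i * step j) \<le> 16 * (H / h) * corner_sum v i j" if "i < N" "j < N" for i j
    using mult_left_mono[OF ratio[OF that(2,1) refl refl], of "16 * corner_sum v i j"]
      mult_left_mono[OF ratio[OF that(1,2) refl refl], of "16 * corner_sum v i j"] corner_sum_nonneg[of v i j]
      step_pos[OF that(1)] step_pos[OF that(2)] by (auto simp: power2_eq_square mult_ac)
  have "inner_grad unit_square v v = (LINT p|lebesgue_on unit_square. (partial (1, 0) v p)\<^sup>2) + (LINT p|lebesgue_on unit_square. (partial (0, 1) v p)\<^sup>2)"
  proof -
    have Bs: "(Basis :: (real \<times> real) set) = {(1, 0), (0, 1)}" by (auto simp: Basis_square)
    have "inner_grad unit_square v v = (\<Sum>b\<in>Basis. (LINT p|lebesgue_on unit_square. (partial b v p)\<^sup>2))"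
      unfolding inner_grad_def by (intro sum.cong refl eq)
    also have "\<dots> = (\<Sum>b\<in>{(1, 0), (0, 1)}. (LINT p|lebesgue_on unit_square. (partial b v p)\<^sup>2))"
      by (simp only: Bs)
    finally show ?thesis by simp
  qed
  also have "\<dots> \<le> (\<Sum>i<N. \<Sum>j<N. 16 * (H / h) * corner_sum v i j) + (\<Sum>i<N. \<Sum>j<N. 16 * (H / h) * corner_sum v i j)"
    using 1 2 3 by (intro add_mono order_trans[OF 1] order_trans[OF 2] sum_mono) auto
  also have "\<dots> = 32 * (H / h) * (\<Sum>i<N. \<Sum>j<N. corner_sum v i j)"
    unfolding sum_distrib_left[symmetric] by simp
  finally show ?thesis .
qed

end

section \<open>Identification with the bilinear and linear element spaces\<close>

context tensor_mesh
begin

lemma loc_bilinear: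
  "i < N \<Longrightarrow> j < N \<Longrightarrow> A + B * loc i s + C * loc j t + E * loc i s * loc j t =
    (A - B * x i / step i - C * x j / step j + E * x i * x j / (step i * step j)) +
    (B / step i - E * x j / (step i * step j)) * s + (C / step j - E * x i / (step i * step j)) * t + E / (step i * step j) * s * t"
  unfolding loc_def step_def[symmetric] using step_pos[of i] step_pos[of j] by (simp add: field_simps)

lemma loc_affine:
  "i < N \<Longrightarrow> j < N \<Longrightarrow> A + B * loc i s + C * loc j t =
    (A - B * x i / step i - C * x j / step j) + B / step i * s + C / step j * t"
  using loc_bilinear[of i j A B s C t 0] by simp

lemma x_loc: "i < N \<Longrightarrow> x i + loc i s * step i = s" "i < N \<Longrightarrow> x (Suc i) = x i + step i"
  using step_pos[of i] by (auto simp: loc_def step_def)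

lemma loc_x: "i < N \<Longrightarrow> loc i (x i + r * step i) = r"
  using step_pos[of i] by (auto simp: loc_def step_def)

lemma corners_in_cell:
  "i < N \<Longrightarrow> j < N \<Longrightarrow> {(x i, x j), (x (Suc i), x j), (x (Suc i), x (Suc j)), (x i, x (Suc j))} \<subseteq> cell i j"
  using x_less[of i] x_less[of j] by (auto simp: cell_def)

text \<open>Axis-parallel affine maps preserve bilinear polynomials, and the four corner values
  determine such a polynomial.\<close>

lemma bilinear_on_cell_iff:
  assumes ij: "i < N" "j < N" and k: "kind i j = Quad"
  shows "bilinear_on (cell i j) v \<longleftrightarrow> (\<forall>p\<in>cell i j. v p = cell_shape (nodal v) i j p)"
proof
  assume "bilinear_on (cell i j) v"
  then obtain a b c e where v: "v (s, t) = a + b * s + c * t + e * s * t" if "(s, t) \<in> cell i j" for s t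
    unfolding bilinear_on_def by blast
  have n: "nodal v i j = a + b * x i + c * x j + e * x i * x j"
    "nodal v (Suc i) j = a + b * x (Suc i) + c * x j + e * x (Suc i) * x j"
    "nodal v (Suc i) (Suc j) = a + b * x (Suc i) + c * x (Suc j) + e * x (Suc i) * x (Suc j)"
    "nodal v i (Suc j) = a + b * x i + c * x (Suc j) + e * x i * x (Suc j)"
    using corners_in_cell[OF ij] by (simp_all add: nodal_def v)
  show "\<forall>p\<in>cell i j. v p = cell_shape (nodal v) i j p"
  proof
    fix p assume p: "p \<in> cell i j"
    define s t where "s = loc i (fst p)" and "t = loc j (snd p)"
    have pe: "fst p = x i + s * step i" "snd p = x j + t * step j"
      unfolding s_def t_def using x_loc ij by simp_all
    have "v p = a + b * fst p + c * snd p + e * fst p * snd p"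
      using v[of "fst p" "snd p"] p by simp
    also have "\<dots> = cell_shape (nodal v) i j p"
      unfolding cell_shape_def k shape.simps s_def[symmetric] t_def[symmetric] n pe x_loc(2)[OF ij(1)] x_loc(2)[OF ij(2)]
      by (simp add: loc_x[OF ij(1)] loc_x[OF ij(2)] algebra_simps)
    finally show "v p = cell_shape (nodal v) i j p" .
  qed
next
  assume v: "\<forall>p\<in>cell i j. v p = cell_shape (nodal v) i j p"
  have "cell_shape (nodal v) i j (s, t) = nodal v i j + (nodal v (Suc i) j - nodal v i j) * loc i s + (nodal v i (Suc j) - nodal v i j) * loc j t +
      (nodal v i j - nodal v (Suc i) j + nodal v (Suc i) (Suc j) - nodal v i (Suc j)) * loc i s * loc j t" for s t
    by (simp add: cell_shape_def k algebra_simps)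
  then obtain a b c e where "cell_shape (nodal v) i j (s, t) = a + b * s + c * t + e * s * t" for s t
    unfolding loc_bilinear[OF ij] by blast
  then have "\<forall>(s, t)\<in>cell i j. v (s, t) = a + b * s + c * t + e * s * t"
    using v by auto
  then show "bilinear_on (cell i j) v"
    unfolding bilinear_on_def by blast
qed

definition triangle :: "(real \<Rightarrow> real \<Rightarrow> bool) \<Rightarrow> nat \<Rightarrow> nat \<Rightarrow> (real \<times> real) set" where
  "triangle P i j = {p \<in> cell i j. P (loc i (fst p)) (loc j (snd p))}"

text \<open>The witnesses are barycentric coordinates of the reference point (s, t), for instance 1
  - s, t and s - t below the main diagonal.\<close>

lemma convex_hull_triangle:
  assumes ij: "i < N" "j < N"
  shows "convex hull {(x i, x j), (x (Suc i), x (Suc j)), (x (Suc i), x j)} = triangle (\<lambda>s t. t \<le> s) i j"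
    "convex hull {(x i, x j), (x (Suc i), x (Suc j)), (x i, x (Suc j))} = triangle (\<lambda>s t. s \<le> t) i j"
    "convex hull {(x (Suc i), x j), (x i, x (Suc j)), (x i, x j)} = triangle (\<lambda>s t. s + t \<le> 1) i j"
    "convex hull {(x (Suc i), x j), (x i, x (Suc j)), (x (Suc i), x (Suc j))} = triangle (\<lambda>s t. 1 \<le> s + t) i j"
proof -
  have param: "p \<in> triangle P i j \<longleftrightarrow> (\<exists>s t. 0 \<le> s \<and> s \<le> 1 \<and> 0 \<le> t \<and> t \<le> 1 \<and> P s t \<and> p = (x i + s * step i, x j + t * step j))" for p P
  proof
    assume p: "p \<in> triangle P i j"
    then have "fst p \<in> {x i..x (Suc i)}" "snd p \<in> {x j..x (Suc j)}"
      by (auto simp: triangle_def cell_def)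
    then show "\<exists>s t. 0 \<le> s \<and> s \<le> 1 \<and> 0 \<le> t \<and> t \<le> 1 \<and> P s t \<and> p = (x i + s * step i, x j + t * step j)"
      using p loc_unit[of i "fst p"] loc_unit[of j "snd p"] ij x_loc(1)
      by (intro exI[of _ "loc i (fst p)"] exI[of _ "loc j (snd p)"]) (auto simp: triangle_def prod_eq_iff)
  next
    assume "\<exists>s t. 0 \<le> s \<and> s \<le> 1 \<and> 0 \<le> t \<and> t \<le> 1 \<and> P s t \<and> p = (x i + s * step i, x j + t * step j)"
    then obtain s t where st: "0 \<le> s" "s \<le> 1" "0 \<le> t" "t \<le> 1" "P s t" "p = (x i + s * step i, x j + t * step j)"
      by blast
    then have "s * step i \<le> step i" "t * step j \<le> step j" "0 \<le> s * step i" "0 \<le> t * step j"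
      using step_pos[OF ij(1)] step_pos[OF ij(2)] by (auto simp: mult_le_cancel_right1)
    then show "p \<in> triangle P i j"
      using st ij by (simp add: triangle_def cell_def loc_x x_loc(2))
  qed
  note hull = convex_hull_3 x_loc(2)[OF ij(1)] x_loc(2)[OF ij(2)]
  show "convex hull {(x i, x j), (x (Suc i), x (Suc j)), (x (Suc i), x j)} = triangle (\<lambda>s t. t \<le> s) i j"
  proof (intro equalityI subsetI)
    fix p assume "p \<in> convex hull {(x i, x j), (x (Suc i), x (Suc j)), (x (Suc i), x j)}"
    then obtain u v w where "0 \<le> u" "0 \<le> v" "0 \<le> w" "u + v + w = 1"
      "p = u *\<^sub>R (x i, x j) + v *\<^sub>R (x (Suc i), x (Suc j)) + w *\<^sub>R (x (Suc i), x j)"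
      unfolding convex_hull_3 by blast
    moreover from this have "u = 1 - v - w" by simp
    ultimately show "p \<in> triangle (\<lambda>s t. t \<le> s) i j"
      unfolding param using ij by (intro exI[of _ "v + w"] exI[of _ v]) (auto simp: x_loc(2) algebra_simps)
  next
    fix p assume "p \<in> triangle (\<lambda>s t. t \<le> s) i j"
    then obtain s t where "0 \<le> s" "s \<le> 1" "0 \<le> t" "t \<le> 1" "t \<le> s" "p = (x i + s * step i, x j + t * step j)"
      unfolding param by blast
    then show "p \<in> convex hull {(x i, x j), (x (Suc i), x (Suc j)), (x (Suc i), x j)}"
      unfolding convex_hull_3 using ij by (intro CollectI exI[of _ "1 - s"] exI[of _ t] exI[of _ "s - t"]) (auto simp: x_loc(2) algebra_simps)
  qed
  show "convex hull {(x i, x j), (x (Suc i), x (Suc j)), (x i, x (Suc j))} = triangle (\<lambda>s t. s \<le> t) i j"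
  proof (intro equalityI subsetI)
    fix p assume "p \<in> convex hull {(x i, x j), (x (Suc i), x (Suc j)), (x i, x (Suc j))}"
    then obtain u v w where "0 \<le> u" "0 \<le> v" "0 \<le> w" "u + v + w = 1"
      "p = u *\<^sub>R (x i, x j) + v *\<^sub>R (x (Suc i), x (Suc j)) + w *\<^sub>R (x i, x (Suc j))"
      unfolding convex_hull_3 by blast
    moreover from this have "u = 1 - v - w" by simp
    ultimately show "p \<in> triangle (\<lambda>s t. s \<le> t) i j"
      unfolding param using ij by (intro exI[of _ v] exI[of _ "v + w"]) (auto simp: x_loc(2) algebra_simps)
  next
    fix p assume "p \<in> triangle (\<lambda>s t. s \<le> t) i j"
    then obtain s t where "0 \<le> s" "s \<le> 1" "0 \<le> t" "t \<le> 1" "s \<le> t" "p = (x i + s * step i, x j + t * step j)"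
      unfolding param by blast
    then show "p \<in> convex hull {(x i, x j), (x (Suc i), x (Suc j)), (x i, x (Suc j))}"
      unfolding convex_hull_3 using ij by (intro CollectI exI[of _ "1 - t"] exI[of _ s] exI[of _ "t - s"]) (auto simp: x_loc(2) algebra_simps)
  qed
  show "convex hull {(x (Suc i), x j), (x i, x (Suc j)), (x i, x j)} = triangle (\<lambda>s t. s + t \<le> 1) i j"
  proof (intro equalityI subsetI)
    fix p assume "p \<in> convex hull {(x (Suc i), x j), (x i, x (Suc j)), (x i, x j)}"
    then obtain u v w where "0 \<le> u" "0 \<le> v" "0 \<le> w" "u + v + w = 1"
      "p = u *\<^sub>R (x (Suc i), x j) + v *\<^sub>R (x i, x (Suc j)) + w *\<^sub>R (x i, x j)"
      unfolding convex_hull_3 by blast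
    moreover from this have "w = 1 - u - v" by simp
    ultimately show "p \<in> triangle (\<lambda>s t. s + t \<le> 1) i j"
      unfolding param using ij by (intro exI[of _ u] exI[of _ v]) (auto simp: x_loc(2) algebra_simps)
  next
    fix p assume "p \<in> triangle (\<lambda>s t. s + t \<le> 1) i j"
    then obtain s t where "0 \<le> s" "s \<le> 1" "0 \<le> t" "t \<le> 1" "s + t \<le> 1" "p = (x i + s * step i, x j + t * step j)"
      unfolding param by blast
    then show "p \<in> convex hull {(x (Suc i), x j), (x i, x (Suc j)), (x i, x j)}"
      unfolding convex_hull_3 using ij by (intro CollectI exI[of _ s] exI[of _ t] exI[of _ "1 - s - t"]) (auto simp: x_loc(2) algebra_simps)
  qed
  show "convex hull {(x (Suc i), x j), (x i, x (Suc j)), (x (Suc i), x (Suc j))} = triangle (\<lambda>s t. 1 \<le> s + t) i j"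
  proof (intro equalityI subsetI)
    fix p assume "p \<in> convex hull {(x (Suc i), x j), (x i, x (Suc j)), (x (Suc i), x (Suc j))}"
    then obtain u v w where "0 \<le> u" "0 \<le> v" "0 \<le> w" "u + v + w = 1"
      "p = u *\<^sub>R (x (Suc i), x j) + v *\<^sub>R (x i, x (Suc j)) + w *\<^sub>R (x (Suc i), x (Suc j))"
      unfolding convex_hull_3 by blast
    moreover from this have "w = 1 - u - v" by simp
    ultimately show "p \<in> triangle (\<lambda>s t. 1 \<le> s + t) i j"
      unfolding param using ij by (intro exI[of _ "1 - v"] exI[of _ "1 - u"]) (auto simp: x_loc(2) algebra_simps)
  next
    fix p assume "p \<in> triangle (\<lambda>s t. 1 \<le> s + t) i j"
    then obtain s t where "0 \<le> s" "s \<le> 1" "0 \<le> t" "t \<le> 1" "1 \<le> s + t" "p = (x i + s * step i, x j + t * step j)"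
      unfolding param by blast
    then show "p \<in> convex hull {(x (Suc i), x j), (x i, x (Suc j)), (x (Suc i), x (Suc j))}"
      unfolding convex_hull_3 using ij by (intro CollectI exI[of _ "1 - t"] exI[of _ "1 - s"] exI[of _ "s + t - 1"]) (auto simp: x_loc(2) algebra_simps)
  qed
qed

text \<open>An affine function is determined by its values at three points that are not collinear,
  which is the meaning of \<open>det\<close>. \<open>S\<close> is a shape function in reference
  coordinates, affine on the triangle; all four kinds of triangle are instances.\<close>

lemma linear_fun_on_triangle_iff:
  assumes ij: "i < N" "j < N"
    and abc: "\<And>s t. P s t \<Longrightarrow> S s t = A + B * s + C * t"
    and corners: "P s1 t1" "P s2 t2" "P s3 t3" "(s1, t1) \<in> {0..1} \<times> {0..1}" "(s2, t2) \<in> {0..1} \<times> {0..1}" "(s3, t3) \<in> {0..1} \<times> {0..1}"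
    and det: "(s2 - s1) * (t3 - t1) - (s3 - s1) * (t2 - t1) \<noteq> 0"
    and vals: "v (x i + s1 * step i, x j + t1 * step j) = S s1 t1" "v (x i + s2 * step i, x j + t2 * step j) = S s2 t2"
      "v (x i + s3 * step i, x j + t3 * step j) = S s3 t3"
  shows "linear_fun_on (triangle P i j) v \<longleftrightarrow> (\<forall>p\<in>triangle P i j. v p = S (loc i (fst p)) (loc j (snd p)))"
proof
  assume "linear_fun_on (triangle P i j) v"
  then obtain a b c where v: "v (s, t) = a + b * s + c * t" if "(s, t) \<in> triangle P i j" for s t
    unfolding linear_fun_on_def by blast
  define a' b' c' where "a' = a + b * x i + c * x j" and "b' = b * step i" and "c' = c * step j"
  have v': "v (x i + s * step i, x j + t * step j) = a' + b' * s + c' * t" if "P s t" "(s, t) \<in> {0..1} \<times> {0..1}" for s t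
  proof -
    have "s * step i \<le> step i" "t * step j \<le> step j" "0 \<le> s * step i" "0 \<le> t * step j"
      using step_pos[OF ij(1)] step_pos[OF ij(2)] that by (auto simp: mult_le_cancel_right1)
    then have "(x i + s * step i, x j + t * step j) \<in> triangle P i j"
      using that ij by (simp add: triangle_def cell_def loc_x x_loc(2))
    from v[OF this] show ?thesis
      by (simp add: a'_def b'_def c'_def algebra_simps)
  qed
  \<comment> \<open>The coefficients of a difference of two affine functions that vanishes at the
    three vertices. Elimination as in Cramer's rule multiplies them by the nonzero
    determinant.\<close>
  define da db dc where "da = a' - A" and "db = b' - B" and "dc = c' - C"
  have e: "da + db * s1 + dc * t1 = 0" "da + db * s2 + dc * t2 = 0" "da + db * s3 + dc * t3 = 0"
    using v'[OF corners(1,4)] v'[OF corners(2,5)] v'[OF corners(3,6)] vals abc[OF corners(1)] abc[OF corners(2)] abc[OF corners(3)]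
    by (auto simp: da_def db_def dc_def algebra_simps)
  have e1: "db * (s2 - s1) + dc * (t2 - t1) = 0" "db * (s3 - s1) + dc * (t3 - t1) = 0"
    using e by (simp_all add: algebra_simps)
  have "db * ((s2 - s1) * (t3 - t1) - (s3 - s1) * (t2 - t1)) =
      (db * (s2 - s1) + dc * (t2 - t1)) * (t3 - t1) - (db * (s3 - s1) + dc * (t3 - t1)) * (t2 - t1)"
    by (simp add: algebra_simps)
  then have "db = 0" using e1 det by simp
  have "dc * ((s2 - s1) * (t3 - t1) - (s3 - s1) * (t2 - t1)) =
      (db * (s3 - s1) + dc * (t3 - t1)) * (s2 - s1) - (db * (s2 - s1) + dc * (t2 - t1)) * (s3 - s1)"
    by (simp add: algebra_simps)
  then have "dc = 0" using e1 det by simp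
  with \<open>db = 0\<close> e(1) have "da = 0" by simp
  show "\<forall>p\<in>triangle P i j. v p = S (loc i (fst p)) (loc j (snd p))"
  proof
    fix p assume p: "p \<in> triangle P i j"
    then have P: "P (loc i (fst p)) (loc j (snd p))" and c: "fst p \<in> {x i..x (Suc i)}" "snd p \<in> {x j..x (Suc j)}"
      by (auto simp: triangle_def cell_def)
    have "v (x i + loc i (fst p) * step i, x j + loc j (snd p) * step j) = a' + b' * loc i (fst p) + c' * loc j (snd p)"
      using loc_unit[OF ij(1) c(1)] loc_unit[OF ij(2) c(2)] by (intro v' P) auto
    then show "v p = S (loc i (fst p)) (loc j (snd p))"
      using \<open>da = 0\<close> \<open>db = 0\<close> \<open>dc = 0\<close> abc[OF P] ij by (simp add: x_loc(1) da_def db_def dc_def)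
  qed
next
  assume "\<forall>p\<in>triangle P i j. v p = S (loc i (fst p)) (loc j (snd p))"
  then have "v (s, t) = (A - B * x i / step i - C * x j / step j) + B / step i * s + C / step j * t" if "(s, t) \<in> triangle P i j" for s t
    using that abc[of "loc i s" "loc j t"] loc_affine[OF ij] by (auto simp: triangle_def)
  then show "linear_fun_on (triangle P i j) v"
    unfolding linear_fun_on_def by blast
qed

lemma linear_on_Diag_iff:
  assumes ij: "i < N" "j < N" and k: "kind i j = Diag"
  shows "linear_fun_on (triangle (\<lambda>s t. t \<le> s) i j) v \<and> linear_fun_on (triangle (\<lambda>s t. s \<le> t) i j) v
    \<longleftrightarrow> (\<forall>p\<in>cell i j. v p = cell_shape (nodal v) i j p)"
proof -
  define S where "S = shape (kind i j) (nodal v i j) (nodal v (Suc i) j) (nodal v (Suc i) (Suc j)) (nodal v i (Suc j))"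
  have SE: "S s t = (1 - max s t) * nodal v i j + max 0 (s - t) * nodal v (Suc i) j + min s t * nodal v (Suc i) (Suc j) + max 0 (t - s) * nodal v i (Suc j)" for s t
    by (simp add: S_def k)
  note n = nodal_def x_loc(2)[OF ij(1)] x_loc(2)[OF ij(2)]
  have 1: "linear_fun_on (triangle (\<lambda>s t. t \<le> s) i j) v \<longleftrightarrow> (\<forall>p\<in>triangle (\<lambda>s t. t \<le> s) i j. v p = S (loc i (fst p)) (loc j (snd p)))"
    by (rule linear_fun_on_triangle_iff[OF ij, where A = "nodal v i j" and B = "nodal v (Suc i) j - nodal v i j"
      and C = "nodal v (Suc i) (Suc j) - nodal v (Suc i) j" and ?s1.0 = 0 and ?t1.0 = 0 and ?s2.0 = 1 and ?t2.0 = 0 and ?s3.0 = 1 and ?t3.0 = 1])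
     (simp_all add: SE max_def min_def algebra_simps, simp_all add: n)
  have 2: "linear_fun_on (triangle (\<lambda>s t. s \<le> t) i j) v \<longleftrightarrow> (\<forall>p\<in>triangle (\<lambda>s t. s \<le> t) i j. v p = S (loc i (fst p)) (loc j (snd p)))"
    by (rule linear_fun_on_triangle_iff[OF ij, where A = "nodal v i j" and C = "nodal v i (Suc j) - nodal v i j"
      and B = "nodal v (Suc i) (Suc j) - nodal v i (Suc j)" and ?s1.0 = 0 and ?t1.0 = 0 and ?s2.0 = 0 and ?t2.0 = 1 and ?s3.0 = 1 and ?t3.0 = 1])
     (auto simp: SE max_def min_def algebra_simps, simp_all add: n)
  show ?thesis
    unfolding 1 2 by (auto simp: triangle_def cell_shape_def S_def) (meson linear)
qed

lemma linear_on_Anti_iff: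
  assumes ij: "i < N" "j < N" and k: "kind i j = Anti"
  shows "linear_fun_on (triangle (\<lambda>s t. s + t \<le> 1) i j) v \<and> linear_fun_on (triangle (\<lambda>s t. 1 \<le> s + t) i j) v
    \<longleftrightarrow> (\<forall>p\<in>cell i j. v p = cell_shape (nodal v) i j p)"
proof -
  define S where "S = shape (kind i j) (nodal v i j) (nodal v (Suc i) j) (nodal v (Suc i) (Suc j)) (nodal v i (Suc j))"
  have SE: "S s t = max 0 (1 - s - t) * nodal v i j + min s (1 - t) * nodal v (Suc i) j + max 0 (s + t - 1) * nodal v (Suc i) (Suc j) + min (1 - s) t * nodal v i (Suc j)" for s t
    by (simp add: S_def k)
  note n = nodal_def x_loc(2)[OF ij(1)] x_loc(2)[OF ij(2)]
  have 1: "linear_fun_on (triangle (\<lambda>s t. s + t \<le> 1) i j) v \<longleftrightarrow> (\<forall>p\<in>triangle (\<lambda>s t. s + t \<le> 1) i j. v p = S (loc i (fst p)) (loc j (snd p)))"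
    by (rule linear_fun_on_triangle_iff[OF ij, where A = "nodal v i j" and B = "nodal v (Suc i) j - nodal v i j"
      and C = "nodal v i (Suc j) - nodal v i j" and ?s1.0 = 0 and ?t1.0 = 0 and ?s2.0 = 1 and ?t2.0 = 0 and ?s3.0 = 0 and ?t3.0 = 1])
     (auto simp: SE max_def min_def algebra_simps, simp_all add: n, simp flip: distrib_right)
  have 2: "linear_fun_on (triangle (\<lambda>s t. 1 \<le> s + t) i j) v \<longleftrightarrow> (\<forall>p\<in>triangle (\<lambda>s t. 1 \<le> s + t) i j. v p = S (loc i (fst p)) (loc j (snd p)))"
    by (rule linear_fun_on_triangle_iff[OF ij, where A = "nodal v (Suc i) j + nodal v i (Suc j) - nodal v (Suc i) (Suc j)" and B = "nodal v (Suc i) (Suc j) - nodal v i (Suc j)"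
      and C = "nodal v (Suc i) (Suc j) - nodal v (Suc i) j" and ?s1.0 = 1 and ?t1.0 = 0 and ?s2.0 = 1 and ?t2.0 = 1 and ?s3.0 = 0 and ?t3.0 = 1])
     (auto simp: SE max_def min_def algebra_simps, simp_all add: n, simp flip: distrib_right)
  show ?thesis
    unfolding 1 2 by (auto simp: triangle_def cell_shape_def S_def) (meson linear)
qed

end

section \<open>The Shishkin mesh\<close>

lemma mesh_pt_step:
  assumes "0 < N" "4 dvd N"
  shows "i < N div 4 \<Longrightarrow> mesh_pt l N (Suc i) - mesh_pt l N i = 4 * l / real N"
    "N div 4 \<le> i \<Longrightarrow> i < 3 * (N div 4) \<Longrightarrow> mesh_pt l N (Suc i) - mesh_pt l N i = 2 * (1 - 2 * l) / real N"
    "3 * (N div 4) \<le> i \<Longrightarrow> mesh_pt l N (Suc i) - mesh_pt l N i = 4 * l / real N"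
proof -
  obtain m where m: "N = 4 * m" "0 < m"
    using assms by auto
  show "mesh_pt l N (Suc i) - mesh_pt l N i = 4 * l / real N" if "i < N div 4"
    using that m by (simp add: mesh_pt_def field_simps)
  \<comment> \<open>At a transition index the two nodes come from different branches of
    \<open>mesh_pt\<close>, hence the separate case here and in the next claim.\<close>
  show "mesh_pt l N (Suc i) - mesh_pt l N i = 2 * (1 - 2 * l) / real N" if "N div 4 \<le> i" "i < 3 * (N div 4)"
    using that m by (cases "i = m") (simp_all add: mesh_pt_def field_simps)
  show "mesh_pt l N (Suc i) - mesh_pt l N i = 4 * l / real N" if "3 * (N div 4) \<le> i"
    using that m by (cases "i = 3 * m") (simp_all add: mesh_pt_def field_simps)
qed

lemma mesh_pt_values:
  assumes "0 < N" "4 dvd N"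
  shows "mesh_pt l N 0 = 0" "mesh_pt l N N = 1" "mesh_pt l N (N div 4) = l" "mesh_pt l N (3 * (N div 4)) = 1 - l"
proof -
  obtain m where m: "N = 4 * m" "0 < m"
    using assms by auto
  show "mesh_pt l N 0 = 0" "mesh_pt l N N = 1" "mesh_pt l N (N div 4) = l" "mesh_pt l N (3 * (N div 4)) = 1 - l"
    using m by (simp_all add: mesh_pt_def field_simps)
qed

lemma tensor_mesh_mesh_pt:
  assumes "0 < N" "4 dvd N" "0 < l" "l \<le> 1/4"
  shows "tensor_mesh (mesh_pt l N) N"
proof
  fix i assume "i < N"
  consider "i < N div 4" | "N div 4 \<le> i" "i < 3 * (N div 4)" | "3 * (N div 4) \<le> i"
    by linarith
  then have "mesh_pt l N (Suc i) - mesh_pt l N i > 0"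
    using assms by cases (simp_all add: mesh_pt_step)
  then show "mesh_pt l N i < mesh_pt l N (Suc i)" by simp
qed (use mesh_pt_values[OF assms(1,2)] in auto)

lemma bilinear_space_eq_fe_space:
  assumes "0 < N" "4 dvd N" "0 < l" "l \<le> 1/4"
  shows "bilinear_space l N = tensor_mesh.fe_space (mesh_pt l N) N (\<lambda>i j. Quad)"
proof -
  interpret tensor_mesh "mesh_pt l N" N "\<lambda>i j. Quad"
    using assms by (rule tensor_mesh_mesh_pt)
  have "mesh_rectangle l N i j = cell i j" for i j
    by (simp add: mesh_rectangle_def cell_def)
  then show ?thesis
    unfolding bilinear_space_def fe_space_def closure_unit_square using bilinear_on_cell_iff by auto
qed

lemma linear_space_eq_fe_space:
  assumes "0 < N" "4 dvd N" "0 < l" "l \<le> 1/4"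
  shows "linear_space d l N = tensor_mesh.fe_space (mesh_pt l N) N (\<lambda>i j. if d i j then Diag else Anti)"
proof -
  interpret tensor_mesh "mesh_pt l N" N "\<lambda>i j. if d i j then Diag else Anti"
    using assms by (rule tensor_mesh_mesh_pt)
  have "(\<forall>T\<in>mesh_triangles (d i j) l N i j. linear_fun_on T v) \<longleftrightarrow> (\<forall>p\<in>cell i j. v p = cell_shape (nodal v) i j p)"
    if ij: "i < N" "j < N" for i j v
  proof (cases "d i j")
    case True
    show ?thesis
      unfolding linear_on_Diag_iff[OF ij, symmetric, simplified True if_True, OF refl]
      by (simp add: mesh_triangles_def True convex_hull_triangle[OF ij] Let_def)
  next
    case False
    show ?thesis
      unfolding linear_on_Anti_iff[OF ij, symmetric, simplified False if_False, OF refl]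
      by (simp add: mesh_triangles_def False convex_hull_triangle[OF ij] Let_def)
  qed
  then show ?thesis
    unfolding linear_space_def fe_space_def closure_unit_square by auto
qed

subsection \<open>Removing the coarse part of a finite element function\<close>

lemma sum_nodes_le_cells:
  fixes f :: "nat \<Rightarrow> real"
  assumes "a < b" "\<And>i. 0 \<le> f i"
  shows "(\<Sum>i\<in>{a..b}. f i) \<le> (\<Sum>i\<in>{a..<b}. f i + f (Suc i))"
proof -
  have "f b \<le> (\<Sum>i\<in>{a..<b}. f (Suc i))"
    using member_le_sum[of "b - 1" "{a..<b}" "\<lambda>i. f (Suc i)"] assms by auto
  moreover have "{a..b} = insert b {a..<b}"
    using assms(1) by auto
  ultimately show ?thesis
    by (simp add: sum.distrib)
qed

lemma sum_shift_le:
  fixes f :: "nat \<Rightarrow> real"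
  assumes "\<And>i. 0 \<le> f i"
  shows "(\<Sum>i<N. f (Suc i)) \<le> (\<Sum>i\<le>N. f i)" "(\<Sum>i<N. f i) \<le> (\<Sum>i\<le>N. f i)"
proof -
  have "(\<Sum>i<N. f (Suc i)) = (\<Sum>i\<in>Suc ` {..<N}. f i)"
    by (simp add: sum.reindex)
  also have "\<dots> \<le> (\<Sum>i\<le>N. f i)"
    using assms by (intro sum_mono2) auto
  finally show "(\<Sum>i<N. f (Suc i)) \<le> (\<Sum>i\<le>N. f i)" .
  show "(\<Sum>i<N. f i) \<le> (\<Sum>i\<le>N. f i)"
    using assms by (intro sum_mono2) auto
qed

text \<open>Each node is a corner of at most four cells.\<close>

lemma sum_shift_le2:
  fixes f :: "nat \<Rightarrow> nat \<Rightarrow> real"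
  assumes f: "\<And>i j. 0 \<le> f i j"
  shows "(\<Sum>i<N. \<Sum>j<N. f i j + f (Suc i) j + f (Suc i) (Suc j) + f i (Suc j)) \<le> 4 * (\<Sum>i\<le>N. \<Sum>j\<le>N. f i j)"
proof -
  let ?U = "\<Sum>i\<le>N. \<Sum>j\<le>N. f i j"
  have 1: "(\<Sum>i<N. \<Sum>j<N. f i j) \<le> ?U" "(\<Sum>i<N. \<Sum>j<N. f i (Suc j)) \<le> ?U"
    by (rule order_trans[OF sum_mono[OF sum_shift_le(2)] sum_shift_le(2)], auto intro: f sum_nonneg)
      (rule order_trans[OF sum_mono[OF sum_shift_le(1)] sum_shift_le(2)], auto intro: f sum_nonneg)
  have 2: "(\<Sum>i<N. \<Sum>j<N. f (Suc i) j) \<le> ?U"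
    by (rule order_trans[OF sum_mono[OF sum_shift_le(2)[of "\<lambda>j. f (Suc _) j"]] sum_shift_le(1)[of "\<lambda>i. \<Sum>j\<le>N. f i j"]])
      (auto intro: f sum_nonneg)
  have 3: "(\<Sum>i<N. \<Sum>j<N. f (Suc i) (Suc j)) \<le> ?U"
    by (rule order_trans[OF sum_mono[OF sum_shift_le(1)[of "\<lambda>j. f (Suc _) j"]] sum_shift_le(1)[of "\<lambda>i. \<Sum>j\<le>N. f i j"]])
      (auto intro: f sum_nonneg)
  show ?thesis
    using 1 2 3 by (simp add: sum.distrib)
qed

text \<open>The conclusions serve different ends. Cancellation and the fine-region integral localise
  the second energy estimate, the gradient bound leads back from \<xi> + z to \<xi>, the maximum
  bound makes a Lipschitz constant available, and the clause for N = 4 is applied to the interpolant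
  itself in order to bound \<open>u\<close>. The constant 4096 of
  \<open>corner_sums_le_integral\<close> times 4 cells per node is 2 ^ 14; times 32 it is 2 ^
  19.\<close>

lemma shishkin_coarse_correction:
  fixes l :: real and N :: nat and kind :: "nat \<Rightarrow> nat \<Rightarrow> cell_kind"
  assumes N: "0 < N" "4 dvd N" and l: "0 < l" "l \<le> 1/4"
  defines "h \<equiv> 4 * l / real N" and "H \<equiv> 2 * (1 - 2 * l) / real N"
    and "W \<equiv> tensor_mesh.fe_space (mesh_pt l N) N kind"
  assumes \<xi>: "\<xi> \<in> W"
  shows "\<exists>z\<in>W. (\<forall>p\<in>coarse_region l. \<xi> p + z p = 0) \<and>
    inner_grad unit_square z z \<le> 2 ^ 19 / (h * H) * inner_L2 unit_square \<xi> \<xi> \<and>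
    (LINT p|lebesgue_on unit_square. indicator (unit_square - coarse_region l) p * (z p)\<^sup>2) \<le> 2 ^ 14 * (h / H) * inner_L2 unit_square \<xi> \<xi> \<and>
    (\<forall>p\<in>unit_square. (z p)\<^sup>2 \<le> 2 ^ 14 / H\<^sup>2 * inner_L2 unit_square \<xi> \<xi>) \<and>
    (N = 4 \<longrightarrow> (\<forall>p\<in>unit_square. z p = - \<xi> p))"
proof -
  interpret tensor_mesh "mesh_pt l N" N kind
    using N l by (rule tensor_mesh_mesh_pt)
  let ?x = "mesh_pt l N"
  have \<xi>': "\<xi> \<in> fe_space" using \<xi> by (simp add: W_def)
  obtain n where n: "N = 4 * n" "0 < n"
    using N by auto
  have nd: "N div 4 = n" and n3: "3 * n \<le> N" using n by simp_all
  have hH: "0 < h" "h \<le> H"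
    using l N by (auto simp: h_def H_def field_simps)
  have step_fine: "step i = h" if "i < n \<or> 3 * n \<le> i" for i
    using that mesh_pt_step(1,3)[OF N, of i l] by (auto simp: step_def h_def nd)
  have step_coarse: "step i = H" if "i \<in> {n..<3 * n}" for i
    using that mesh_pt_step(2)[OF N, of i l] by (auto simp: step_def H_def nd)
  have step_bounds: "h \<le> step i" "step i \<le> H" for i
    using step_fine[of i] step_coarse[of i] hH by (cases "i < n \<or> 3 * n \<le> i"; force)+
  have nonneg: "0 \<le> corner_sum \<xi> i j * (step i * step j)" for i j
    using step_bounds(1)[of i] step_bounds(1)[of j] hH(1)
    by (intro mult_nonneg_nonneg corner_sum_nonneg) linarith+
  \<comment> \<open>The indices n and 3 * n, with coordinates l and 1 - l, are included, so that
    every coarse cell has all four corners corrected.\<close>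
  define c where "c i j = (if i \<in> {n..3 * n} \<and> j \<in> {n..3 * n} then - nodal \<xi> i j else 0)" for i j
  obtain z where z: "z \<in> fe_space" and nz: "\<And>i j. i \<le> N \<Longrightarrow> j \<le> N \<Longrightarrow> nodal z i j = c i j"
  proof (rule interpolant_exists[of c])
    fix i j assume "i = 0 \<or> i = N \<or> j = 0 \<or> j = N"
    then show "c i j = 0" using n by (auto simp: c_def)
  qed blast
  \<comment> \<open>Only coarse cells are counted. Each has area H * H, so passing from mass to
    nodal values costs 1 / H^2 and never the small step h; every node where \<open>z\<close> may be
    nonzero is a corner of such a cell.\<close>
  define T where "T = (\<Sum>i\<in>{n..<3 * n}. \<Sum>j\<in>{n..<3 * n}. corner_sum \<xi> i j)"
  have "T * (H * H) = (\<Sum>i\<in>{n..<3 * n}. \<Sum>j\<in>{n..<3 * n}. corner_sum \<xi> i j * (step i * step j))"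
    unfolding T_def by (simp add: sum_distrib_right step_coarse)
  also have "\<dots> \<le> (\<Sum>i\<in>{n..<3 * n}. \<Sum>j<N. corner_sum \<xi> i j * (step i * step j))"
    by (intro sum_mono sum_mono2 nonneg) (use n in auto)
  also have "\<dots> \<le> (\<Sum>i<N. \<Sum>j<N. corner_sum \<xi> i j * (step i * step j))"
    by (intro sum_mono2 sum_nonneg nonneg) (use n in auto)
  also have "\<dots> \<le> 4096 * inner_L2 unit_square \<xi> \<xi>"
    by (rule corner_sums_le_integral[OF \<xi>'])
  finally have T: "T \<le> 4096 * inner_L2 unit_square \<xi> \<xi> / (H * H)"
    using hH by (simp add: pos_le_divide_eq)
  have "(\<Sum>i\<le>N. \<Sum>j\<le>N. (nodal z i j)\<^sup>2) = (\<Sum>i\<le>N. \<Sum>j\<le>N. (c i j)\<^sup>2)"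
    using nz by simp
  also have "\<dots> = (\<Sum>i\<in>{n..3 * n}. \<Sum>j\<le>N. (c i j)\<^sup>2)"
    using n by (intro sum.mono_neutral_right) (auto simp: c_def)
  also have "\<dots> = (\<Sum>i\<in>{n..3 * n}. \<Sum>j\<in>{n..3 * n}. (c i j)\<^sup>2)"
    using n by (intro sum.cong refl sum.mono_neutral_right) (auto simp: c_def)
  also have "\<dots> = (\<Sum>i\<in>{n..3 * n}. \<Sum>j\<in>{n..3 * n}. (nodal \<xi> i j)\<^sup>2)"
    by (intro sum.cong refl) (auto simp: c_def)
  also have "\<dots> \<le> (\<Sum>i\<in>{n..3 * n}. \<Sum>j\<in>{n..<3 * n}. (nodal \<xi> i j)\<^sup>2 + (nodal \<xi> i (Suc j))\<^sup>2)"
    using n by (intro sum_mono sum_nodes_le_cells) auto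
  also have "\<dots> \<le> (\<Sum>i\<in>{n..<3 * n}. (\<Sum>j\<in>{n..<3 * n}. (nodal \<xi> i j)\<^sup>2 + (nodal \<xi> i (Suc j))\<^sup>2) +
      (\<Sum>j\<in>{n..<3 * n}. (nodal \<xi> (Suc i) j)\<^sup>2 + (nodal \<xi> (Suc i) (Suc j))\<^sup>2))"
    using n by (intro sum_nodes_le_cells) (auto intro!: sum_nonneg)
  also have "\<dots> = T"
    unfolding T_def corner_sum_def by (simp add: sum.distrib)
  finally have U: "(\<Sum>i\<le>N. \<Sum>j\<le>N. (nodal z i j)\<^sup>2) \<le> T" .
  have S: "(\<Sum>i<N. \<Sum>j<N. corner_sum z i j) \<le> 4 * T"
    using sum_shift_le2[of "\<lambda>i j. (nodal z i j)\<^sup>2" N] U by (simp add: corner_sum_def)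
  have S': "4 * T \<le> 2 ^ 14 / H\<^sup>2 * inner_L2 unit_square \<xi> \<xi>"
    using T by (simp add: power2_eq_square)
  have sum_zero: "\<xi> p + z p = 0" if "i < N" "j < N" "p \<in> cell i j"
    and "\<And>i' j'. i' \<in> {i, Suc i} \<Longrightarrow> j' \<in> {j, Suc j} \<Longrightarrow> nodal z i' j' = - nodal \<xi> i' j'" for i j p
  proof -
    have "corner_sum (\<lambda>p. \<xi> p + z p) i j = 0"
      using that(4) by (simp add: corner_sum_def nodal_def)
    then show ?thesis
      using abs_le_corner_sum[OF fe_space_add[OF \<xi>' z] that(1-3)] by simp
  qed
  have coarse_index: "i \<in> {n..<3 * n}" if "i < N" "s \<in> {?x i..?x (Suc i)}" "l < s" "s < 1 - l" for i s
  proof -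
    have "?x n < ?x (Suc i)" "?x i < ?x (3 * n)"
      using that mesh_pt_values(3,4)[OF N, of l] by (auto simp: nd)
    then have "\<not> Suc i \<le> n" "\<not> 3 * n \<le> i"
      using x_mono[of "Suc i" n] x_mono[of "3 * n" i] that n by auto
    then show ?thesis by simp
  qed
  show ?thesis
  proof (intro bexI[of _ z] conjI ballI impI)
    show "z \<in> W" using z by (simp add: W_def)
  next
    fix p assume p: "p \<in> coarse_region l"
    have "p \<in> cbox (0, 0) (1, 1)"
      using p l by (auto simp: coarse_region_def mem_cbox_unit)
    then obtain i j where ij: "i < N" "j < N" "p \<in> cell i j"
      by (rule covering)
    then have "i \<in> {n..<3 * n}" "j \<in> {n..<3 * n}"
      using p coarse_index[of i "fst p"] coarse_index[of j "snd p"] by (auto simp: coarse_region_def cell_def)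
    with n3 show "\<xi> p + z p = 0"
      by (intro sum_zero[OF ij]) (auto simp: nz c_def)
  next
    have "inner_grad unit_square z z \<le> 32 * (H / h) * (\<Sum>i<N. \<Sum>j<N. corner_sum z i j)"
      using hH step_bounds by (intro inner_grad_le_corner_sums z) auto
    also have "\<dots> \<le> 32 * (H / h) * (2 ^ 14 / H\<^sup>2 * inner_L2 unit_square \<xi> \<xi>)"
      using S S' hH by (intro mult_left_mono) auto
    also have "\<dots> = 2 ^ 19 / (h * H) * inner_L2 unit_square \<xi> \<xi>"
      using hH by (simp add: power2_eq_square)
    finally show "inner_grad unit_square z z \<le> 2 ^ 19 / (h * H) * inner_L2 unit_square \<xi> \<xi>" .
  next
    \<comment> \<open>Off the skeleton, coarse cells lie in the coarse region and contribute
      nothing. Any other cell has at least one side h, hence area at most h * H.\<close>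
    let ?d = "\<lambda>i j. if i \<in> {n..<3 * n} \<and> j \<in> {n..<3 * n} then 0 else corner_sum z i j"
    have "(LINT p|lebesgue_on unit_square. indicator (unit_square - coarse_region l) p * (z p)\<^sup>2) \<le>
        (\<Sum>i<N. \<Sum>j<N. ?d i j * (step i * step j))"
    proof (rule integral_le_cells)
      fix p i j assume p: "p \<in> unit_square - skeleton" "i < N" "j < N" "p \<in> cell i j"
      show "indicator (unit_square - coarse_region l) p * (z p)\<^sup>2 \<le> ?d i j"
      proof (cases "i \<in> {n..<3 * n} \<and> j \<in> {n..<3 * n}")
        case True
        have "?x n \<le> ?x i" "?x (Suc i) \<le> ?x (3 * n)" "?x n \<le> ?x j" "?x (Suc j) \<le> ?x (3 * n)"
          using True n3 by (auto intro!: x_mono)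
        then have "p \<in> coarse_region l"
          using interior_cell[OF p(4) _ p(2,3)] p(1) mesh_pt_values(3,4)[OF N, of l]
          by (cases p) (auto simp: coarse_region_def nd)
        then show ?thesis using True by simp
      next
        case False
        then show ?thesis
          using square_le_corner_sum[OF z p(2-4)] corner_sum_nonneg[of z i j] by (auto simp: indicator_def)
      qed
    qed (simp add: corner_sum_nonneg)
    also have "\<dots> \<le> (\<Sum>i<N. \<Sum>j<N. corner_sum z i j * (h * H))"
    proof (intro sum_mono)
      fix i j assume ij: "i \<in> {..<N}" "j \<in> {..<N}"
      show "?d i j * (step i * step j) \<le> corner_sum z i j * (h * H)"
      proof (cases "i \<in> {n..<3 * n} \<and> j \<in> {n..<3 * n}")
        case True
        then show ?thesis using hH corner_sum_nonneg[of z i j] by simp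
      next
        case False
        have "step i * step j \<le> h * H"
        proof (cases "i \<in> {n..<3 * n}")
          case True
          then have "step j = h" using False by (intro step_fine) auto
          then show ?thesis using step_bounds[of i] hH mult_right_mono[of "step i" H h] by (simp add: mult.commute)
        next
          case i: False
          then have "step i = h" by (intro step_fine) auto
          then show ?thesis using step_bounds[of j] hH mult_left_mono[of "step j" H h] by simp
        qed
        then show ?thesis using False corner_sum_nonneg[of z i j] by (auto intro!: mult_left_mono)
      qed
    qed
    also have "\<dots> = (\<Sum>i<N. \<Sum>j<N. corner_sum z i j) * (h * H)"
      by (simp add: sum_distrib_right)
    also have "\<dots> \<le> (2 ^ 14 / H\<^sup>2 * inner_L2 unit_square \<xi> \<xi>) * (h * H)"
      using S S' hH by (intro mult_right_mono) auto
    also have "\<dots> = 2 ^ 14 * (h / H) * inner_L2 unit_square \<xi> \<xi>"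
      using hH by (simp add: power2_eq_square)
    finally show "(LINT p|lebesgue_on unit_square. indicator (unit_square - coarse_region l) p * (z p)\<^sup>2) \<le> 2 ^ 14 * (h / H) * inner_L2 unit_square \<xi> \<xi>" .
  next
    fix p assume "p \<in> unit_square"
    then have "p \<in> cbox (0, 0) (1, 1)"
      using unit_square_subset by blast
    then obtain i j where ij: "i < N" "j < N" "p \<in> cell i j"
      by (rule covering)
    have "(z p)\<^sup>2 \<le> corner_sum z i j"
      using z ij by (rule square_le_corner_sum)
    also have "\<dots> \<le> (\<Sum>j<N. corner_sum z i j)"
      using ij corner_sum_nonneg by (intro member_le_sum) auto
    also have "\<dots> \<le> (\<Sum>i<N. \<Sum>j<N. corner_sum z i j)"
      using ij corner_sum_nonneg by (intro member_le_sum[of i "{..<N}" "\<lambda>i. \<Sum>j<N. corner_sum z i j"]) (auto intro: sum_nonneg)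
    finally show "(z p)\<^sup>2 \<le> 2 ^ 14 / H\<^sup>2 * inner_L2 unit_square \<xi> \<xi>"
      using S S' by linarith
  next
    fix p assume N4: "N = 4" and "p \<in> unit_square"
    then have "p \<in> cbox (0, 0) (1, 1)"
      using unit_square_subset by blast
    then obtain i j where ij: "i < N" "j < N" "p \<in> cell i j"
      by (rule covering)
    \<comment> \<open>For N = 4 the range n..3 * n is 1..3, that is, all interior nodes.\<close>
    have "nodal z i' j' = - nodal \<xi> i' j'" if "i' \<le> N" "j' \<le> N" for i' j'
    proof (cases "i' \<in> {n..3 * n} \<and> j' \<in> {n..3 * n}")
      case False
      then have "i' = 0 \<or> i' = N \<or> j' = 0 \<or> j' = N"
        using that N4 n by auto
      then show ?thesis
        using nodal_boundary[OF \<xi>' that] nodal_boundary[OF z that] by simp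
    qed (simp add: nz[OF that] c_def)
    then have "\<xi> p + z p = 0"
      using ij by (intro sum_zero[OF ij]) auto
    then show "z p = - \<xi> p" by simp
  qed
qed

section \<open>Energy estimates\<close>

text \<open>\<open>w\<close> is a comparison function from \<open>W\<close>, and \<open>D\<close> is
  where it may differ from \<open>uN\<close>: off \<open>D\<close> the test function vanishes, which
  confines the reaction term to \<open>D\<close>. The gradient product and the Lipschitz term are
  split by Young's inequality, half of the corresponding left-hand term being absorbed each
  time.\<close>

lemma energy_estimate:
  fixes g :: "real \<times> real \<Rightarrow> real \<Rightarrow> real"
  assumes pos: "0 < \<mu>" "0 < \<epsilon>"
    and mono: "\<And>p s t. p \<in> unit_square \<Longrightarrow> \<mu> * (s - t)\<^sup>2 \<le> (g p s - g p t) * (s - t)"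
    and lip: "\<And>p s t. p \<in> unit_square \<Longrightarrow> \<bar>s\<bar> \<le> M \<Longrightarrow> \<bar>t\<bar> \<le> M \<Longrightarrow> \<bar>g p s - g p t\<bar> \<le> K * \<bar>s - t\<bar>"
    and gu: "(\<lambda>p. g p (u p)) \<in> L2 unit_square" and gN: "(\<lambda>p. g p (uN p)) \<in> L2 unit_square"
    and u: "variational_solution \<epsilon> g (H1_0 unit_square) u" and uN: "variational_solution \<epsilon> g W uN"
    and W: "W \<subseteq> H1_0 unit_square" "w \<in> W" "(\<lambda>p. w p - uN p) \<in> W"
    and D: "D \<in> sets lebesgue" "D \<subseteq> unit_square" "\<And>p. p \<in> unit_square - D \<Longrightarrow> w p = uN p"
    and bound: "AE p in lebesgue_on unit_square. \<bar>u p\<bar> \<le> M" "AE p in lebesgue_on unit_square. \<bar>w p\<bar> \<le> M"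
  defines "\<eta> \<equiv> \<lambda>p. w p - uN p" and "\<rho> \<equiv> \<lambda>p. u p - w p"
  shows "\<epsilon> * inner_grad unit_square \<eta> \<eta> + \<mu> * inner_L2 unit_square \<eta> \<eta> \<le>
    \<epsilon> * inner_grad unit_square \<rho> \<rho> + K\<^sup>2 / \<mu> * (LINT p|lebesgue_on unit_square. indicator D p * (\<rho> p)\<^sup>2)"
proof -
  let ?M = "lebesgue_on unit_square"
  have H1: "f \<in> H1 unit_square" if "f \<in> H1_0 unit_square" for f
    using that by (simp add: H1_0_def)
  have uH: "u \<in> H1 unit_square" and uNW: "uN \<in> W"
    using u uN H1 by (auto simp: variational_solution_def)
  then have wH: "w \<in> H1 unit_square" and uNH: "uN \<in> H1 unit_square"
    using W H1 by auto
  have \<eta>W: "\<eta> \<in> W" and \<eta>0: "\<eta> \<in> H1_0 unit_square" and \<eta>H: "\<eta> \<in> H1 unit_square"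
    using W H1 by (auto simp: \<eta>_def)
  have \<rho>H: "\<rho> \<in> H1 unit_square"
    unfolding \<rho>_def by (intro H1_diff uH wH)
  have e1: "\<epsilon> * inner_grad unit_square u \<eta> + inner_L2 unit_square (\<lambda>p. g p (u p)) \<eta> = 0"
    using u \<eta>0 by (simp add: variational_solution_def)
  have e2: "\<epsilon> * inner_grad unit_square uN \<eta> + inner_L2 unit_square (\<lambda>p. g p (uN p)) \<eta> = 0"
    using uN \<eta>W by (simp add: variational_solution_def)
  have "inner_grad unit_square \<rho> \<eta> = inner_grad unit_square u \<eta> - inner_grad unit_square w \<eta>"
    unfolding \<rho>_def by (rule inner_grad_diff_left[OF uH wH \<eta>H])
  moreover have "inner_grad unit_square \<eta> \<eta> = inner_grad unit_square w \<eta> - inner_grad unit_square uN \<eta>"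
    using inner_grad_diff_left[OF wH uNH \<eta>H] by (simp add: \<eta>_def)
  ultimately have ig: "inner_grad unit_square u \<eta> - inner_grad unit_square uN \<eta> = inner_grad unit_square \<rho> \<eta> + inner_grad unit_square \<eta> \<eta>"
    by simp
  have L: "\<eta> \<in> L2 unit_square" "\<rho> \<in> L2 unit_square"
    using \<eta>H \<rho>H H1_L2 by auto
  have DM: "D \<in> sets ?M"
    using D sets_unit_square by (simp add: sets_restrict_space_iff)
  have int1: "integrable ?M (\<lambda>p. (g p (u p) - g p (uN p)) * \<eta> p)"
    by (intro L2_integrable_mult L2_diff gu gN L)
  have int2: "integrable ?M (\<lambda>p. indicator D p * (\<rho> p)\<^sup>2)"
    using integrable_real_mult_indicator[OF DM L2_integrable_square[OF L(2)]] by (simp add: mult.commute)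
  have int3: "integrable ?M (\<lambda>p. \<mu> / 2 * (\<eta> p * \<eta> p) - K\<^sup>2 / (2 * \<mu>) * (indicator D p * (\<rho> p)\<^sup>2))"
    by (intro Bochner_Integration.integrable_diff integrable_mult_right L2_integrable_mult L int2)
  have "(LINT p|?M. \<mu> / 2 * (\<eta> p * \<eta> p) - K\<^sup>2 / (2 * \<mu>) * (indicator D p * (\<rho> p)\<^sup>2)) \<le>
      (LINT p|?M. (g p (u p) - g p (uN p)) * \<eta> p)"
  proof (rule integral_mono_AE[OF int3 int1])
    show "AE p in ?M. \<mu> / 2 * (\<eta> p * \<eta> p) - K\<^sup>2 / (2 * \<mu>) * (indicator D p * (\<rho> p)\<^sup>2) \<le> (g p (u p) - g p (uN p)) * \<eta> p"
      using bound AE_space[of ?M]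
    proof eventually_elim
      case (elim p)
      then have p: "p \<in> unit_square" by simp
      show ?case
      proof (cases "p \<in> D")
        case True
        have "\<bar>(g p (u p) - g p (w p)) * \<eta> p\<bar> \<le> (K * \<bar>\<rho> p\<bar>) * \<bar>\<eta> p\<bar>"
          unfolding abs_mult \<rho>_def using lip[OF p elim(1,2)] by (intro mult_right_mono) auto
        also have "\<dots> \<le> K\<^sup>2 / (2 * \<mu>) * (\<rho> p)\<^sup>2 + \<mu> / 2 * (\<eta> p)\<^sup>2"
        proof -
          \<comment> \<open>Young's inequality, weighted so that half of the monotonicity term \<mu>
            * \<eta>^2 survives.\<close>
          have "0 \<le> \<mu> / 2 * (K * \<bar>\<rho> p\<bar> / \<mu> - \<bar>\<eta> p\<bar>)\<^sup>2"
            using pos by simp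
          also have "\<dots> = K\<^sup>2 / (2 * \<mu>) * (\<rho> p)\<^sup>2 + \<mu> / 2 * (\<eta> p)\<^sup>2 - (K * \<bar>\<rho> p\<bar>) * \<bar>\<eta> p\<bar>"
            using pos by (simp add: power2_diff power_divide power_mult_distrib field_simps power2_eq_square)
          finally show ?thesis by simp
        qed
        finally have 1: "- (K\<^sup>2 / (2 * \<mu>) * (\<rho> p)\<^sup>2) - \<mu> / 2 * (\<eta> p)\<^sup>2 \<le> (g p (u p) - g p (w p)) * \<eta> p"
          by linarith
        have 2: "\<mu> * (\<eta> p)\<^sup>2 \<le> (g p (w p) - g p (uN p)) * \<eta> p"
          using mono[OF p] by (simp add: \<eta>_def)
        have "(g p (u p) - g p (uN p)) * \<eta> p = (g p (u p) - g p (w p)) * \<eta> p + (g p (w p) - g p (uN p)) * \<eta> p"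
          by (simp add: algebra_simps)
        then show ?thesis
          using 1 2 True by (simp add: power2_eq_square)
      next
        case False
        then show ?thesis
          using D(3)[of p] p by (simp add: \<eta>_def)
      qed
    qed
  qed
  also have "(LINT p|?M. (g p (u p) - g p (uN p)) * \<eta> p) = inner_L2 unit_square (\<lambda>p. g p (u p)) \<eta> - inner_L2 unit_square (\<lambda>p. g p (uN p)) \<eta>"
    unfolding inner_L2_def left_diff_distrib
    by (intro Bochner_Integration.integral_diff L2_integrable_mult gu gN L)
  also have "\<dots> = - (\<epsilon> * (inner_grad unit_square \<rho> \<eta> + inner_grad unit_square \<eta> \<eta>))"
    using e1 e2 unfolding ig[symmetric] right_diff_distrib by linarith
  also have "(LINT p|?M. \<mu> / 2 * (\<eta> p * \<eta> p) - K\<^sup>2 / (2 * \<mu>) * (indicator D p * (\<rho> p)\<^sup>2)) =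
      \<mu> / 2 * inner_L2 unit_square \<eta> \<eta> - K\<^sup>2 / (2 * \<mu>) * (LINT p|?M. indicator D p * (\<rho> p)\<^sup>2)"
    unfolding inner_L2_def using L2_integrable_mult[OF L(1) L(1)] int2
    by (subst Bochner_Integration.integral_diff) auto
  finally have main: "\<mu> / 2 * inner_L2 unit_square \<eta> \<eta> - K\<^sup>2 / (2 * \<mu>) * (LINT p|?M. indicator D p * (\<rho> p)\<^sup>2) \<le>
      - (\<epsilon> * (inner_grad unit_square \<rho> \<eta> + inner_grad unit_square \<eta> \<eta>))" .
  have neg: "- inner_grad unit_square \<rho> \<eta> \<le> (inner_grad unit_square \<rho> \<rho> + inner_grad unit_square \<eta> \<eta>) / 2"
  proof -
    have "0 \<le> inner_grad unit_square \<rho> \<rho> + 2 * inner_grad unit_square \<rho> \<eta> + inner_grad unit_square \<eta> \<eta>"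
      using inner_grad_self_nonneg[of unit_square "\<lambda>p. \<rho> p + \<eta> p"] inner_grad_add_self[OF \<rho>H \<eta>H] by simp
    then show ?thesis by simp
  qed
  have "\<epsilon> * (- inner_grad unit_square \<rho> \<eta>) \<le> \<epsilon> * ((inner_grad unit_square \<rho> \<rho> + inner_grad unit_square \<eta> \<eta>) / 2)"
    using neg pos by (intro mult_left_mono) auto
  then have "\<mu> / 2 * inner_L2 unit_square \<eta> \<eta> + \<epsilon> / 2 * inner_grad unit_square \<eta> \<eta> \<le>
      \<epsilon> / 2 * inner_grad unit_square \<rho> \<rho> + K\<^sup>2 / (2 * \<mu>) * (LINT p|?M. indicator D p * (\<rho> p)\<^sup>2)"
    using main by (simp add: algebra_simps)
  then show ?thesis
    by (simp add: field_simps)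
qed

section \<open>Auxiliary bounds for the fine region, the nonlinearity and the weak solution\<close>

lemma norm_Linf_AE:
  assumes "norm_Linf D f \<le> ereal c" "D \<in> sets lebesgue"
  shows "AE p in lebesgue. p \<in> D \<longrightarrow> \<bar>f p\<bar> \<le> c"
proof -
  have "AE p in lebesgue_on D. ereal \<bar>f p\<bar> \<le> norm_Linf D f"
    unfolding norm_Linf_def by (rule esssup_AE)
  then have "AE p in lebesgue_on D. \<bar>f p\<bar> \<le> c"
  proof eventually_elim
    case (elim p)
    then have "ereal \<bar>f p\<bar> \<le> ereal c" using assms(1) by (rule order_trans)
    then show ?case by simp
  qed
  then show ?thesis
    using assms(2) by (simp add: AE_restrict_space_iff)
qed

lemma coarse_region_lmeasurable: "coarse_region l \<in> lmeasurable"
proof -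
  have "coarse_region l = box (l, l) (1 - l, 1 - l)"
    by (auto simp: coarse_region_def mem_box Basis_prod_def)
  then show ?thesis by simp
qed

text \<open>From 1 - (1 - 2 * l)^2 = 4 * l - 4 * l^2. With the choice of the transition point this
  is where a factor sqrt eps * ln N originates.\<close>

lemma measure_fine_region:
  assumes "0 < l" "l \<le> 1/4"
  shows "measure lebesgue (unit_square - coarse_region l) \<le> 4 * l"
proof -
  have "coarse_region l \<subseteq> unit_square"
    using assms by (auto simp: coarse_region_def unit_square_def)
  then have "measure lebesgue (unit_square - coarse_region l) = 1 - (1 - l - l) * (1 - l - l)"
    using measurable_measure_Diff[OF lmeasurable_unit_square, of "coarse_region l"] coarse_region_lmeasurable[of l]
      rectangle_measure(2)[of l "1 - l" l "1 - l"] assms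
    by (simp add: measure_unit_square coarse_region_def fmeasurableD)
  also have "\<dots> \<le> 4 * l"
    using mult_nonneg_nonneg[of l l] assms by (simp add: algebra_simps)
  finally show ?thesis .
qed

lemma continuous_on_superposition:
  assumes "continuous_on (closure unit_square \<times> UNIV) (\<lambda>(x, s). g x s)" "continuous_on (cbox (0, 0) (1, 1)) w"
  shows "(\<lambda>p. g p (w p)) \<in> L2 unit_square"
proof (rule continuous_on_L2_unit_square)
  have "continuous_on (cbox (0, 0) (1, 1)) (\<lambda>p. (\<lambda>(x, s). g x s) (p, w p))"
    using assms unfolding closure_unit_square
    by (intro continuous_on_compose2[OF assms(1)[unfolded closure_unit_square]] continuous_intros) auto
  then show "continuous_on (cbox (0, 0) (1, 1)) (\<lambda>p. g p (w p))" by simp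
qed

lemma monotone_of_deriv_ge:
  fixes f f' :: "real \<Rightarrow> real"
  assumes "\<And>s. (f has_real_derivative f' s) (at s)" "\<And>s. \<mu> \<le> f' s"
  shows "\<mu> * (s - t)\<^sup>2 \<le> (f s - f t) * (s - t)"
proof -
  have less: "\<mu> * (s - t)\<^sup>2 \<le> (f s - f t) * (s - t)" if "t < s" for s t
  proof -
    have "\<exists>r>t. r < s \<and> f s - f t = (s - t) * f' r"
      using that by (rule MVT2) (rule assms(1))
    then obtain r where "f s - f t = (s - t) * f' r"
      by blast
    then show ?thesis
      using mult_right_mono[OF assms(2)[of r], of "(s - t)\<^sup>2"] by (simp add: power2_eq_square mult_ac)
  qed
  show ?thesis
    using less[of t s] less[of s t] by (cases s t rule: linorder_cases) (auto simp: power2_commute algebra_simps)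
qed

text \<open>By compactness of the closed square times [-M, M]; the constant depends on
  \<open>M\<close> but not on the point of the square.\<close>

lemma Lipschitz_of_bounded_deriv:
  fixes g g2 :: "real \<times> real \<Rightarrow> real \<Rightarrow> real"
  assumes "\<And>x s. x \<in> closure unit_square \<Longrightarrow> (g x has_real_derivative g2 x s) (at s)"
    and "continuous_on (closure unit_square \<times> UNIV) (\<lambda>(x, s). g2 x s)"
  obtains K where "\<And>p s t. p \<in> unit_square \<Longrightarrow> \<bar>s\<bar> \<le> M \<Longrightarrow> \<bar>t\<bar> \<le> M \<Longrightarrow> \<bar>g p s - g p t\<bar> \<le> K * \<bar>s - t\<bar>"
proof -
  have "compact ((\<lambda>(x, s). g2 x s) ` (closure unit_square \<times> {- M..M}))"
    unfolding closure_unit_square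
    by (intro compact_continuous_image compact_Times compact_cbox compact_Icc continuous_on_subset[OF assms(2)[unfolded closure_unit_square]]) auto
  then obtain K where K: "\<And>x s. x \<in> closure unit_square \<Longrightarrow> s \<in> {- M..M} \<Longrightarrow> \<bar>g2 x s\<bar> \<le> K"
    using compact_imp_bounded by (force simp: bounded_iff)
  have "\<bar>g p s - g p t\<bar> \<le> K * \<bar>s - t\<bar>" if "p \<in> unit_square" "\<bar>s\<bar> \<le> M" "\<bar>t\<bar> \<le> M" for p s t
  proof -
    have p: "p \<in> closure unit_square"
      using that(1) closure_subset by blast
    have "norm (g p s - g p t) \<le> K * norm (s - t)"
      by (rule field_differentiable_bound[of "{- M..M}" "g p" "g2 p"])
        (use that p K has_field_derivative_at_within[OF assms(1)[OF p]] in \<open>auto simp: abs_le_iff\<close>)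
    then show ?thesis by simp
  qed
  then show ?thesis using that by blast
qed

text \<open>Test with \<open>u\<close> itself: the gradient term is nonnegative, and monotonicity
  against 0 together with Young's inequality leaves a bound free of \<epsilon>.\<close>

lemma weak_solution_L2_bound:
  fixes g :: "real \<times> real \<Rightarrow> real \<Rightarrow> real"
  assumes pos: "0 < \<mu>" "0 < \<epsilon>"
    and mono: "\<And>p s t. p \<in> unit_square \<Longrightarrow> \<mu> * (s - t)\<^sup>2 \<le> (g p s - g p t) * (s - t)"
    and G: "\<And>p. p \<in> unit_square \<Longrightarrow> \<bar>g p 0\<bar> \<le> G"
    and gu: "(\<lambda>p. g p (u p)) \<in> L2 unit_square"
    and u: "variational_solution \<epsilon> g (H1_0 unit_square) u"
  shows "inner_L2 unit_square u u \<le> G\<^sup>2 / \<mu>\<^sup>2"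
proof -
  let ?M = "lebesgue_on unit_square"
  have uL: "u \<in> L2 unit_square"
    using u by (auto simp: variational_solution_def H1_0_def H1_def)
  have e: "\<epsilon> * inner_grad unit_square u u + inner_L2 unit_square (\<lambda>p. g p (u p)) u = 0"
    using u by (simp add: variational_solution_def)
  interpret finite_measure ?M
    using lmeasurable_unit_square by (rule finite_measure_lebesgue_on)
  have "(LINT p|?M. \<mu> / 2 * (u p * u p) - G\<^sup>2 / (2 * \<mu>)) \<le> (LINT p|?M. g p (u p) * u p)"
  proof (rule integral_mono)
    fix p assume "p \<in> space ?M"
    then have p: "p \<in> unit_square" by simp
    have "\<bar>g p 0 * u p\<bar> \<le> G * \<bar>u p\<bar>"
      unfolding abs_mult using G[OF p] by (intro mult_right_mono) auto
    also have "\<dots> \<le> G\<^sup>2 / (2 * \<mu>) + \<mu> / 2 * (u p)\<^sup>2"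
    proof -
      have "0 \<le> \<mu> / 2 * (G / \<mu> - \<bar>u p\<bar>)\<^sup>2"
        using pos by simp
      also have "\<dots> = G\<^sup>2 / (2 * \<mu>) + \<mu> / 2 * (u p)\<^sup>2 - G * \<bar>u p\<bar>"
        using pos by (simp add: power2_diff power_divide field_simps power2_eq_square)
      finally show ?thesis by simp
    qed
    finally have "- (G\<^sup>2 / (2 * \<mu>) + \<mu> / 2 * (u p)\<^sup>2) \<le> g p 0 * u p" by linarith
    moreover have "\<mu> * (u p)\<^sup>2 \<le> g p (u p) * u p - g p 0 * u p"
      using mono[OF p, of "u p" 0] by (simp add: algebra_simps)
    ultimately show "\<mu> / 2 * (u p * u p) - G\<^sup>2 / (2 * \<mu>) \<le> g p (u p) * u p"
      by (simp add: power2_eq_square)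
  qed (intro Bochner_Integration.integrable_diff integrable_mult_right L2_integrable_mult uL gu integrable_const)+
  also have "(LINT p|?M. g p (u p) * u p) \<le> 0"
  proof -
    have "0 \<le> \<epsilon> * inner_grad unit_square u u"
      using pos inner_grad_self_nonneg[of unit_square u] by simp
    then show ?thesis
      using e unfolding inner_L2_def by linarith
  qed
  also have "(LINT p|?M. \<mu> / 2 * (u p * u p) - G\<^sup>2 / (2 * \<mu>)) = \<mu> / 2 * inner_L2 unit_square u u - G\<^sup>2 / (2 * \<mu>)"
    using L2_integrable_mult[OF uL uL] measure_unit_square
    by (simp add: inner_L2_def measure_restrict_space sets_unit_square)
  finally show ?thesis
    using pos by (simp add: field_simps power2_eq_square)
qed

section \<open>The discrete error\<close>

text \<open>The constants are spelled out in the statement so that their independence of \<epsilon>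
  and N is visible. \<open>A\<close> belongs to the first energy estimate, \<gamma> to l \<le>
  \<gamma> * sqrt \<epsilon> * ln N, \<open>P\<close> and \<open>Q\<close> to the squared balanced
  gradients of \<open>z\<close> and \<xi> + z, and \<open>B\<close> covers both cases.
  \<open>K'\<close> is a Lipschitz constant on the larger range in which \<open>w + z\<close>
  lies.\<close>

lemma discrete_error_bound:
  fixes g :: "real \<times> real \<Rightarrow> real \<Rightarrow> real" and N :: nat
  defines "n \<equiv> real N" and "L \<equiv> ln (real N)"
  assumes pos: "0 < \<mu>" "0 < \<epsilon>" "\<epsilon> \<le> 1" "0 < cstar"
    and N: "0 < N" "4 dvd N"
    and mono: "\<And>p s t. p \<in> unit_square \<Longrightarrow> \<mu> * (s - t)\<^sup>2 \<le> (g p s - g p t) * (s - t)"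
    and lip: "\<And>p s t. p \<in> unit_square \<Longrightarrow> \<bar>s\<bar> \<le> M \<Longrightarrow> \<bar>t\<bar> \<le> M \<Longrightarrow> \<bar>g p s - g p t\<bar> \<le> K * \<bar>s - t\<bar>"
    and lip': "\<And>p s t. p \<in> unit_square \<Longrightarrow> \<bar>s\<bar> \<le> M' \<Longrightarrow> \<bar>t\<bar> \<le> M' \<Longrightarrow> \<bar>g p s - g p t\<bar> \<le> K' * \<bar>s - t\<bar>"
    and gu: "(\<lambda>p. g p (u p)) \<in> L2 unit_square" and gN: "(\<lambda>p. g p (uN p)) \<in> L2 unit_square"
    and u: "variational_solution \<epsilon> g (H1_0 unit_square) u" and uN: "variational_solution \<epsilon> g W uN"
  defines "l \<equiv> transition_point cstar \<epsilon> N"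
  assumes W: "W = tensor_mesh.fe_space (mesh_pt l N) N kind" and w: "w \<in> W"
    and bound: "AE p in lebesgue_on unit_square. \<bar>u p\<bar> \<le> M" "AE p in lebesgue_on unit_square. \<bar>w p\<bar> \<le> M"
    and interp: "inner_L2 unit_square (\<lambda>p. u p - w p) (\<lambda>p. u p - w p) \<le> C\<^sup>2 / n ^ 4"
      "sqrt \<epsilon> * inner_grad unit_square (\<lambda>p. u p - w p) (\<lambda>p. u p - w p) \<le> C\<^sup>2 * L\<^sup>2 / n\<^sup>2"
      "AE p in lebesgue_on unit_square. p \<notin> coarse_region l \<longrightarrow> (u p - w p)\<^sup>2 \<le> C\<^sup>2 * L ^ 4 / n ^ 4"
  defines "A \<equiv> C\<^sup>2 + K\<^sup>2 * C\<^sup>2 / \<mu>"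
  assumes M': "M + sqrt (2 ^ 14 * (A / \<mu>)) \<le> M'"
  defines "\<gamma> \<equiv> 2 / sqrt cstar"
  defines "P \<equiv> 2 ^ 17 * (4 + 1 / \<gamma>) * (A / \<mu>)"
  defines "Q \<equiv> 2 * C\<^sup>2 + 2 * P + K'\<^sup>2 / \<mu> * \<gamma> * (8 * C\<^sup>2 + 2 ^ 17 * (A / \<mu>))"
  defines "B \<equiv> A + A / \<mu> + 2 * Q + 2 * P"
  defines "\<xi> \<equiv> \<lambda>p. w p - uN p"
  shows "sqrt \<epsilon> * inner_grad unit_square \<xi> \<xi> \<le> B * (L ^ 3 / n\<^sup>2)" "inner_L2 unit_square \<xi> \<xi> \<le> B * (L ^ 3 / n\<^sup>2)"
proof -
  define X where "X = sqrt \<epsilon>"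
  have X: "0 < X" "X \<le> 1" "X * X = \<epsilon>"
    using pos by (auto simp: X_def)
  have n4: "4 \<le> n"
    using N by (auto simp: n_def dest: dvd_imp_le)
  have n0: "n \<noteq> 0" "0 < n" "n ^ 4 = n\<^sup>2 * n\<^sup>2"
    using n4 by (auto simp: power_add[symmetric])
  have L1: "1 \<le> L"
  proof -
    have "exp 1 \<le> real N"
      using exp_le n4 by (simp add: n_def)
    then show ?thesis
      unfolding L_def using N by (simp add: ln_ge_iff)
  qed
  have Ln: "L \<le> n"
    unfolding L_def n_def using N ln_le_minus_one[of "real N"] by simp
  have \<gamma>: "0 < \<gamma>"
    using pos by (simp add: \<gamma>_def)
  have ll: "l = min (1/4) (\<gamma> * X * L)"
    using pos by (simp add: l_def transition_point_def \<gamma>_def X_def L_def real_sqrt_divide)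
  have l: "0 < l" "l \<le> 1/4" "l \<le> \<gamma> * X * L"
    using X \<gamma> L1 by (auto simp: ll)
  \<comment> \<open>The gradient of \<open>z\<close> costs a factor 1 / l, which sqrt \<epsilon>
    pays for in either branch of the minimum.\<close>
  have Xl: "X / l \<le> 4 + 1 / \<gamma>"
  proof (cases "l = 1/4")
    case True
    have "X / l = 4 * X" unfolding True by simp
    moreover have "0 \<le> 1 / \<gamma>" using \<gamma> by simp
    ultimately show ?thesis using X by linarith
  next
    case False
    then have "l = \<gamma> * X * L" by (auto simp: ll min_def split: if_splits)
    then have "X / l = 1 / (\<gamma> * L)" using X by simp
    also have "\<dots> \<le> 1 / \<gamma>" using \<gamma> L1 by (intro divide_left_mono) auto
    finally show ?thesis by simp
  qed
  interpret tensor_mesh "mesh_pt l N" N kind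
    using N l(1,2) by (rule tensor_mesh_mesh_pt)
  have WH: "W \<subseteq> H1_0 unit_square" and WH1: "W \<subseteq> H1 unit_square"
    unfolding W using fe_space_H1_0 fe_space_H1 by auto
  have uNW: "uN \<in> W"
    using uN by (simp add: variational_solution_def)
  have \<xi>W: "\<xi> \<in> W"
    unfolding \<xi>_def using fe_space_diff w uNW by (simp add: W)
  define \<theta> where "\<theta> = (\<lambda>p. u p - w p)"
  have uH: "u \<in> H1 unit_square"
    using u by (simp add: variational_solution_def H1_0_def)
  have \<theta>H: "\<theta> \<in> H1 unit_square"
    unfolding \<theta>_def using uH w WH1 by (intro H1_diff) auto
  define g\<theta> g\<xi> c\<xi> t\<theta> where "g\<theta> = inner_grad unit_square \<theta> \<theta>" and "g\<xi> = inner_grad unit_square \<xi> \<xi>"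
    and "c\<xi> = inner_L2 unit_square \<xi> \<xi>" and "t\<theta> = inner_L2 unit_square \<theta> \<theta>"
  have A0: "0 \<le> A" "0 \<le> A / \<mu>"
    using pos by (auto simp: A_def)
  have P0: "0 \<le> P"
    unfolding P_def by (intro mult_nonneg_nonneg add_nonneg_nonneg A0) (use \<gamma> in auto)
  have Q0: "0 \<le> Q"
    unfolding Q_def by (intro mult_nonneg_nonneg add_nonneg_nonneg A0) (use \<gamma> pos P0 in auto)
  have int: "t\<theta> \<le> C\<^sup>2 / n ^ 4" "X * g\<theta> \<le> C\<^sup>2 * L\<^sup>2 / n\<^sup>2"
    using interp(1,2) by (auto simp: t\<theta>_def g\<theta>_def \<theta>_def X_def)
  have nonneg: "0 \<le> g\<theta>" "0 \<le> g\<xi>" "0 \<le> c\<xi>" "0 \<le> t\<theta>"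
    by (auto simp: g\<theta>_def g\<xi>_def c\<xi>_def t\<theta>_def inner_grad_self_nonneg inner_L2_self_nonneg)
  have "\<epsilon> * g\<xi> + \<mu> * c\<xi> \<le> \<epsilon> * g\<theta> + K\<^sup>2 / \<mu> * (LINT p|lebesgue_on unit_square. indicator unit_square p * (\<theta> p)\<^sup>2)"
    unfolding g\<xi>_def c\<xi>_def g\<theta>_def \<xi>_def \<theta>_def
    by (rule energy_estimate[OF pos(1,2) mono lip gu gN u uN WH w _ sets_unit_square _ _ bound])
      (use \<xi>W in \<open>auto simp: \<xi>_def\<close>)
  also have "(LINT p|lebesgue_on unit_square. indicator unit_square p * (\<theta> p)\<^sup>2) = t\<theta>"
    unfolding t\<theta>_def inner_L2_def by (rule Bochner_Integration.integral_cong) (auto simp: power2_eq_square)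
  finally have S1: "X * (X * g\<xi>) + \<mu> * c\<xi> \<le> X * (X * g\<theta>) + K\<^sup>2 / \<mu> * t\<theta>"
    by (simp add: X(3)[symmetric] mult.assoc)
  have "K\<^sup>2 / \<mu> * t\<theta> \<le> K\<^sup>2 / \<mu> * (C\<^sup>2 / n ^ 4)"
    using int pos by (intro mult_left_mono) auto
  moreover have "X * (X * g\<theta>) \<le> X * (C\<^sup>2 * L\<^sup>2 / n\<^sup>2)"
    using int X by (intro mult_left_mono) auto
  ultimately have S1': "X * (X * g\<xi>) + \<mu> * c\<xi> \<le> X * (C\<^sup>2 * L\<^sup>2 / n\<^sup>2) + K\<^sup>2 * C\<^sup>2 / \<mu> * (1 / n ^ 4)"
    using S1 by simp
  have KC: "0 \<le> K\<^sup>2 * C\<^sup>2 / \<mu>"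
    using pos by simp
  have powL: "1 \<le> L\<^sup>2" "L\<^sup>2 \<le> L ^ 3" "L\<^sup>2 \<le> n\<^sup>2"
    using L1 Ln by (auto intro: one_le_power power_increasing power_mono)
  have n2: "1 / n ^ 4 \<le> 1 / n\<^sup>2" "1 / n ^ 4 = 1 / n\<^sup>2 * (1 / n\<^sup>2)"
    using n4 by (auto intro!: divide_left_mono power_increasing simp: power_add[symmetric])
  have L23: "L\<^sup>2 / n\<^sup>2 \<le> L ^ 3 / n\<^sup>2"
    using powL by (intro divide_right_mono) auto
  have Xg0: "0 \<le> X * (X * g\<xi>)"
    using X nonneg by simp
  have c_general: "\<mu> * c\<xi> \<le> A * (L\<^sup>2 / n\<^sup>2)"
  proof -
    have "X * (C\<^sup>2 * L\<^sup>2 / n\<^sup>2) \<le> 1 * (C\<^sup>2 * L\<^sup>2 / n\<^sup>2)"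
      using X by (intro mult_right_mono) auto
    then have "X * (C\<^sup>2 * L\<^sup>2 / n\<^sup>2) \<le> C\<^sup>2 * (L\<^sup>2 / n\<^sup>2)"
      by simp
    moreover have "1 / n ^ 4 \<le> L\<^sup>2 / n\<^sup>2"
      using n2(1) powL(1) divide_right_mono[of 1 "L\<^sup>2" "n\<^sup>2"] by simp
    then have "K\<^sup>2 * C\<^sup>2 / \<mu> * (1 / n ^ 4) \<le> K\<^sup>2 * C\<^sup>2 / \<mu> * (L\<^sup>2 / n\<^sup>2)"
      using KC by (rule mult_left_mono)
    ultimately show ?thesis
      using S1' Xg0 unfolding A_def distrib_right by linarith
  qed
  have div_\<mu>: "c \<le> A / \<mu> * y" if "\<mu> * c \<le> A * y" for c y
    using that pos(1) unfolding times_divide_eq_left by (simp only: pos_le_divide_eq mult.commute)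
  have c_le: "c\<xi> \<le> A / \<mu> * (L ^ 3 / n\<^sup>2)"
  proof -
    have "A * (L\<^sup>2 / n\<^sup>2) \<le> A * (L ^ 3 / n\<^sup>2)"
      using L23 A0 by (intro mult_left_mono) auto
    then have "\<mu> * c\<xi> \<le> A * (L ^ 3 / n\<^sup>2)" using c_general by linarith
    then show ?thesis by (rule div_\<mu>)
  qed
  have LB: "0 \<le> L ^ 3 / n\<^sup>2" using L1 by simp
  show "inner_L2 unit_square \<xi> \<xi> \<le> B * (L ^ 3 / n\<^sup>2)"
  proof -
    have "A / \<mu> * (L ^ 3 / n\<^sup>2) \<le> B * (L ^ 3 / n\<^sup>2)"
      using A0 P0 Q0 LB by (intro mult_right_mono) (auto simp: B_def)
    then show ?thesis using c_le by (simp add: c\<xi>_def)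
  qed
  show "sqrt \<epsilon> * inner_grad unit_square \<xi> \<xi> \<le> B * (L ^ 3 / n\<^sup>2)"
  proof (cases "1 \<le> X * n\<^sup>2")
    case True
    \<comment> \<open>Here 1 / n^2 is at most X, so the reaction term already contains the factor X
      that is cancelled below.\<close>
    have "1 / n ^ 4 \<le> X * (1 / n\<^sup>2)"
      unfolding n2(2) using True n4 by (intro mult_right_mono) (auto simp: field_simps)
    then have "K\<^sup>2 * C\<^sup>2 / \<mu> * (1 / n ^ 4) \<le> K\<^sup>2 * C\<^sup>2 / \<mu> * (X * (1 / n\<^sup>2))"
      using KC by (rule mult_left_mono)
    also have "\<dots> \<le> K\<^sup>2 * C\<^sup>2 / \<mu> * (X * (L\<^sup>2 / n\<^sup>2))"
      using KC X powL by (intro mult_left_mono divide_right_mono) auto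
    finally have "X * (X * g\<xi>) \<le> X * (C\<^sup>2 * L\<^sup>2 / n\<^sup>2) + K\<^sup>2 * C\<^sup>2 / \<mu> * (X * (L\<^sup>2 / n\<^sup>2))"
      using S1' nonneg pos mult_nonneg_nonneg[of \<mu> c\<xi>] by linarith
    also have "\<dots> = X * (A * (L\<^sup>2 / n\<^sup>2))"
      by (simp add: A_def algebra_simps)
    finally have "X * (X * g\<xi>) \<le> X * (A * (L\<^sup>2 / n\<^sup>2))" .
    then have "X * g\<xi> \<le> A * (L\<^sup>2 / n\<^sup>2)"
      by (rule mult_left_le_imp_le[OF _ X(1)])
    also have "\<dots> \<le> B * (L ^ 3 / n\<^sup>2)"
      using A0 P0 Q0 L23 LB by (intro mult_mono) (auto simp: B_def)
    finally show ?thesis by (simp add: X_def g\<xi>_def)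
  next
    case False
    then have Xn: "X \<le> 1 / n\<^sup>2"
      using n4 by (simp add: field_simps)
    have n24: "n\<^sup>2 * (L\<^sup>2 / n ^ 4) = L\<^sup>2 / n\<^sup>2"
    proof -
      have "n\<^sup>2 * (L\<^sup>2 / n ^ 4) = n\<^sup>2 * ((L\<^sup>2 / n\<^sup>2) / n\<^sup>2)"
        by (simp only: n0(3) divide_divide_eq_left)
      also have "\<dots> = L\<^sup>2 / n\<^sup>2"
        using n0(1) by (metis nonzero_mult_div_cancel_left power_not_zero times_divide_eq_right)
      finally show ?thesis .
    qed
    \<comment> \<open>Now X is at most 1 / n^2, so the gradient term of the first estimate is of
      order L^2 / n^4 as well: two powers of n better than \<open>c_general\<close>.\<close>
    have cB: "c\<xi> \<le> A / \<mu> * (L\<^sup>2 / n ^ 4)"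
    proof -
      have "X * (C\<^sup>2 * L\<^sup>2 / n\<^sup>2) \<le> 1 / n\<^sup>2 * (C\<^sup>2 * L\<^sup>2 / n\<^sup>2)"
        using Xn by (intro mult_right_mono) auto
      also have "\<dots> = C\<^sup>2 * (L\<^sup>2 / n ^ 4)"
        unfolding n0(3) by simp
      finally have 1: "X * (C\<^sup>2 * L\<^sup>2 / n\<^sup>2) \<le> C\<^sup>2 * (L\<^sup>2 / n ^ 4)" .
      have "K\<^sup>2 * C\<^sup>2 / \<mu> * (1 / n ^ 4) \<le> K\<^sup>2 * C\<^sup>2 / \<mu> * (L\<^sup>2 / n ^ 4)"
        using KC powL n4 by (intro mult_left_mono divide_right_mono) auto
      then have "\<mu> * c\<xi> \<le> A * (L\<^sup>2 / n ^ 4)"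
        using S1' 1 Xg0 unfolding A_def distrib_right by linarith
      then show ?thesis by (rule div_\<mu>)
    qed
    define h H where "h = 4 * l / real N" and "H = 2 * (1 - 2 * l) / real N"
    have hH: "0 < h" "1 / n \<le> H" "h = 4 * l / n" "0 < H"
      using l n4 by (auto simp: h_def H_def n_def field_simps)
    obtain z where z: "z \<in> W" "\<forall>p\<in>coarse_region l. \<xi> p + z p = 0"
      and gz: "inner_grad unit_square z z \<le> 2 ^ 19 / (h * H) * c\<xi>"
      and fz: "(LINT p|lebesgue_on unit_square. indicator (unit_square - coarse_region l) p * (z p)\<^sup>2) \<le> 2 ^ 14 * (h / H) * c\<xi>"
      and sz: "\<forall>p\<in>unit_square. (z p)\<^sup>2 \<le> 2 ^ 14 / H\<^sup>2 * c\<xi>"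
      using shishkin_coarse_correction[OF N l(1,2) \<xi>W[unfolded W], folded c\<xi>_def h_def H_def W] by blast
    define w' where "w' = (\<lambda>p. w p + z p)"
    define \<eta> \<rho> where "\<eta> = (\<lambda>p. w' p - uN p)" and "\<rho> = (\<lambda>p. u p - w' p)"
    have w'W: "w' \<in> W" "\<eta> \<in> W"
      unfolding \<eta>_def w'_def using fe_space_add fe_space_diff w z uNW by (auto simp: W)
    have zH: "z \<in> H1 unit_square" and \<eta>H: "\<eta> \<in> H1 unit_square"
      using z(1) w'W WH1 by auto
    have H2: "1 / H\<^sup>2 \<le> n\<^sup>2"
    proof -
      have "(1 / n)\<^sup>2 \<le> H\<^sup>2"
        using hH n4 by (intro power_mono) auto
      then have "1 / H\<^sup>2 \<le> 1 / (1 / n)\<^sup>2"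
        using hH n0 by (intro divide_left_mono) auto
      then show ?thesis
        by (simp add: power_divide)
    qed
    \<comment> \<open>The factor 1 / H^2, at most n^2, is absorbed by the improved bound
      \<open>cB\<close>: what remains is L^2 / n^2, at most 1. Hence \<open>M'\<close> and
      \<open>K'\<close> can be chosen independently of the mesh.\<close>
    have zb: "\<bar>z p\<bar> \<le> sqrt (2 ^ 14 * (A / \<mu>))" if "p \<in> unit_square" for p
    proof (rule real_le_rsqrt)
      have "(z p)\<^sup>2 \<le> 2 ^ 14 * (1 / H\<^sup>2) * c\<xi>"
        using sz that by simp
      also have "\<dots> \<le> 2 ^ 14 * n\<^sup>2 * (A / \<mu> * (L\<^sup>2 / n ^ 4))"
        using H2 cB nonneg n4 by (intro mult_mono) auto
      also have "\<dots> = 2 ^ 14 * (A / \<mu>) * (n\<^sup>2 * (L\<^sup>2 / n ^ 4))"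
        by (simp only: mult_ac)
      also have "\<dots> = 2 ^ 14 * (A / \<mu>) * (L\<^sup>2 / n\<^sup>2)"
        by (simp only: n24)
      also have "\<dots> \<le> 2 ^ 14 * (A / \<mu>) * 1"
        using powL(3) n4 A0 by (intro mult_left_mono) (auto simp: divide_le_eq)
      finally show "\<bar>z p\<bar>\<^sup>2 \<le> 2 ^ 14 * (A / \<mu>)" by simp
    qed
    have bound': "AE p in lebesgue_on unit_square. \<bar>u p\<bar> \<le> M'" "AE p in lebesgue_on unit_square. \<bar>w' p\<bar> \<le> M'"
    proof -
      have "0 \<le> sqrt (2 ^ 14 * (A / \<mu>))" using A0 by simp
      then have "M \<le> M'" using M' by linarith
      show "AE p in lebesgue_on unit_square. \<bar>u p\<bar> \<le> M'"
        using bound(1) by eventually_elim (use \<open>M \<le> M'\<close> in linarith)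
      show "AE p in lebesgue_on unit_square. \<bar>w' p\<bar> \<le> M'"
        using bound(2) AE_space[of "lebesgue_on unit_square"]
      proof eventually_elim
        case (elim p)
        then have p: "p \<in> unit_square" by simp
        show ?case using elim(1) zb[OF p] M' unfolding w'_def by linarith
      qed
    qed
    let ?D = "unit_square - coarse_region l"
    have Dl: "?D \<in> lmeasurable"
      using lmeasurable_unit_square coarse_region_lmeasurable by (intro fmeasurable_Diff) (auto simp: fmeasurableD)
    have Dm: "?D \<in> sets lebesgue"
      using Dl by blast
    have S2: "\<epsilon> * inner_grad unit_square \<eta> \<eta> + \<mu> * inner_L2 unit_square \<eta> \<eta> \<le>
        \<epsilon> * inner_grad unit_square \<rho> \<rho> + K'\<^sup>2 / \<mu> * (LINT p|lebesgue_on unit_square. indicator ?D p * (\<rho> p)\<^sup>2)"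
      unfolding \<eta>_def \<rho>_def
    proof (rule energy_estimate[OF pos(1,2) mono lip' gu gN u uN WH w'W(1) _ Dm _ _ bound'])
      show "(\<lambda>p. w' p - uN p) \<in> W"
        using w'W(2) by (simp add: \<eta>_def[abs_def])
      fix p assume "p \<in> unit_square - ?D"
      then have "\<xi> p + z p = 0"
        using z(2) by blast
      then show "w' p = uN p"
        by (simp add: w'_def \<xi>_def)
    qed auto
    have \<rho>: "\<rho> = (\<lambda>p. \<theta> p + (- 1) * z p)"
      by (auto simp: \<rho>_def \<theta>_def w'_def)
    have mzH: "(\<lambda>p. (- 1) * z p) \<in> H1 unit_square"
      using zH by (rule H1_cmult)
    have neg: "inner_grad unit_square (\<lambda>p. (- 1) * z p) (\<lambda>p. (- 1) * z p) = inner_grad unit_square z z"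
      using inner_grad_cmult_left[OF zH mzH, of "-1"] inner_grad_cmult_left[OF zH zH, of "-1"]
      by (simp add: inner_grad_commute[of unit_square z "\<lambda>p. - z p"])
    have g\<rho>: "inner_grad unit_square \<rho> \<rho> \<le> 2 * g\<theta> + 2 * inner_grad unit_square z z"
      unfolding \<rho> g\<theta>_def using inner_grad_add_self_le[OF \<theta>H mzH] unfolding neg .
    \<comment> \<open>From h = 4 * l / n and H \<ge> 1 / n one has 1 / (h * H) \<le> n^2 / (4 * l);
      this turns 2 ^ 19 into 2 ^ 17 and leaves the ratio X / l.\<close>
    have Xgz: "X * inner_grad unit_square z z \<le> P * (L\<^sup>2 / n\<^sup>2)"
    proof -
      have "4 * l / n\<^sup>2 \<le> h * H"
        using mult_left_mono[OF hH(2), of h] hH l n4 by (simp add: power2_eq_square)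
      then have "1 / (h * H) \<le> 1 / (4 * l / n\<^sup>2)"
        using l n0 hH by (intro divide_left_mono) auto
      then have "1 / (h * H) \<le> n\<^sup>2 / (4 * l)"
        by simp
      then have "2 ^ 19 * (1 / (h * H)) * c\<xi> \<le> 2 ^ 19 * (n\<^sup>2 / (4 * l)) * (A / \<mu> * (L\<^sup>2 / n ^ 4))"
        using cB nonneg l by (intro mult_mono mult_left_mono) auto
      then have "X * inner_grad unit_square z z \<le> X * (2 ^ 19 * (n\<^sup>2 / (4 * l)) * (A / \<mu> * (L\<^sup>2 / n ^ 4)))"
        using gz X by (intro mult_left_mono) auto
      also have "\<dots> = 2 ^ 17 * (X / l) * (A / \<mu>) * (n\<^sup>2 * (L\<^sup>2 / n ^ 4))"
        by (simp add: mult_ac)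
      also have "\<dots> = 2 ^ 17 * (X / l) * (A / \<mu>) * (L\<^sup>2 / n\<^sup>2)"
        by (simp only: n24)
      also have "\<dots> \<le> P * (L\<^sup>2 / n\<^sup>2)"
        unfolding P_def using Xl A0 by (intro mult_right_mono mult_left_mono) auto
      finally show ?thesis .
    qed
    \<comment> \<open>The maximum norm bound is integrated over a set of measure at most 4 * l; the
      L2 bound of the interpolation error would not provide this factor.\<close>
    have f\<theta>: "(LINT p|lebesgue_on unit_square. indicator ?D p * (\<theta> p)\<^sup>2) \<le> 4 * l * (C\<^sup>2 * L ^ 4 / n ^ 4)"
    proof -
      have DM: "?D \<in> sets (lebesgue_on unit_square)"
        using Dm sets_unit_square by (simp add: sets_restrict_space_iff)
      have "(LINT p|lebesgue_on unit_square. indicator ?D p * (\<theta> p)\<^sup>2) \<le>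
          (LINT p|lebesgue_on unit_square. indicator ?D p * (C\<^sup>2 * L ^ 4 / n ^ 4))"
      proof (rule integral_mono_AE)
        show "integrable (lebesgue_on unit_square) (\<lambda>p. indicator ?D p * (\<theta> p)\<^sup>2)"
          using integrable_real_mult_indicator[OF DM L2_integrable_square[OF H1_L2[OF \<theta>H]]] by (simp add: mult.commute)
        have "finite_measure (lebesgue_on unit_square)"
          using lmeasurable_unit_square by (rule finite_measure_lebesgue_on)
        then show "integrable (lebesgue_on unit_square) (\<lambda>p. indicator ?D p * (C\<^sup>2 * L ^ 4 / n ^ 4))"
          using integrable_real_mult_indicator[OF DM finite_measure.integrable_const] by (simp add: mult.commute)
        show "AE p in lebesgue_on unit_square. indicator ?D p * (\<theta> p)\<^sup>2 \<le> indicator ?D p * (C\<^sup>2 * L ^ 4 / n ^ 4)"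
          using interp(3)
        proof eventually_elim
          case (elim p)
          then show ?case
            unfolding \<theta>_def by (cases "p \<in> ?D") auto
        qed
      qed
      also have "\<dots> = measure (lebesgue_on unit_square) (?D \<inter> space (lebesgue_on unit_square)) * (C\<^sup>2 * L ^ 4 / n ^ 4)"
        using Bochner_Integration.integral_indicator[of "lebesgue_on unit_square" ?D]
        by (simp only: integral_mult_left_zero)
      also have "measure (lebesgue_on unit_square) (?D \<inter> space (lebesgue_on unit_square)) = measure lebesgue ?D"
      proof -
        have "?D \<inter> unit_square = ?D" by blast
        then show ?thesis
          using Dm by (simp add: measure_restrict_space sets_unit_square)
      qed
      also have "\<dots> * (C\<^sup>2 * L ^ 4 / n ^ 4) \<le> 4 * l * (C\<^sup>2 * L ^ 4 / n ^ 4)"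
        using measure_fine_region[OF l(1,2)] by (intro mult_right_mono) auto
      finally show ?thesis .
    qed
    \<comment> \<open>The ratio h / H is at most 4 * l, so the thin layer carrying \<open>z\<close>
      supplies the same factor as the measure of the fine region.\<close>
    have fz': "(LINT p|lebesgue_on unit_square. indicator ?D p * (z p)\<^sup>2) \<le> 4 * l * (2 ^ 14 * (A / \<mu>) * (L\<^sup>2 / n ^ 4))"
    proof -
      have "h / H \<le> h / (1 / n)"
        using hH n4 by (intro divide_left_mono) auto
      also have "\<dots> = 4 * l"
        using hH n4 by simp
      finally have "2 ^ 14 * (h / H) * c\<xi> \<le> 2 ^ 14 * (4 * l) * (A / \<mu> * (L\<^sup>2 / n ^ 4))"
        using cB nonneg l by (intro mult_mono mult_left_mono) auto
      then show ?thesis using fz by simp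
    qed
    have f\<rho>: "(LINT p|lebesgue_on unit_square. indicator ?D p * (\<rho> p)\<^sup>2) \<le>
        l * (8 * C\<^sup>2 * (L ^ 4 / n ^ 4) + 2 ^ 17 * (A / \<mu>) * (L\<^sup>2 / n ^ 4))"
    proof -
      have DM: "?D \<in> sets (lebesgue_on unit_square)"
        using Dm sets_unit_square by (simp add: sets_restrict_space_iff)
      have intD: "integrable (lebesgue_on unit_square) (\<lambda>p. indicator ?D p * (f p)\<^sup>2)" if "f \<in> H1 unit_square" for f
        using integrable_real_mult_indicator[OF DM L2_integrable_square[OF H1_L2[OF that]]] by (simp add: mult.commute)
      have \<rho>H: "\<rho> \<in> H1 unit_square"
        unfolding \<rho> by (intro H1_add \<theta>H mzH)
      have "(LINT p|lebesgue_on unit_square. indicator ?D p * (\<rho> p)\<^sup>2) \<le>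
          (LINT p|lebesgue_on unit_square. 2 * (indicator ?D p * (\<theta> p)\<^sup>2) + 2 * (indicator ?D p * (z p)\<^sup>2))"
      proof (rule integral_mono)
        fix p
        have "(\<rho> p)\<^sup>2 \<le> 2 * (\<theta> p)\<^sup>2 + 2 * (z p)\<^sup>2"
          unfolding \<rho> using zero_le_power2[of "\<theta> p + z p"] by (simp add: power2_sum power2_diff)
        then show "indicator ?D p * (\<rho> p)\<^sup>2 \<le> 2 * (indicator ?D p * (\<theta> p)\<^sup>2) + 2 * (indicator ?D p * (z p)\<^sup>2)"
          by (cases "p \<in> ?D") auto
      qed (intro Bochner_Integration.integrable_add integrable_mult_right intD \<theta>H zH \<rho>H)+
      also have "\<dots> = 2 * (LINT p|lebesgue_on unit_square. indicator ?D p * (\<theta> p)\<^sup>2) + 2 * (LINT p|lebesgue_on unit_square. indicator ?D p * (z p)\<^sup>2)"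
        using intD[OF \<theta>H] intD[OF zH] by (subst Bochner_Integration.integral_add) (auto simp only: integral_mult_right_zero integrable_mult_right)
      also have "\<dots> \<le> 2 * (4 * l * (C\<^sup>2 * L ^ 4 / n ^ 4)) + 2 * (4 * l * (2 ^ 14 * (A / \<mu>) * (L\<^sup>2 / n ^ 4)))"
        using f\<theta> fz' by linarith
      also have "\<dots> = l * (8 * C\<^sup>2 * (L ^ 4 / n ^ 4) + 2 ^ 17 * (A / \<mu>) * (L\<^sup>2 / n ^ 4))"
        by (simp add: algebra_simps)
      finally show ?thesis .
    qed
    have inner_le: "8 * C\<^sup>2 * (L ^ 4 / n ^ 4) + 2 ^ 17 * (A / \<mu>) * (L\<^sup>2 / n ^ 4) \<le> (8 * C\<^sup>2 + 2 ^ 17 * (A / \<mu>)) * (L\<^sup>2 / n\<^sup>2)"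
    proof -
      have "L ^ 4 / n ^ 4 = L\<^sup>2 / n\<^sup>2 * (L\<^sup>2 / n\<^sup>2)"
        by (simp add: power_add[symmetric])
      also have "\<dots> \<le> L\<^sup>2 / n\<^sup>2 * 1"
        using powL(3) n4 by (intro mult_left_mono) (auto simp: divide_le_eq)
      finally have 1: "L ^ 4 / n ^ 4 \<le> L\<^sup>2 / n\<^sup>2" by simp
      have "L\<^sup>2 / n ^ 4 \<le> L\<^sup>2 / n\<^sup>2"
        using n4 by (intro divide_left_mono power_increasing) auto
      with 1 show ?thesis
        unfolding distrib_right using A0 by (intro add_mono mult_left_mono) auto
    qed
    \<comment> \<open>Every term on the right carries a factor X: the gradient part because
      \<epsilon> = X * X, the reaction part through l \<le> \<gamma> * X * L. Cancelling it turns
      the energy bound into a balanced one.\<close>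
    have "X * (X * inner_grad unit_square \<eta> \<eta>) \<le> X * (X * inner_grad unit_square \<rho> \<rho>) +
        K'\<^sup>2 / \<mu> * (LINT p|lebesgue_on unit_square. indicator ?D p * (\<rho> p)\<^sup>2)"
      using S2 pos mult_nonneg_nonneg[of \<mu> "inner_L2 unit_square \<eta> \<eta>"] inner_L2_self_nonneg[of unit_square \<eta>]
      unfolding X(3)[symmetric] mult.assoc by linarith
    also have "X * (X * inner_grad unit_square \<rho> \<rho>) \<le> X * (2 * C\<^sup>2 * (L\<^sup>2 / n\<^sup>2) + 2 * P * (L\<^sup>2 / n\<^sup>2))"
    proof -
      have "X * inner_grad unit_square \<rho> \<rho> \<le> X * (2 * g\<theta> + 2 * inner_grad unit_square z z)"
        using g\<rho> X by (intro mult_left_mono) auto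
      also have "\<dots> \<le> 2 * C\<^sup>2 * (L\<^sup>2 / n\<^sup>2) + 2 * P * (L\<^sup>2 / n\<^sup>2)"
        using int(2) Xgz by (simp add: distrib_left)
      finally show ?thesis using X by (intro mult_left_mono) auto
    qed
    also have "K'\<^sup>2 / \<mu> * (LINT p|lebesgue_on unit_square. indicator ?D p * (\<rho> p)\<^sup>2) \<le>
        K'\<^sup>2 / \<mu> * ((\<gamma> * X * L) * ((8 * C\<^sup>2 + 2 ^ 17 * (A / \<mu>)) * (L\<^sup>2 / n\<^sup>2)))"
    proof (rule mult_left_mono)
      have "l * (8 * C\<^sup>2 * (L ^ 4 / n ^ 4) + 2 ^ 17 * (A / \<mu>) * (L\<^sup>2 / n ^ 4)) \<le>
          (\<gamma> * X * L) * ((8 * C\<^sup>2 + 2 ^ 17 * (A / \<mu>)) * (L\<^sup>2 / n\<^sup>2))"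
      proof (rule mult_mono[OF l(3) inner_le])
        show "0 \<le> \<gamma> * X * L"
          using l by linarith
        show "0 \<le> 8 * C\<^sup>2 * (L ^ 4 / n ^ 4) + 2 ^ 17 * (A / \<mu>) * (L\<^sup>2 / n ^ 4)"
          by (intro add_nonneg_nonneg mult_nonneg_nonneg A0) auto
      qed
      then show "(LINT p|lebesgue_on unit_square. indicator ?D p * (\<rho> p)\<^sup>2) \<le>
          (\<gamma> * X * L) * ((8 * C\<^sup>2 + 2 ^ 17 * (A / \<mu>)) * (L\<^sup>2 / n\<^sup>2))"
        using f\<rho> by linarith
    qed (use pos in auto)
    also have "X * (2 * C\<^sup>2 * (L\<^sup>2 / n\<^sup>2) + 2 * P * (L\<^sup>2 / n\<^sup>2)) +
        K'\<^sup>2 / \<mu> * ((\<gamma> * X * L) * ((8 * C\<^sup>2 + 2 ^ 17 * (A / \<mu>)) * (L\<^sup>2 / n\<^sup>2))) =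
        X * ((2 * C\<^sup>2 + 2 * P) * (L\<^sup>2 / n\<^sup>2) + K'\<^sup>2 / \<mu> * \<gamma> * (8 * C\<^sup>2 + 2 ^ 17 * (A / \<mu>)) * (L ^ 3 / n\<^sup>2))"
    proof -
      have "L ^ 3 / n\<^sup>2 = L * (L\<^sup>2 / n\<^sup>2)"
        by (simp add: power3_eq_cube power2_eq_square)
      moreover have "X * (a * y + b * y) + k * ((\<gamma> * X * L) * (d * y)) = X * ((a + b) * y + k * \<gamma> * d * (L * y))" for a b y k d
        by (simp add: algebra_simps)
      ultimately show ?thesis by (simp only:)
    qed
    also have "\<dots> \<le> X * (Q * (L ^ 3 / n\<^sup>2))"
    proof (rule mult_left_mono)
      have "(2 * C\<^sup>2 + 2 * P) * (L\<^sup>2 / n\<^sup>2) \<le> (2 * C\<^sup>2 + 2 * P) * (L ^ 3 / n\<^sup>2)"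
        using P0 L23 by (intro mult_left_mono) auto
      then show "(2 * C\<^sup>2 + 2 * P) * (L\<^sup>2 / n\<^sup>2) + K'\<^sup>2 / \<mu> * \<gamma> * (8 * C\<^sup>2 + 2 ^ 17 * (A / \<mu>)) * (L ^ 3 / n\<^sup>2) \<le> Q * (L ^ 3 / n\<^sup>2)"
        unfolding Q_def distrib_right by linarith
    qed (use X in auto)
    finally have "X * (X * inner_grad unit_square \<eta> \<eta>) \<le> X * (Q * (L ^ 3 / n\<^sup>2))"
      by simp
    then have g\<eta>: "X * inner_grad unit_square \<eta> \<eta> \<le> Q * (L ^ 3 / n\<^sup>2)"
      by (rule mult_left_le_imp_le[OF _ X(1)])
    have \<xi>\<eta>: "\<xi> = (\<lambda>p. \<eta> p + (- 1) * z p)"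
      by (auto simp: \<xi>_def \<eta>_def w'_def)
    have "g\<xi> \<le> 2 * inner_grad unit_square \<eta> \<eta> + 2 * inner_grad unit_square z z"
      unfolding g\<xi>_def \<xi>\<eta> using inner_grad_add_self_le[OF \<eta>H mzH] unfolding neg .
    then have "X * g\<xi> \<le> X * (2 * inner_grad unit_square \<eta> \<eta> + 2 * inner_grad unit_square z z)"
      using X by (intro mult_left_mono) auto
    also have "\<dots> \<le> 2 * (Q * (L ^ 3 / n\<^sup>2)) + 2 * (P * (L\<^sup>2 / n\<^sup>2))"
      using g\<eta> Xgz by (simp add: distrib_left)
    also have "\<dots> \<le> 2 * (Q * (L ^ 3 / n\<^sup>2)) + 2 * (P * (L ^ 3 / n\<^sup>2))"
      using mult_left_mono[OF L23 P0] by linarith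
    also have "\<dots> = (2 * Q + 2 * P) * (L ^ 3 / n\<^sup>2)"
      by (simp only: distrib_right mult.assoc)
    also have "\<dots> \<le> B * (L ^ 3 / n\<^sup>2)"
      using A0 LB by (intro mult_right_mono) (auto simp: B_def)
    finally show ?thesis by (simp add: X_def g\<xi>_def)
  qed
qed

section \<open>Constants uniform in \<epsilon> and N, and the final error bound\<close>

theorem mainTheorem3:
  fixes g g2 :: "real \<times> real \<Rightarrow> real \<Rightarrow> real"
    and \<mu> cstar \<epsilon>0 C0 :: real
    and u :: "real \<Rightarrow> real \<times> real \<Rightarrow> real"
    and V :: "real \<Rightarrow> nat \<Rightarrow> (real \<times> real \<Rightarrow> real) set"
    and uI :: "real \<Rightarrow> nat \<Rightarrow> real \<times> real \<Rightarrow> real"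
  defines "\<Omega> \<equiv> unit_square"
    and "l \<equiv> transition_point cstar"
    and "admissible \<equiv> \<lambda>\<epsilon> (N::nat). 0 < \<epsilon> \<and> \<epsilon> \<le> \<epsilon>0 \<and> 0 < N \<and> 4 dvd N"
  assumes eps0: "0 < \<epsilon>0" "\<epsilon>0 \<le> 1"
    and g_cont: "continuous_on (closure \<Omega> \<times> UNIV) (\<lambda>(x, s). g x s)"
    and g2_deriv: "\<And>x s. x \<in> closure \<Omega> \<Longrightarrow> (g x has_real_derivative g2 x s) (at s)"
    and g2_cont: "continuous_on (closure \<Omega> \<times> UNIV) (\<lambda>(x, s). g2 x s)"
    and mu: "0 < \<mu>" "\<And>x s. x \<in> closure \<Omega> \<Longrightarrow> \<mu> \<le> g2 x s"
    and cstar: "0 < cstar" "cstar < \<mu>"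
    and u_sol: "\<And>\<epsilon>. 0 < \<epsilon> \<Longrightarrow> \<epsilon> \<le> \<epsilon>0 \<Longrightarrow> variational_solution \<epsilon> g (H1_0 \<Omega>) (u \<epsilon>)"
    and u_cont: "\<And>\<epsilon>. 0 < \<epsilon> \<Longrightarrow> \<epsilon> \<le> \<epsilon>0 \<Longrightarrow> continuous_on (closure \<Omega>) (u \<epsilon>)"
    and V_space:
      "(\<forall>\<epsilon> N. admissible \<epsilon> N \<longrightarrow> V \<epsilon> N = bilinear_space (l \<epsilon> N) N) \<or>
       (\<exists>d. \<forall>\<epsilon> N. admissible \<epsilon> N \<longrightarrow> V \<epsilon> N = linear_space (d \<epsilon> N) (l \<epsilon> N) N)"
    and uI_interp:
      "\<And>\<epsilon> N. admissible \<epsilon> N \<Longrightarrow> lagrange_interpolant (l \<epsilon> N) N (V \<epsilon> N) (u \<epsilon>) (uI \<epsilon> N)"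
    and interp_L2:
      "\<And>\<epsilon> N. admissible \<epsilon> N \<Longrightarrow>
         norm_L2 \<Omega> (\<lambda>x. u \<epsilon> x - uI \<epsilon> N x) \<le> C0 * (1 / real N ^ 2)"
    and interp_H1:
      "\<And>\<epsilon> N. admissible \<epsilon> N \<Longrightarrow>
         \<epsilon> powr (1/4) * seminorm_H1 \<Omega> (\<lambda>x. u \<epsilon> x - uI \<epsilon> N x) \<le> C0 * (1 / real N * ln (real N))"
    and interp_Linf_coarse:
      "\<And>\<epsilon> N. admissible \<epsilon> N \<Longrightarrow>
         norm_Linf (coarse_region (l \<epsilon> N)) (\<lambda>x. u \<epsilon> x - uI \<epsilon> N x)
           \<le> ereal (C0 * (1 / real N ^ 2))"
    and interp_Linf_fine:
      "\<And>\<epsilon> N. admissible \<epsilon> N \<Longrightarrow>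
         norm_Linf (\<Omega> - coarse_region (l \<epsilon> N)) (\<lambda>x. u \<epsilon> x - uI \<epsilon> N x)
           \<le> ereal (C0 * (1 / real N * ln (real N)) ^ 2)"
  shows "\<exists>C. \<forall>\<epsilon> N uN. admissible \<epsilon> N \<longrightarrow> variational_solution \<epsilon> g (V \<epsilon> N) uN \<longrightarrow>
      \<epsilon> powr (1/4) * seminorm_H1 \<Omega> (\<lambda>x. u \<epsilon> x - uN x) + norm_L2 \<Omega> (\<lambda>x. u \<epsilon> x - uN x)
        \<le> C * (1 / real N * ln (real N) powr (3/2) + 1 / real N ^ 2)"
proof -
  have \<Omega>c: "p \<in> closure \<Omega>" if "p \<in> unit_square" for p
    using that closure_subset unfolding \<Omega>_def by blast
  have g_cont': "continuous_on (closure unit_square \<times> UNIV) (\<lambda>(x, s). g x s)"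
    using g_cont by (simp add: \<Omega>_def)
  have mono: "\<mu> * (s - t)\<^sup>2 \<le> (g p s - g p t) * (s - t)" if "p \<in> unit_square" for p s t
    by (rule monotone_of_deriv_ge[of "g p" "g2 p"]) (use g2_deriv mu(2) \<Omega>c[OF that] in auto)
  have Lipschitz: "\<exists>K. \<forall>p s t. p \<in> unit_square \<longrightarrow> \<bar>s\<bar> \<le> M \<longrightarrow> \<bar>t\<bar> \<le> M \<longrightarrow> \<bar>g p s - g p t\<bar> \<le> K * \<bar>s - t\<bar>" for M
    using Lipschitz_of_bounded_deriv[of g g2 M] g2_deriv g2_cont unfolding \<Omega>_def by metis
  have "continuous_on (cbox (0, 0) (1, 1)) (\<lambda>p. (\<lambda>(x, s). g x s) (p, 0))"
    by (rule continuous_on_compose2[OF g_cont'[unfolded closure_unit_square]]) (auto intro!: continuous_intros)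
  then have "continuous_on (cbox (0, 0) (1, 1)) (\<lambda>p. g p 0)"
    by simp
  from continuous_on_cbox_bound[OF this] obtain G
    where G_cbox: "\<And>p. p \<in> cbox (0, 0) (1, 1) \<Longrightarrow> norm (g p 0) \<le> G"
    by blast
  have G: "\<bar>g p 0\<bar> \<le> G" if "p \<in> unit_square" for p
    using G_cbox[of p] unit_square_subset that by force
  \<comment> \<open>The hypotheses leave the sign of \<open>C0\<close> open, and the bounds are
    squared below.\<close>
  define Ca where "Ca = \<bar>C0\<bar>"
  have Ca: "0 \<le> Ca" "C0 \<le> Ca" by (auto simp: Ca_def)

  have range_l: "0 < l \<epsilon> N" "l \<epsilon> N \<le> 1/4" if "admissible \<epsilon> N" for \<epsilon> N
  proof -
    have "4 \<le> N"
      using that by (auto simp: admissible_def dest: dvd_imp_le)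
    then have "0 < ln (real N)" by simp
    then show "0 < l \<epsilon> N" "l \<epsilon> N \<le> 1/4"
      using that cstar by (auto simp: admissible_def l_def transition_point_def)
  qed
  \<comment> \<open>From here on linear and bilinear elements are treated alike, through
    \<open>kind\<close>.\<close>
  have fe: "\<exists>kind. V \<epsilon> N = tensor_mesh.fe_space (mesh_pt (l \<epsilon> N) N) N kind" if a: "admissible \<epsilon> N" for \<epsilon> N
    using V_space
  proof
    assume "\<forall>\<epsilon> N. admissible \<epsilon> N \<longrightarrow> V \<epsilon> N = bilinear_space (l \<epsilon> N) N"
    then show ?thesis
      using bilinear_space_eq_fe_space[of N "l \<epsilon> N"] a range_l[OF a] by (auto simp: admissible_def)
  next
    assume "\<exists>d. \<forall>\<epsilon> N. admissible \<epsilon> N \<longrightarrow> V \<epsilon> N = linear_space (d \<epsilon> N) (l \<epsilon> N) N"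
    then obtain d where "V \<epsilon> N = linear_space (d \<epsilon> N) (l \<epsilon> N) N"
      using a by blast
    then show ?thesis
      using linear_space_eq_fe_space[of N "l \<epsilon> N"] a range_l[OF a] by (auto simp: admissible_def)
  qed
  have V_props: "continuous_on (cbox (0, 0) (1, 1)) v" "v \<in> H1 unit_square" if a: "admissible \<epsilon> N" and v: "v \<in> V \<epsilon> N" for \<epsilon> N v
  proof -
    obtain kind where k: "V \<epsilon> N = tensor_mesh.fe_space (mesh_pt (l \<epsilon> N) N) N kind"
      using fe[OF a] by blast
    have t: "tensor_mesh (mesh_pt (l \<epsilon> N) N) N"
      using a range_l[OF a] by (intro tensor_mesh_mesh_pt) (auto simp: admissible_def)
    show "continuous_on (cbox (0, 0) (1, 1)) v" "v \<in> H1 unit_square"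
      using tensor_mesh.fe_spaceD(1)[OF t] tensor_mesh.fe_space_H1[OF t] v unfolding k by blast+
  qed
  have uI_V: "uI \<epsilon> N \<in> V \<epsilon> N" if "admissible \<epsilon> N" for \<epsilon> N
    using uI_interp[OF that] by (simp add: lagrange_interpolant_def)
  have u_weak: "variational_solution \<epsilon> g (H1_0 unit_square) (u \<epsilon>)"
    and u_H1: "u \<epsilon> \<in> H1 unit_square" and gu: "(\<lambda>p. g p (u \<epsilon> p)) \<in> L2 unit_square"
    if "0 < \<epsilon>" "\<epsilon> \<le> \<epsilon>0" for \<epsilon>
    using u_sol[OF that] u_cont[OF that] continuous_on_superposition[OF g_cont', of "u \<epsilon>"]
    by (auto simp: \<Omega>_def closure_unit_square variational_solution_def H1_0_def)

  have ratio: "0 \<le> ln (real N)" "1 / real N * ln (real N) \<le> 1" "1 / real N ^ 2 \<le> 1" if "admissible \<epsilon> N" for \<epsilon> N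
  proof -
    have "1 \<le> real N"
      using that by (simp add: admissible_def)
    then show "0 \<le> ln (real N)" "1 / real N * ln (real N) \<le> 1" "1 / real N ^ 2 \<le> 1"
      using ln_le_minus_one[of "real N"] by (auto simp: divide_le_eq one_le_power)
  qed
  \<comment> \<open>A crude bound on the whole square, for the Lipschitz constants, is combined with
    the sharp one on the fine region, for the integral there.\<close>
  have \<theta>_Linf: "AE p in lebesgue_on unit_square. \<bar>u \<epsilon> p - uI \<epsilon> N p\<bar> \<le> Ca \<and>
      (p \<notin> coarse_region (l \<epsilon> N) \<longrightarrow> (u \<epsilon> p - uI \<epsilon> N p)\<^sup>2 \<le> Ca\<^sup>2 * ln (real N) ^ 4 / real N ^ 4)"
    if a: "admissible \<epsilon> N" for \<epsilon> N
  proof -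
    have "AE p in lebesgue. p \<in> coarse_region (l \<epsilon> N) \<longrightarrow> \<bar>u \<epsilon> p - uI \<epsilon> N p\<bar> \<le> C0 * (1 / real N ^ 2)"
      using interp_Linf_coarse[OF a] coarse_region_lmeasurable by (intro norm_Linf_AE) (auto simp: fmeasurableD)
    moreover have "AE p in lebesgue. p \<in> unit_square - coarse_region (l \<epsilon> N) \<longrightarrow>
        \<bar>u \<epsilon> p - uI \<epsilon> N p\<bar> \<le> C0 * (1 / real N * ln (real N)) ^ 2"
      using interp_Linf_fine[OF a] coarse_region_lmeasurable sets_unit_square
      by (intro norm_Linf_AE) (auto simp: fmeasurableD \<Omega>_def)
    ultimately have "AE p in lebesgue. p \<in> unit_square \<longrightarrow> \<bar>u \<epsilon> p - uI \<epsilon> N p\<bar> \<le> Ca \<and>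
      (p \<notin> coarse_region (l \<epsilon> N) \<longrightarrow> (u \<epsilon> p - uI \<epsilon> N p)\<^sup>2 \<le> Ca\<^sup>2 * ln (real N) ^ 4 / real N ^ 4)"
    proof eventually_elim
      case (elim p)
      have 1: "C0 * (1 / real N ^ 2) \<le> Ca"
        using mult_mono[of C0 Ca "1 / real N ^ 2" 1] ratio[OF a] Ca by simp
      have 2: "C0 * (1 / real N * ln (real N)) ^ 2 \<le> Ca * (1 / real N * ln (real N)) ^ 2"
        using Ca by (intro mult_right_mono) auto
      have 3: "Ca * (1 / real N * ln (real N)) ^ 2 \<le> Ca * 1"
        using ratio[OF a] Ca by (intro mult_left_mono power_le_one) auto
      show ?case
      proof (cases "p \<in> coarse_region (l \<epsilon> N)")
        case True
        then show ?thesis using elim(1) 1 by simp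
      next
        case False
        show ?thesis
        proof (intro impI conjI)
          assume "p \<in> unit_square"
          then have le: "\<bar>u \<epsilon> p - uI \<epsilon> N p\<bar> \<le> Ca * (1 / real N * ln (real N)) ^ 2"
            using elim(2) False 2 by simp
          then show "\<bar>u \<epsilon> p - uI \<epsilon> N p\<bar> \<le> Ca" using 3 by simp
          have "\<bar>u \<epsilon> p - uI \<epsilon> N p\<bar>\<^sup>2 \<le> (Ca * (1 / real N * ln (real N)) ^ 2)\<^sup>2"
            using le by (intro power_mono) auto
          then show "(u \<epsilon> p - uI \<epsilon> N p)\<^sup>2 \<le> Ca\<^sup>2 * ln (real N) ^ 4 / real N ^ 4"
            by (simp add: power_mult_distrib power_divide flip: power_mult)
        qed
      qed
    qed
    moreover have "unit_square \<inter> space lebesgue \<in> sets lebesgue"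
      by (simp add: sets_unit_square)
    ultimately show ?thesis
      by (simp only: AE_restrict_space_iff)
  qed
  have \<theta>_L2: "inner_L2 unit_square (\<lambda>p. u \<epsilon> p - uI \<epsilon> N p) (\<lambda>p. u \<epsilon> p - uI \<epsilon> N p) \<le> Ca\<^sup>2 / real N ^ 4"
    if a: "admissible \<epsilon> N" for \<epsilon> N
  proof -
    have "norm_L2 unit_square (\<lambda>p. u \<epsilon> p - uI \<epsilon> N p) \<le> Ca * (1 / real N ^ 2)"
      using interp_L2[OF a] mult_right_mono[OF Ca(2), of "1 / real N ^ 2"] by (simp add: \<Omega>_def)
    then have "(norm_L2 unit_square (\<lambda>p. u \<epsilon> p - uI \<epsilon> N p))\<^sup>2 \<le> (Ca * (1 / real N ^ 2))\<^sup>2"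
      by (intro power_mono) (auto simp: norm_L2_def inner_L2_self_nonneg)
    then show ?thesis
      by (simp add: norm_L2_square power_mult_distrib power_divide flip: power_mult)
  qed
  have powr_quarter: "(\<epsilon> powr (1/4))\<^sup>2 = sqrt \<epsilon>" if "0 < \<epsilon>" for \<epsilon> :: real
    using that by (simp add: powr_half_sqrt[symmetric] flip: powr_numeral add: powr_powr)
  have \<theta>_H1: "sqrt \<epsilon> * inner_grad unit_square (\<lambda>p. u \<epsilon> p - uI \<epsilon> N p) (\<lambda>p. u \<epsilon> p - uI \<epsilon> N p) \<le> Ca\<^sup>2 * (ln (real N))\<^sup>2 / (real N)\<^sup>2"
    if a: "admissible \<epsilon> N" for \<epsilon> N
  proof -
    have "\<epsilon> powr (1/4) * seminorm_H1 unit_square (\<lambda>p. u \<epsilon> p - uI \<epsilon> N p) \<le> Ca * (1 / real N * ln (real N))"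
      using interp_H1[OF a] mult_right_mono[OF Ca(2), of "1 / real N * ln (real N)"] ratio[OF a] by (simp add: \<Omega>_def)
    then have "(\<epsilon> powr (1/4) * seminorm_H1 unit_square (\<lambda>p. u \<epsilon> p - uI \<epsilon> N p))\<^sup>2 \<le> (Ca * (1 / real N * ln (real N)))\<^sup>2"
      by (intro power_mono) (auto simp: seminorm_H1_def inner_grad_self_nonneg)
    then show ?thesis
      using a by (simp add: power_mult_distrib powr_quarter seminorm_H1_square power_divide admissible_def)
  qed

  \<comment> \<open>On the mesh with \<open>N = 4\<close> every interior node lies on the closed coarse region, so there the
    interpolant is controlled by its \<open>L2\<close> norm alone. This bounds \<open>u\<close> uniformly in \<open>\<epsilon>\<close> without a
    maximum principle.\<close>
  define R where "R = sqrt (2 ^ 18 * (2 * (G\<^sup>2 / \<mu>\<^sup>2) + 2 * Ca\<^sup>2))"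
  have u_bound: "AE p in lebesgue_on unit_square. \<bar>u \<epsilon> p\<bar> \<le> R + Ca" if \<epsilon>: "0 < \<epsilon>" "\<epsilon> \<le> \<epsilon>0" for \<epsilon>
  proof -
    have a: "admissible \<epsilon> 4"
      using \<epsilon> by (simp add: admissible_def)
    obtain kind where k: "V \<epsilon> 4 = tensor_mesh.fe_space (mesh_pt (l \<epsilon> 4) 4) 4 kind"
      using fe[OF a] by blast
    define w where "w = uI \<epsilon> 4"
    have w: "w \<in> tensor_mesh.fe_space (mesh_pt (l \<epsilon> 4) 4) 4 kind"
      using uI_V[OF a] by (simp add: w_def k)
    define H where "H = 2 * (1 - 2 * l \<epsilon> 4) / real 4"
    \<comment> \<open>With \<open>w\<close> in the place of \<xi> the correction is - w, so its
      maximum bound becomes one for \<open>w\<close>.\<close>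
    have "\<exists>z. (\<forall>p\<in>unit_square. (z p)\<^sup>2 \<le> 2 ^ 14 / H\<^sup>2 * inner_L2 unit_square w w) \<and> (\<forall>p\<in>unit_square. z p = - w p)"
      using shishkin_coarse_correction[OF _ _ range_l[OF a] w, folded H_def] by auto
    then have z: "(w p)\<^sup>2 \<le> 2 ^ 14 / H\<^sup>2 * inner_L2 unit_square w w" if "p \<in> unit_square" for p
      using that by auto
    have wH: "w \<in> H1 unit_square"
      using V_props(2)[OF a] uI_V[OF a] by (simp add: w_def)
    have "inner_L2 unit_square (\<lambda>p. u \<epsilon> p + - 1 * (u \<epsilon> p - w p)) (\<lambda>p. u \<epsilon> p + - 1 * (u \<epsilon> p - w p)) \<le>
        2 * inner_L2 unit_square (u \<epsilon>) (u \<epsilon>) + 2 * inner_L2 unit_square (\<lambda>p. - 1 * (u \<epsilon> p - w p)) (\<lambda>p. - 1 * (u \<epsilon> p - w p))"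
      by (intro inner_L2_add_self_le L2_cmult L2_diff H1_L2 u_H1 \<epsilon> wH)
    moreover have "inner_L2 unit_square (\<lambda>p. - 1 * (u \<epsilon> p - w p)) (\<lambda>p. - 1 * (u \<epsilon> p - w p)) = inner_L2 unit_square (\<lambda>p. u \<epsilon> p - w p) (\<lambda>p. u \<epsilon> p - w p)"
      by (simp only: inner_L2_cmult_left inner_L2_commute[of _ _ "\<lambda>p. - 1 * (u \<epsilon> p - w p)"])
    moreover have "inner_L2 unit_square (\<lambda>p. u \<epsilon> p - w p) (\<lambda>p. u \<epsilon> p - w p) \<le> Ca\<^sup>2"
      using \<theta>_L2[OF a] inner_L2_self_nonneg[of unit_square "\<lambda>p. u \<epsilon> p - w p"] unfolding w_def by simp
    moreover have "inner_L2 unit_square (u \<epsilon>) (u \<epsilon>) \<le> G\<^sup>2 / \<mu>\<^sup>2"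
      by (rule weak_solution_L2_bound[OF mu(1) \<epsilon>(1) mono G gu[OF \<epsilon>] u_weak[OF \<epsilon>]])
    ultimately have w_L2: "inner_L2 unit_square w w \<le> 2 * (G\<^sup>2 / \<mu>\<^sup>2) + 2 * Ca\<^sup>2"
      by simp
    \<comment> \<open>From l \<le> 1/4; this turns 2 ^ 14 / H^2 into the 2 ^ 18 of
      \<open>R\<close>.\<close>
    have "1 / 4 \<le> H"
      using range_l[OF a] by (simp add: H_def)
    then have "(1 / 4)\<^sup>2 \<le> H\<^sup>2"
      by (intro power_mono) auto
    then have H: "2 ^ 14 / H\<^sup>2 \<le> 2 ^ 18"
      by (simp add: power_divide divide_le_eq)
    have w_bound: "\<bar>w p\<bar> \<le> R" if "p \<in> unit_square" for p
      unfolding R_def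
    proof (rule real_le_rsqrt)
      have "(w p)\<^sup>2 \<le> 2 ^ 14 / H\<^sup>2 * inner_L2 unit_square w w"
        by (rule z[OF that])
      also have "\<dots> \<le> 2 ^ 18 * (2 * (G\<^sup>2 / \<mu>\<^sup>2) + 2 * Ca\<^sup>2)"
        using H w_L2 by (intro mult_mono) (auto simp: inner_L2_self_nonneg)
      finally show "\<bar>w p\<bar>\<^sup>2 \<le> 2 ^ 18 * (2 * (G\<^sup>2 / \<mu>\<^sup>2) + 2 * Ca\<^sup>2)" by simp
    qed
    show ?thesis
      using \<theta>_Linf[OF a] AE_space[of "lebesgue_on unit_square"]
    proof eventually_elim
      case (elim p)
      have "\<bar>u \<epsilon> p - w p\<bar> \<le> Ca" "\<bar>w p\<bar> \<le> R"
        using elim w_bound[of p] by (auto simp: w_def)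
      then show ?case by linarith
    qed
  qed

  \<comment> \<open>\<open>u\<close> is bounded by R + Ca, and the interpolant by one more
    Ca.\<close>
  define M where "M = R + 2 * Ca"
  have u_M: "AE p in lebesgue_on unit_square. \<bar>u \<epsilon> p\<bar> \<le> M" and uI_M: "AE p in lebesgue_on unit_square. \<bar>uI \<epsilon> N p\<bar> \<le> M"
    if a: "admissible \<epsilon> N" for \<epsilon> N
  proof -
    have \<epsilon>: "0 < \<epsilon>" "\<epsilon> \<le> \<epsilon>0" using a by (auto simp: admissible_def)
    show "AE p in lebesgue_on unit_square. \<bar>u \<epsilon> p\<bar> \<le> M"
      using u_bound[OF \<epsilon>] by eventually_elim (use Ca in \<open>simp add: M_def\<close>)
    show "AE p in lebesgue_on unit_square. \<bar>uI \<epsilon> N p\<bar> \<le> M"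
      using u_bound[OF \<epsilon>] \<theta>_Linf[OF a]
    proof eventually_elim
      case (elim p)
      then have "\<bar>u \<epsilon> p - uI \<epsilon> N p\<bar> \<le> Ca" by blast
      then show ?case using elim(1) unfolding M_def by linarith
    qed
  qed
  \<comment> \<open>The order M, K, A, M', K' avoids a circle: the enlarged range \<open>M'\<close>
    depends on \<open>K\<close> through \<open>A\<close>, and a new Lipschitz constant is taken on
    it.\<close>
  obtain K where K: "\<And>p s t. p \<in> unit_square \<Longrightarrow> \<bar>s\<bar> \<le> M \<Longrightarrow> \<bar>t\<bar> \<le> M \<Longrightarrow> \<bar>g p s - g p t\<bar> \<le> K * \<bar>s - t\<bar>"
    using Lipschitz by blast
  define A where "A = Ca\<^sup>2 + K\<^sup>2 * Ca\<^sup>2 / \<mu>"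
  define M' where "M' = M + sqrt (2 ^ 14 * (A / \<mu>))"
  obtain K' where K': "\<And>p s t. p \<in> unit_square \<Longrightarrow> \<bar>s\<bar> \<le> M' \<Longrightarrow> \<bar>t\<bar> \<le> M' \<Longrightarrow> \<bar>g p s - g p t\<bar> \<le> K' * \<bar>s - t\<bar>"
    using Lipschitz by blast
  obtain B where B: "\<And>\<epsilon> N uN. admissible \<epsilon> N \<Longrightarrow> variational_solution \<epsilon> g (V \<epsilon> N) uN \<Longrightarrow>
      sqrt \<epsilon> * inner_grad unit_square (\<lambda>p. uI \<epsilon> N p - uN p) (\<lambda>p. uI \<epsilon> N p - uN p) \<le> B * (ln (real N) ^ 3 / (real N)\<^sup>2) \<and>
      inner_L2 unit_square (\<lambda>p. uI \<epsilon> N p - uN p) (\<lambda>p. uI \<epsilon> N p - uN p) \<le> B * (ln (real N) ^ 3 / (real N)\<^sup>2)"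
  proof -
    define \<gamma> P where "\<gamma> = 2 / sqrt cstar" and "P = 2 ^ 17 * (4 + 1 / \<gamma>) * (A / \<mu>)"
    define Q where "Q = 2 * Ca\<^sup>2 + 2 * P + K'\<^sup>2 / \<mu> * \<gamma> * (8 * Ca\<^sup>2 + 2 ^ 17 * (A / \<mu>))"
    show ?thesis
    proof (rule that[of "A + A / \<mu> + 2 * Q + 2 * P"])
      fix \<epsilon> N uN assume a: "admissible \<epsilon> N" and uN: "variational_solution \<epsilon> g (V \<epsilon> N) uN"
      obtain kind where k: "V \<epsilon> N = tensor_mesh.fe_space (mesh_pt (l \<epsilon> N) N) N kind"
        using fe[OF a] by blast
      have \<epsilon>: "0 < \<epsilon>" "\<epsilon> \<le> \<epsilon>0" "\<epsilon> \<le> 1" and N: "0 < N" "4 dvd N"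
        using a eps0 by (auto simp: admissible_def)
      have uNV: "uN \<in> V \<epsilon> N"
        using uN by (simp add: variational_solution_def)
      have gN: "(\<lambda>p. g p (uN p)) \<in> L2 unit_square"
        by (rule continuous_on_superposition[OF g_cont' V_props(1)[OF a uNV]])
      have fine: "AE p in lebesgue_on unit_square. p \<notin> coarse_region (transition_point cstar \<epsilon> N) \<longrightarrow>
          (u \<epsilon> p - uI \<epsilon> N p)\<^sup>2 \<le> Ca\<^sup>2 * ln (real N) ^ 4 / real N ^ 4"
        using \<theta>_Linf[OF a] by eventually_elim (simp add: l_def)
      note bound = discrete_error_bound[where M = M and M' = M', OF mu(1) \<epsilon>(1,3) cstar(1) N mono K K' gu[OF \<epsilon>(1,2)] gN u_weak[OF \<epsilon>(1,2)] uN
        k[unfolded l_def] uI_V[OF a] u_M[OF a] uI_M[OF a] \<theta>_L2[OF a] \<theta>_H1[OF a] fine, folded A_def, folded \<gamma>_def, folded P_def, folded Q_def]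
      show "sqrt \<epsilon> * inner_grad unit_square (\<lambda>p. uI \<epsilon> N p - uN p) (\<lambda>p. uI \<epsilon> N p - uN p) \<le> (A + A / \<mu> + 2 * Q + 2 * P) * (ln (real N) ^ 3 / (real N)\<^sup>2) \<and>
        inner_L2 unit_square (\<lambda>p. uI \<epsilon> N p - uN p) (\<lambda>p. uI \<epsilon> N p - uN p) \<le> (A + A / \<mu> + 2 * Q + 2 * P) * (ln (real N) ^ 3 / (real N)\<^sup>2)"
        by (intro conjI; rule bound; simp add: M'_def)
    qed
  qed

  \<comment> \<open>\<open>B\<close> was obtained without a sign, hence the maximum with 0; the
    factors 2 come from squaring the sum of \<theta> and \<xi>.\<close>
  define S where "S = 2 * Ca\<^sup>2 + 2 * max 0 B"
  have S0: "0 \<le> S" by (simp add: S_def)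
  show ?thesis
  \<comment> \<open>One sqrt S for each of the two norms.\<close>
  proof (intro exI[of _ "2 * sqrt S"] allI impI)
    fix \<epsilon> N uN assume a: "admissible \<epsilon> N" and uN: "variational_solution \<epsilon> g (V \<epsilon> N) uN"
    have \<epsilon>: "0 < \<epsilon>" "\<epsilon> \<le> \<epsilon>0" and n4: "4 \<le> real N"
      using a by (auto simp: admissible_def dest: dvd_imp_le)
    have uNV: "uN \<in> V \<epsilon> N"
      using uN by (simp add: variational_solution_def)
    define n L where "n = real N" and "L = ln (real N)"
    have L1: "1 \<le> L"
      using exp_le n4 by (simp add: L_def ln_ge_iff)
    define \<theta> \<xi> where "\<theta> = (\<lambda>p. u \<epsilon> p - uI \<epsilon> N p)" and "\<xi> = (\<lambda>p. uI \<epsilon> N p - uN p)"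
    have H: "\<theta> \<in> H1 unit_square" "\<xi> \<in> H1 unit_square"
      unfolding \<theta>_def \<xi>_def by (intro H1_diff u_H1 \<epsilon> V_props(2)[OF a] uI_V[OF a] uNV)+
    have sum: "(\<lambda>p. u \<epsilon> p - uN p) = (\<lambda>p. \<theta> p + \<xi> p)"
      by (simp add: \<theta>_def \<xi>_def)
    have LB: "0 \<le> L ^ 3 / n\<^sup>2" "L\<^sup>2 / n\<^sup>2 \<le> L ^ 3 / n\<^sup>2" "1 / n ^ 4 \<le> L ^ 3 / n\<^sup>2"
    proof -
      show "0 \<le> L ^ 3 / n\<^sup>2" using L1 by simp
      show "L\<^sup>2 / n\<^sup>2 \<le> L ^ 3 / n\<^sup>2"
        using L1 by (intro divide_right_mono power_increasing) auto
      have "1 / n ^ 4 \<le> 1 / n\<^sup>2"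
        using n4 by (intro divide_left_mono power_increasing) (auto simp: n_def)
      also have "\<dots> \<le> L ^ 3 / n\<^sup>2"
        using L1 by (intro divide_right_mono) (auto simp: one_le_power)
      finally show "1 / n ^ 4 \<le> L ^ 3 / n\<^sup>2" .
    qed
    have BS: "B * (L ^ 3 / n\<^sup>2) \<le> max 0 B * (L ^ 3 / n\<^sup>2)"
      using LB by (intro mult_right_mono) auto
    have facts: "sqrt \<epsilon> * inner_grad unit_square \<theta> \<theta> \<le> Ca\<^sup>2 * (L\<^sup>2 / n\<^sup>2)" "inner_L2 unit_square \<theta> \<theta> \<le> Ca\<^sup>2 * (1 / n ^ 4)"
      "sqrt \<epsilon> * inner_grad unit_square \<xi> \<xi> \<le> B * (L ^ 3 / n\<^sup>2)" "inner_L2 unit_square \<xi> \<xi> \<le> B * (L ^ 3 / n\<^sup>2)"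
      using \<theta>_H1[OF a] \<theta>_L2[OF a] B[OF a uN] by (simp_all add: \<theta>_def \<xi>_def n_def L_def)
    have "sqrt \<epsilon> * inner_grad unit_square (\<lambda>p. \<theta> p + \<xi> p) (\<lambda>p. \<theta> p + \<xi> p) \<le>
        sqrt \<epsilon> * (2 * inner_grad unit_square \<theta> \<theta> + 2 * inner_grad unit_square \<xi> \<xi>)"
      using \<epsilon> by (intro mult_left_mono inner_grad_add_self_le H) auto
    also have "\<dots> \<le> 2 * (Ca\<^sup>2 * (L\<^sup>2 / n\<^sup>2)) + 2 * (max 0 B * (L ^ 3 / n\<^sup>2))"
    proof -
      have "sqrt \<epsilon> * (2 * inner_grad unit_square \<theta> \<theta> + 2 * inner_grad unit_square \<xi> \<xi>) =
          2 * (sqrt \<epsilon> * inner_grad unit_square \<theta> \<theta>) + 2 * (sqrt \<epsilon> * inner_grad unit_square \<xi> \<xi>)"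
        by (simp add: distrib_left)
      then show ?thesis using facts BS by linarith
    qed
    also have "\<dots> \<le> S * (L ^ 3 / n\<^sup>2)"
      using mult_left_mono[OF LB(2), of "Ca\<^sup>2"] unfolding S_def distrib_right by simp
    finally have H1_error: "sqrt \<epsilon> * inner_grad unit_square (\<lambda>p. u \<epsilon> p - uN p) (\<lambda>p. u \<epsilon> p - uN p) \<le> S * (L ^ 3 / n\<^sup>2)"
      by (simp only: sum)
    have "inner_L2 unit_square (\<lambda>p. \<theta> p + \<xi> p) (\<lambda>p. \<theta> p + \<xi> p) \<le> 2 * inner_L2 unit_square \<theta> \<theta> + 2 * inner_L2 unit_square \<xi> \<xi>"
      by (intro inner_L2_add_self_le H1_L2 H)
    also have "\<dots> \<le> 2 * (Ca\<^sup>2 * (1 / n ^ 4)) + 2 * (max 0 B * (L ^ 3 / n\<^sup>2))"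
      using facts BS by linarith
    also have "\<dots> \<le> S * (L ^ 3 / n\<^sup>2)"
      using mult_left_mono[OF LB(3), of "Ca\<^sup>2"] unfolding S_def distrib_right by simp
    finally have L2_error: "inner_L2 unit_square (\<lambda>p. u \<epsilon> p - uN p) (\<lambda>p. u \<epsilon> p - uN p) \<le> S * (L ^ 3 / n\<^sup>2)"
      by (simp only: sum)
    have root: "r \<le> sqrt S * (1 / n * L powr (3/2))" if "r\<^sup>2 \<le> S * (L ^ 3 / n\<^sup>2)" for r
    proof (rule power2_le_imp_le)
      have "(L powr (3/2))\<^sup>2 = L ^ 3"
        using L1 by (simp add: powr_powr flip: powr_numeral)
      then have "(sqrt S * (1 / n * L powr (3/2)))\<^sup>2 = S * (L ^ 3 / n\<^sup>2)"
        using S0 by (simp add: power_mult_distrib power_divide)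
      then show "r\<^sup>2 \<le> (sqrt S * (1 / n * L powr (3/2)))\<^sup>2"
        using that by simp
      show "0 \<le> sqrt S * (1 / n * L powr (3/2))"
        using S0 by (simp add: n_def)
    qed
    have "\<epsilon> powr (1/4) * seminorm_H1 \<Omega> (\<lambda>p. u \<epsilon> p - uN p) \<le> sqrt S * (1 / n * L powr (3/2))"
      by (rule root) (use H1_error \<epsilon> in \<open>simp add: power_mult_distrib powr_quarter seminorm_H1_square \<Omega>_def\<close>)
    moreover have "norm_L2 \<Omega> (\<lambda>p. u \<epsilon> p - uN p) \<le> sqrt S * (1 / n * L powr (3/2))"
      by (rule root) (use L2_error in \<open>simp add: norm_L2_square \<Omega>_def\<close>)
    moreover have "0 \<le> 2 * sqrt S * (1 / n ^ 2)"
      using S0 by simp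
    ultimately show "\<epsilon> powr (1/4) * seminorm_H1 \<Omega> (\<lambda>x. u \<epsilon> x - uN x) + norm_L2 \<Omega> (\<lambda>x. u \<epsilon> x - uN x)
        \<le> 2 * sqrt S * (1 / real N * ln (real N) powr (3/2) + 1 / real N ^ 2)"
      unfolding n_def L_def distrib_left by linarith
  qed
qed

end
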